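(* Let $d>2$ be an even integer. Let $g_1,g_2\in\mathcal{S}(\mathbb{R}^d)$ be (real-valued) radial functions and let $f_1,f_2\in L^2(\mathbb{R}^d)\otimes\mathbb{R}_d$. Then $$\int_{\mathbb{R}^{2d}}\overline{\mathcal{V}_{g_1}f_1(x,\omega)}\,\mathcal{V}_{g_2}f_2(x,\omega)\,d\omega\,dx=\langle f_1,f_2\rangle\left(\int_{\mathbb{R}^d}g_1(z)g_2(z)\,dz\right).$$
   Context: $\mathbb{R}_d$ is the real Clifford algebra generated by $e_1,\dots,e_d$ with $e_je_k+e_ke_j=-2\delta_{jk}$; a vector $x\in\mathbb{R}^d$ is identified with $\underline{x}=\sum_j x_je_j$, with Euclidean norm $|\underline{x}|$, and $\underline{x}\wedge\underline{y}=\sum_{j<k}e_je_k(x_jy_k-x_ky_j)$. Clifford conjugation is the real-linear map with $\overline{e_j}=-e_j$, $\overline{ab}=\bar b\,\bar a$. For $a=\sum_A a_Ae_A$, $|a|=(\sum_A a_A^2)^{1/2}$. $L^2(\mathbb{R}^d)\otimes\mathbb{R}_d$ is the space of $f:\mathbb{R}^d\to\mathbb{R}_d$ with $\|f\|_2^2=\int|f|^2<\infty$, and $\langle f,g\rangle=\int_{\mathbb{R}^d}\overline{f(x)}g(x)\,dx\in\mathbb{R}_d$. Radial means $g(x)=g_0(|\underline{x}|)$ with $g_0$ real-valued. Put $\lambda=\frac{d-2}{2}$. For $d$ even the Clifford-Fourier kernel $K_-(x,y)=e^{i\frac{\pi}{2}\Gamma_{\underline y}}e^{-i\langle\underline x,\underline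 y\rangle}$ (where $\Gamma_{\underline y}=-\sum_{j<k}e_je_k(y_j\partial_{y_k}-y_k\partial_{y_j})$) is the $\mathbb{R}_d$-valued function $$K_-(x,y)=(-1)^{\lambda+1}\left(\tfrac{\pi}{2}\right)^{1/2}\left(A^*_\lambda(s,t)+B^*_\lambda(s,t)+(\underline x\wedge\underline y)C^*_\lambda(s,t)\right),$$ with $s=\langle\underline x,\underline y\rangle=\sum_j x_jy_j$, $t=\sqrt{|\underline x|^2|\underline y|^2-s^2}$, $\tilde J_\alpha(t)=t^{-\alpha}J_\alpha(t)$ ($J_\alpha$ the Bessel function; value at $t=0$ by continuity), and $A^*_\lambda=\sum_{l=0}^{\lfloor\frac{\lambda+1}{2}-\frac34\rfloor}s^{\lambda-1-2l}\frac{1}{2^ll!}\frac{\Gamma(\lambda+1)}{\Gamma(\lambda-2l)}\tilde J_{(2\lambda-2l-1)/2}(t)$, $B^*_\lambda=-\sum_{l=0}^{\lfloor\lambda/2\rfloor}s^{\lambda-2l}\frac{1}{2^ll!}\frac{\Gamma(\lambda+1)}{\Gamma(\lambda-2l+1)}\tilde J_{(2\lambda-2l-1)/2}(t)$, $C^*_\lambda=-\sum_{l=0}^{\lfloor\lambda/2\rfloor}s^{\lambda-2l}\frac{1}{2^ll!}\frac{\Gamma(\lambda+1)}{\Gamma(\lambda-2l+1)}\tilde J_{(2\lambda-2l+1)/2}(t)$. The Clifford short-time Fourier transform of $f$ with radial window $g$ is $$\mathcal{V}_gf(x,\omega)=(2\pi)^{-\frac d2}\int_{\mathbb{R}^d}K_-(t,\omega)\,g(t-x)\,f(t)\,dt,\qquad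 x,\omega\in\mathbb{R}^d.$$ *)

theory Defs
  imports "HOL-Analysis.Analysis"
begin

section \<open>The real Clifford algebra\<close>

text \<open>
  The dimension is \<open>d = CARD('n)\<close>; the linear order on \<open>'n\<close> numbers the generators.
  An element \<open>a = \<Sum>\<^sub>A a\<^sub>A e\<^sub>A\<close> is the family of its coefficients, where \<open>A\<close> ranges over the
  subsets of the index set and \<open>e\<^sub>A\<close> is the product of the generators \<open>e\<^sub>j\<close>, \<open>j \<in> A\<close>, in increasing
  order. The norm inherited from the vector type is \<open>(\<Sum>\<^sub>A a\<^sub>A\<^sup>2)\<^sup>1\<^sup>/\<^sup>2\<close>. The inherited \<open>*\<close> is componentwise
  and is not the Clifford product, which is \<open>\<odot>\<close> below.
\<close>

type_synonym 'n clifford = "(real, 'n set) vec"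

definition cbasis :: "'n::finite set \<Rightarrow> 'n clifford" where
  "cbasis A = axis A 1"

abbreviation cone :: "'n::finite clifford" where
  "cone \<equiv> cbasis {}"

abbreviation cgen :: "'n::finite \<Rightarrow> 'n clifford" where
  "cgen j \<equiv> cbasis {j}"

text \<open>
  Sorting \<open>e\<^sub>A e\<^sub>B\<close> costs a factor \<open>-1\<close> for every pair \<open>b < a\<close> with \<open>a \<in> A\<close>, \<open>b \<in> B\<close> (anticommutation)
  and another one for every common index (\<open>e\<^sub>j\<^sup>2 = -1\<close>).
\<close>

definition csign :: "'n::{finite,linorder} set \<Rightarrow> 'n set \<Rightarrow> real" where
  "csign A B = (-1) ^ card {(a, b). a \<in> A \<and> b \<in> B \<and> b \<le> a}"

definition cmult :: "'n::{finite,linorder} clifford \<Rightarrow> 'n clifford \<Rightarrow> 'n clifford"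
    (infixl "\<odot>" 70) where
  "a \<odot> b = (\<Sum>A\<in>UNIV. \<Sum>B\<in>UNIV. (a $ A * b $ B * csign A B) *\<^sub>R cbasis (sym_diff A B))"

text \<open>
  Reversing a product of \<open>k\<close> distinct generators gives \<open>(-1)^(k(k-1)/2)\<close>, and the \<open>k\<close> sign changes
  \<open>e\<^sub>j \<mapsto> -e\<^sub>j\<close> turn this into \<open>(-1)^(k(k+1)/2)\<close>.
\<close>

definition cconj :: "'n::finite clifford \<Rightarrow> 'n clifford" where
  "cconj a = (\<chi> A. (-1) ^ (card A * (card A + 1) div 2) * a $ A)"

definition wedge :: "(real, 'n::{finite,linorder}) vec \<Rightarrow> (real, 'n) vec \<Rightarrow> 'n clifford" where
  "wedge x y = (\<Sum>(j, k) | j < k. (x $ j * y $ k - x $ k * y $ j) *\<^sub>R (cgen j \<odot> cgen k))"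


subsection \<open>The defining properties hold in this model\<close>

lemma csign_prod: "csign A B = (\<Prod>a\<in>A. \<Prod>b\<in>B. if b \<le> a then -1 else 1)"
proof -
  have "{(a, b). a \<in> A \<and> b \<in> B \<and> b \<le> a} = (SIGMA a:A. {b \<in> B. b \<le> a})" by auto
  then have "csign A B = (\<Prod>a\<in>A. (-1) ^ card {b \<in> B. b \<le> a})"
    by (simp add: csign_def power_sum)
  also have "\<dots> = (\<Prod>a\<in>A. \<Prod>b\<in>B. if b \<le> a then -1 else 1)"
    by (intro prod.cong refl) (simp add: prod.If_cases Int_def)
  finally show ?thesis .
qed

lemma prod_sym_diff:
  fixes h :: "'n::finite \<Rightarrow> real"
  assumes "\<And>x. h x * h x = 1"
  shows "prod h (sym_diff A B) = prod h A * prod h B"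
proof -
  have "prod h A = prod h (A - B) * prod h (A \<inter> B)"
    by (subst prod.union_disjoint[symmetric]) (auto intro!: prod.cong)
  moreover have "prod h B = prod h (B - A) * prod h (A \<inter> B)"
    by (subst prod.union_disjoint[symmetric]) (auto intro!: prod.cong)
  moreover have "prod h (A \<inter> B) * prod h (A \<inter> B) = 1"
    by (simp add: prod.distrib[symmetric] assms)
  moreover have "prod h (sym_diff A B) = prod h (A - B) * prod h (B - A)"
    by (subst prod.union_disjoint) auto
  ultimately show ?thesis by (simp add: algebra_simps)
qed

lemma csign_square: "csign A B * csign A B = 1"
  by (simp add: csign_def flip: power_add mult_2)

lemma csign_sym_diff_left: "csign (sym_diff A B) C = csign A C * csign B C"
  unfolding csign_prod
  by (rule prod_sym_diff) (auto simp: prod.distrib[symmetric] intro!: prod.neutral)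

lemma csign_sym_diff_right: "csign A (sym_diff B C) = csign A B * csign A C"
proof -
  have *: "csign A B = (\<Prod>b\<in>B. \<Prod>a\<in>A. if b \<le> a then -1 else 1)" for B
    unfolding csign_prod by (rule prod.swap)
  show ?thesis
    unfolding * by (rule prod_sym_diff) (auto simp: prod.distrib[symmetric] intro!: prod.neutral)
qed

lemma cbasis_nth: "cbasis A $ B = (if B = A then 1 else 0)"
  by (simp add: cbasis_def axis_def)

lemma cbasis_expansion: "a = (\<Sum>A\<in>UNIV. (a $ A) *\<^sub>R cbasis A)"
  by (simp add: vec_eq_iff cbasis_nth if_distrib cong: if_cong)

lemma bilinear_cmult: "bilinear (\<odot>)"
  unfolding bilinear_def cmult_def
  by (auto intro!: linearI simp: algebra_simps sum.distrib scaleR_add_left scaleR_sum_right)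

lemma cmult_basis: "cbasis A \<odot> cbasis B = csign A B *\<^sub>R cbasis (sym_diff A B)"
proof -
  have "cbasis A \<odot> cbasis B = (\<Sum>A'\<in>UNIV. \<Sum>B'\<in>UNIV.
      if B' = B then if A' = A then csign A B *\<^sub>R cbasis (sym_diff A B) else 0 else 0)"
    unfolding cmult_def by (intro sum.cong refl) (auto simp: cbasis_nth)
  then show ?thesis by simp
qed

lemma linear_eq_on_cbasis:
  assumes "linear f" "linear g" "\<And>A. f (cbasis A) = g (cbasis A)"
  shows "f a = g a"
proof -
  have "h a = (\<Sum>A\<in>UNIV. (a $ A) *\<^sub>R h (cbasis A))" if "linear h" for h
    using arg_cong[OF cbasis_expansion[of a], of h] that
    by (simp add: linear_sum linear_scale)
  from this[OF assms(1)] this[OF assms(2)] show ?thesis by (simp add: assms(3))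
qed

lemma linear_cmult_left: "linear h \<Longrightarrow> linear (\<lambda>x. h x \<odot> b)"
  and linear_cmult_right: "linear h \<Longrightarrow> linear (\<lambda>x. b \<odot> h x)"
  using bilinear_cmult linear_compose[of h "\<lambda>x. x \<odot> b"] linear_compose[of h "\<lambda>x. b \<odot> x"]
  by (auto simp: bilinear_def o_def)

lemmas linear_cmult_intros = linear_cmult_left linear_cmult_right linear_ident

lemma cmult_assoc: "(a \<odot> b) \<odot> c = a \<odot> (b \<odot> c)"
proof -
  have s: "sym_diff (sym_diff A B) C = sym_diff A (sym_diff B C)" for A B C :: "'a set"
    by auto
  have 1: "(cbasis A \<odot> cbasis B) \<odot> cbasis C = cbasis A \<odot> (cbasis B \<odot> cbasis C)"
    for A B C :: "'a set"
    by (simp add: cmult_basis bilinear_lmul[OF bilinear_cmult] bilinear_rmul[OF bilinear_cmult]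
        csign_sym_diff_left csign_sym_diff_right s mult_ac)
  have 2: "(cbasis A \<odot> cbasis B) \<odot> c = cbasis A \<odot> (cbasis B \<odot> c)" for A B
    by (rule linear_eq_on_cbasis[where a = c]) (intro linear_cmult_intros 1)+
  have 3: "(cbasis A \<odot> b) \<odot> c = cbasis A \<odot> (b \<odot> c)" for A
    by (rule linear_eq_on_cbasis[where a = b]) (intro linear_cmult_intros 2)+
  show ?thesis
    by (rule linear_eq_on_cbasis[where a = a]) (intro linear_cmult_intros 3)+
qed

lemma cone_cmult: "cone \<odot> a = a" and cmult_cone: "a \<odot> cone = a"
  by (rule linear_eq_on_cbasis[where a = a];
      (intro linear_cmult_intros)?; simp add: cmult_basis csign_def)+

lemma cgen_anticommute:
  "cgen j \<odot> cgen k + cgen k \<odot> cgen j = (if j = k then - 2 else 0) *\<^sub>R cone"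
proof -
  have "csign {j} {k} = (if k \<le> j then -1 else 1)" for j k :: 'a
    by (simp add: csign_prod)
  moreover have "sym_diff {j} {k} = sym_diff {k} {j}" by auto
  ultimately show ?thesis
    by (auto simp: cmult_basis simp flip: scaleR_add_left)
qed

lemma cbasis_insert:
  assumes "\<And>a. a \<in> A \<Longrightarrow> a < k"
  shows "cbasis (insert k A) = cbasis A \<odot> cgen k"
proof -
  have "csign A {k} = 1"
    unfolding csign_prod using assms by (auto intro!: prod.neutral simp: not_le)
  moreover have "sym_diff A {k} = insert k A" using assms by auto
  ultimately show ?thesis by (simp add: cmult_basis)
qed

lemma linear_cconj: "linear cconj"
  by (rule linearI) (simp_all add: cconj_def vec_eq_iff algebra_simps)

lemma cconj_basis: "cconj (cbasis A) = (-1) ^ (card A * (card A + 1) div 2) *\<^sub>R cbasis A"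
  by (simp add: cconj_def vec_eq_iff cbasis_nth)

lemma cconj_cgen: "cconj (cgen j) = - cgen j"
  by (simp add: cconj_basis)

lemma csign_self: "csign A A = (-1) ^ (card A * (card A + 1) div 2)"
proof -
  have "card {(a, b). a \<in> A \<and> b \<in> A \<and> b \<le> a} = card A * (card A + 1) div 2"
    using finite[of A]
  proof (induction A rule: finite_linorder_max_induct)
    case empty
    then show ?case by simp
  next
    case (insert k A)
    have "{(a, b). a \<in> insert k A \<and> b \<in> insert k A \<and> b \<le> a}
        = {(a, b). a \<in> A \<and> b \<in> A \<and> b \<le> a} \<union> Pair k ` insert k A"
      using insert.hyps by (auto dest: leD less_imp_le)
    moreover have "{(a, b). a \<in> A \<and> b \<in> A \<and> b \<le> a} \<inter> Pair k ` insert k A = {}"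
      using insert.hyps by auto
    ultimately have "card {(a, b). a \<in> insert k A \<and> b \<in> insert k A \<and> b \<le> a}
        = card {(a, b). a \<in> A \<and> b \<in> A \<and> b \<le> a} + card (insert k A)"
      by (simp only: card_Un_disjoint[OF finite finite], subst card_image, auto simp: inj_on_def)
    moreover have "k \<notin> A" using insert.hyps by auto
    ultimately show ?case using insert.IH by simp
  qed
  then show ?thesis by (simp add: csign_def)
qed

lemma cconj_cmult: "cconj (a \<odot> b) = cconj b \<odot> cconj a"
proof -
  have 1: "cconj (cbasis A \<odot> cbasis B) = cconj (cbasis B) \<odot> cconj (cbasis A)" for A B :: "'a set"
  proof -
    have "csign A B * csign (sym_diff A B) (sym_diff A B)
        = csign A A * csign B B * csign B A * (csign A B * csign A B)"
      by (simp only: csign_sym_diff_left csign_sym_diff_right mult_ac)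
    moreover have "sym_diff A B = sym_diff B A" by auto
    moreover have "cconj (cbasis A) = csign A A *\<^sub>R cbasis A" for A :: "'a set"
      by (simp only: cconj_basis csign_self)
    ultimately show ?thesis
      by (simp add: cmult_basis linear_scale[OF linear_cconj] csign_square
          bilinear_lmul[OF bilinear_cmult] bilinear_rmul[OF bilinear_cmult] mult_ac)
  qed
  note l = linear_cmult_intros linear_cconj linear_compose[OF _ linear_cconj, unfolded o_def]
  have 2: "cconj (cbasis A \<odot> b) = cconj b \<odot> cconj (cbasis A)" for A
    by (rule linear_eq_on_cbasis[where a = b]) (intro l 1)+
  show ?thesis
    by (rule linear_eq_on_cbasis[where a = a]) (intro l 2)+
qed


section \<open>Function spaces\<close>

definition L2_clifford :: "((real, 'n::finite) vec \<Rightarrow> 'n clifford) set" where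
  "L2_clifford = {f \<in> borel_measurable lebesgue. integrable lebesgue (\<lambda>x. (norm (f x))\<^sup>2)}"

definition cinner ::
  "((real, 'n::{finite,linorder}) vec \<Rightarrow> 'n clifford) \<Rightarrow> ((real, 'n) vec \<Rightarrow> 'n clifford) \<Rightarrow> 'n clifford" where
  "cinner f g = (LINT x|lebesgue. cconj (f x) \<odot> g x)"

definition radial :: "((real, 'n::finite) vec \<Rightarrow> real) \<Rightarrow> bool" where
  "radial g \<longleftrightarrow> (\<exists>g0 :: real \<Rightarrow> real. \<forall>x. g x = g0 (norm x))"

text \<open>
  Iterated partial derivatives are indexed by lists of coordinate directions. A function is smooth
  iff all of them exist and are (totally) differentiable.
\<close>

definition partial_deriv :: "'n::finite \<Rightarrow> ((real, 'n) vec \<Rightarrow> real) \<Rightarrow> (real, 'n) vec \<Rightarrow> real" where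
  "partial_deriv j g x = frechet_derivative g (at x) (axis j 1)"

definition partial_derivs :: "'n::finite list \<Rightarrow> ((real, 'n) vec \<Rightarrow> real) \<Rightarrow> (real, 'n) vec \<Rightarrow> real" where
  "partial_derivs js g = foldr partial_deriv js g"

definition schwartz :: "((real, 'n::finite) vec \<Rightarrow> real) set" where
  "schwartz = {g. \<forall>js. (\<forall>x. partial_derivs js g differentiable at x) \<and>
                       (\<forall>k. bounded (range (\<lambda>x. norm x ^ k * partial_derivs js g x)))}"


section \<open>The Clifford-Fourier kernel in even dimension\<close>

text \<open>Only valid for \<open>t > 0\<close>, because of \<open>powr\<close>.\<close>

definition bessel_J :: "real \<Rightarrow> real \<Rightarrow> real" where
  "bessel_J \<alpha> t = (\<Sum>m. (-1) ^ m / (fact m * Gamma (real m + \<alpha> + 1)) * (t / 2) powr (2 * real m + \<alpha>))"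

definition bessel_J_tilde :: "real \<Rightarrow> real \<Rightarrow> real" where
  "bessel_J_tilde \<alpha> t =
     (if t = 0 then Lim (at_right 0) (\<lambda>u. u powr (- \<alpha>) * bessel_J \<alpha> u)
      else t powr (- \<alpha>) * bessel_J \<alpha> t)"

lemma summable_bessel:
  "summable (\<lambda>m. (-1) ^ m / (fact m * Gamma (real m + \<alpha> + 1)) * (y :: real) ^ m)"
proof -
  define N where "N = nat \<lceil>2 * \<bar>y\<bar> + \<bar>\<alpha>\<bar> + 1\<rceil>"
  show ?thesis
  proof (rule summable_ratio_test[of "1 / 2" N])
    fix m assume m: "m \<ge> N"
    then have mN: "real m \<ge> 2 * \<bar>y\<bar> + \<bar>\<alpha>\<bar> + 1" unfolding N_def by linarith
    define z where "z = real m + \<alpha> + 1"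
    have z: "z \<ge> 2 * \<bar>y\<bar>" "z > 0" using mN by (auto simp: z_def)
    have G: "Gamma (real (Suc m) + \<alpha> + 1) = z * Gamma z"
    proof -
      have "z \<notin> \<int>\<^sub>\<le>\<^sub>0" using z by (auto elim!: nonpos_Ints_cases)
      then show ?thesis using Gamma_plus1[of z] by (simp add: z_def add_ac)
    qed
    have "Gamma z > 0" using z by (simp add: Gamma_real_pos)
    have "\<bar>y\<bar> \<le> 1 / 2 * (real (Suc m) * z)"
    proof -
      have "2 * \<bar>y\<bar> \<le> 1 * z" using z by simp
      also have "\<dots> \<le> real (Suc m) * z" using z by (intro mult_right_mono) auto
      finally show ?thesis by simp
    qed
    then have "\<bar>y\<bar> / (real (Suc m) * z) \<le> 1 / 2"
      using z by (simp add: field_simps del: of_nat_Suc)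
    then have "\<bar>y\<bar> / (real (Suc m) * z) * (\<bar>y\<bar> ^ m / (fact m * Gamma z))
        \<le> 1 / 2 * (\<bar>y\<bar> ^ m / (fact m * Gamma z))"
      using \<open>Gamma z > 0\<close> by (intro mult_right_mono) auto
    then show "norm ((-1) ^ Suc m / (fact (Suc m) * Gamma (real (Suc m) + \<alpha> + 1)) * y ^ Suc m)
        \<le> 1 / 2 * norm ((-1) ^ m / (fact m * Gamma (real m + \<alpha> + 1)) * y ^ m)"
      unfolding G using z \<open>Gamma z > 0\<close>
      by (simp add: abs_mult power_abs z_def[symmetric] mult_ac)
  qed simp
qed

lemma bessel_J_tilde_series:
  assumes "t \<ge> 0"
  shows "bessel_J_tilde \<alpha> t =
    2 powr (- \<alpha>) * (\<Sum>m. (-1) ^ m / (fact m * Gamma (real m + \<alpha> + 1)) * ((t / 2)\<^sup>2) ^ m)"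
proof -
  define c :: "nat \<Rightarrow> real" where "c m = (-1) ^ m / (fact m * Gamma (real m + \<alpha> + 1))" for m
  have summ: "summable (\<lambda>m. c m * y ^ m)" for y
    unfolding c_def by (rule summable_bessel)
  have pos: "u powr (- \<alpha>) * bessel_J \<alpha> u = 2 powr (- \<alpha>) * (\<Sum>m. c m * ((u / 2)\<^sup>2) ^ m)"
    if "u > 0" for u
  proof -
    have "c m * (u / 2) powr (2 * real m + \<alpha>) = (u / 2) powr \<alpha> * (c m * ((u / 2)\<^sup>2) ^ m)" for m
      using that powr_realpow[of "u / 2" "2 * m"]
      by (simp add: powr_add power_mult)
    then have "bessel_J \<alpha> u = (u / 2) powr \<alpha> * (\<Sum>m. c m * ((u / 2)\<^sup>2) ^ m)"
      unfolding bessel_J_def c_def[symmetric] by (simp only: suminf_mult[OF summ])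
    moreover have "u powr (- \<alpha>) * (u / 2) powr \<alpha> = 2 powr (- \<alpha>)"
      using that by (simp add: powr_divide powr_minus field_simps)
    ultimately show ?thesis by (simp flip: mult.assoc)
  qed
  show ?thesis
  proof (cases "t = 0")
    case True
    have "isCont (\<lambda>y. \<Sum>m. c m * y ^ m) 0"
      by (rule isCont_powser[of _ 1], rule summ) simp
    then have "isCont (\<lambda>y. \<Sum>m. c m * y ^ m) (((0::real) / 2)\<^sup>2)" by simp
    then have "((\<lambda>u. 2 powr (- \<alpha>) * (\<Sum>m. c m * ((u / 2)\<^sup>2) ^ m))
        \<longlongrightarrow> 2 powr (- \<alpha>) * (\<Sum>m. c m * ((0 / 2)\<^sup>2) ^ m)) (at_right 0)"
      by (intro tendsto_mult tendsto_const isCont_tendsto_compose[where g = "\<lambda>y. \<Sum>m. c m * y ^ m"])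
        (auto intro!: tendsto_eq_intros)
    then have "((\<lambda>u. u powr (- \<alpha>) * bessel_J \<alpha> u)
        \<longlongrightarrow> 2 powr (- \<alpha>) * (\<Sum>m. c m * ((0 / 2)\<^sup>2) ^ m)) (at_right 0)"
      by (rule Lim_transform_eventually) (auto simp: eventually_at_filter pos)
    then have "Lim (at_right 0) (\<lambda>u. u powr (- \<alpha>) * bessel_J \<alpha> u)
        = 2 powr (- \<alpha>) * (\<Sum>m. c m * ((0 / 2)\<^sup>2) ^ m)"
      by (intro tendsto_Lim) auto
    then show ?thesis using True by (simp add: bessel_J_tilde_def c_def)
  next
    case False
    then show ?thesis using assms pos[of t] by (simp add: bessel_J_tilde_def c_def)
  qed
qed

text \<open>
  In the first sum the upper bound is \<open>-1\<close> for \<open>\<lambda> = 0\<close>, hence the comparison of integers. In each sum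
  the exponent of \<open>s\<close> is nonnegative, so the subtractions on naturals do not truncate.
\<close>

definition A_star :: "nat \<Rightarrow> real \<Rightarrow> real \<Rightarrow> real" where
  "A_star l s t = (\<Sum>k | int k \<le> \<lfloor>(real l + 1) / 2 - 3 / 4\<rfloor>.
     s ^ (l - 1 - 2 * k) * (1 / (2 ^ k * fact k)) * (Gamma (real l + 1) / Gamma (real l - 2 * real k))
       * bessel_J_tilde ((2 * real l - 2 * real k - 1) / 2) t)"

definition B_star :: "nat \<Rightarrow> real \<Rightarrow> real \<Rightarrow> real" where
  "B_star l s t = - (\<Sum>k | int k \<le> \<lfloor>real l / 2\<rfloor>.
     s ^ (l - 2 * k) * (1 / (2 ^ k * fact k)) * (Gamma (real l + 1) / Gamma (real l - 2 * real k + 1))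
       * bessel_J_tilde ((2 * real l - 2 * real k - 1) / 2) t)"

definition C_star :: "nat \<Rightarrow> real \<Rightarrow> real \<Rightarrow> real" where
  "C_star l s t = - (\<Sum>k | int k \<le> \<lfloor>real l / 2\<rfloor>.
     s ^ (l - 2 * k) * (1 / (2 ^ k * fact k)) * (Gamma (real l + 1) / Gamma (real l - 2 * real k + 1))
       * bessel_J_tilde ((2 * real l - 2 * real k + 1) / 2) t)"

text \<open>
  The closed form, for even dimension \<open>d\<close>, of \<open>exp (i \<pi>/2 \<Gamma>\<^sub>y) exp (- i \<langle>x, y\<rangle>)\<close> with
  \<open>\<Gamma>\<^sub>y = - \<Sum>\<^sub>j\<^sub><\<^sub>k e\<^sub>j e\<^sub>k (y\<^sub>j \<partial>\<^sub>y\<^sub>k - y\<^sub>k \<partial>\<^sub>y\<^sub>j)\<close>; here \<open>l\<close> is \<open>\<lambda> = (d - 2) / 2\<close>.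
\<close>

definition K_minus :: "(real, 'n::{finite,linorder}) vec \<Rightarrow> (real, 'n) vec \<Rightarrow> 'n clifford" where
  "K_minus x y =
    (let l = (CARD('n) - 2) div 2;
         s = x \<bullet> y;
         t = sqrt ((norm x)\<^sup>2 * (norm y)\<^sup>2 - s\<^sup>2)
     in ((-1) ^ (l + 1) * (pi / 2) powr (1 / 2)) *\<^sub>R
          ((A_star l s t + B_star l s t) *\<^sub>R cone + C_star l s t *\<^sub>R wedge x y))"

definition clifford_STFT ::
  "((real, 'n::{finite,linorder}) vec \<Rightarrow> real) \<Rightarrow> ((real, 'n) vec \<Rightarrow> 'n clifford)
     \<Rightarrow> (real, 'n) vec \<Rightarrow> (real, 'n) vec \<Rightarrow> 'n clifford" where
  "clifford_STFT g f x \<omega> = (2 * pi) powr (- real CARD('n) / 2) *\<^sub>R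
     (LINT t|lebesgue. K_minus t \<omega> \<odot> (g (t - x) *\<^sub>R f t))"

end

theory Submission
  imports Defs "HOL-Probability.Characteristic_Functions" "HOL-Probability.Sinc_Integral"
begin

text \<open>
  For fixed \<open>x\<close>, the Clifford-Fourier transform with kernel \<open>K_minus\<close> is a Fourier transform followed by
  the unitary operator \<open>exp (i \<pi>/2 \<Gamma>)\<close>, so it satisfies a Plancherel formula with values in the Clifford
  algebra; applying it to \<open>g (\<cdot> - x) f\<close> and integrating over \<open>x\<close> with Fubini gives the orthogonality relation.

  Unitarity is proved along the flow \<open>u\<^sub>\<theta> = exp (i \<theta> \<Gamma>\<^sub>y) exp (- i \<langle>x, y\<rangle>)\<close>. In terms of \<open>s = \<langle>x, y\<rangle>\<close>,
  \<open>p = |x|\<^sup>2 |y|\<^sup>2\<close> and the bivector \<open>W = x \<and> y\<close>, write \<open>u = a(s, p) + b(s, p) W\<close>; then \<open>\<Gamma>\<close> maps \<open>(a, b)\<close> to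
  \<open>((d - 1) s b - (p - s\<^sup>2) b\<^sub>s, a\<^sub>s + (d - 2) b)\<close>. In dimension 2 the flow is
  \<open>exp (- i s cos \<theta>) (cos (t sin \<theta>) + W sin (t sin \<theta>) / t)\<close> with \<open>t\<^sup>2 = p - s\<^sup>2\<close>, and the step
  \<open>(a, b) \<mapsto> i exp (i \<theta>) (a\<^sub>s - b, b\<^sub>s)\<close> raises the dimension by 2. At \<open>\<theta> = 0\<close> this is the Fourier kernel
  and at \<open>\<theta> = \<pi>/2\<close> it is \<open>K_minus\<close>. Since \<open>\<Gamma>\<close> is symmetric and annihilates radial functions, the integral
  of \<open>u\<^sub>\<theta>(x, y)\<^sup>* u\<^sub>\<theta>(x', y)\<close> against a Gaussian in \<open>y\<close> does not depend on \<open>\<theta>\<close>; at \<open>\<theta> = 0\<close> it is a heat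
  kernel in \<open>x - x'\<close>, and Plancherel follows by letting the Gaussian tend to 1.
\<close>

section \<open>The Clifford algebra\<close>

text \<open>Raising the dimension works because D (a, b) = (a_s - b, b_s) intertwines the operators:
  \<Gamma> in dimension d + 2 after D equals D after \<Gamma> + 1 in dimension d. The factor exp (i
  \<theta>) absorbs the shift by 1, and the factor i keeps the value exp (- i s) at \<theta> = 0. At
  \<theta> = \<pi>/2 the two factors multiply to -1, so the kernel is made of iterated s-derivatives
  of Bessel functions of p - s^2; expanding them produces the sums \<open>A_star\<close>,
  \<open>B_star\<close> and \<open>C_star\<close>. The obstacle is convergence. The kernel is
  bounded only by polynomials in both variables. The transform is therefore applied to functions
  with all moments, which a Schwartz window provides, and the frequency integral needs the Gaussian
  before Fubini applies. Removing the Gaussian requires integrability of the limit: for one function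
  the coefficient of 1 in the product is the squared norm, so monotone convergence yields it, and
  the product of two different transforms is then dominated.\<close>

lemma bounded_bilinear_cmult: "bounded_bilinear (\<odot>)"
  using bilinear_cmult by (simp add: bilinear_conv_bounded_bilinear)

interpretation cmult: bounded_bilinear "(\<odot>)"
  by (rule bounded_bilinear_cmult)

lemma bounded_linear_cconj: "bounded_linear cconj"
  using linear_cconj linear_conv_bounded_linear by blast

lemmas cconj_add = linear_add[OF linear_cconj]
  and cconj_scaleR = linear_scale[OF linear_cconj]
  and cconj_sum = linear_sum[OF linear_cconj]

lemma cconj_cone [simp]: "cconj cone = cone"
  by (simp add: cconj_basis)

declare cone_cmult [simp] cmult_cone [simp]

text \<open>Only pairs of equal index sets contribute to the coefficient of 1, and there the sign of
  the conjugation cancels \<open>csign A A\<close>. This extracts norm identities from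
  Clifford-valued ones.\<close>

lemma cmult_cconj_scalar_part: "(cconj a \<odot> a) $ {} = (norm a)\<^sup>2"
proof -
  have "(cconj a \<odot> a) $ {} = (\<Sum>A\<in>UNIV. \<Sum>B\<in>UNIV. cconj a $ A * a $ B * csign A B * (if sym_diff A B
      = {} then 1 else 0))"
    unfolding cmult_def by (simp add: cbasis_nth eq_commute[of "{}"])
  also have "\<dots> = (\<Sum>A\<in>UNIV. \<Sum>B\<in>UNIV. if B = A then cconj a $ A * a $ A * csign A A else 0)"
    by (intro sum.cong refl) auto
  also have "\<dots> = (\<Sum>A\<in>UNIV. (a $ A)\<^sup>2)"
    by (simp add: csign_self cconj_def power2_eq_square algebra_simps flip: power_add mult_2)
  finally show ?thesis
    by (simp add: norm_vec_def L2_set_def sum_nonneg)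
qed

section \<open>Vectors and bivectors\<close>

definition cvec :: "(real, 'n::{finite,linorder}) vec \<Rightarrow> 'n clifford" where
  "cvec x = (\<Sum>j\<in>UNIV. (x $ j) *\<^sub>R cgen j)"

lemma linear_cvec: "linear cvec"
  unfolding cvec_def by (auto intro!: linearI simp: algebra_simps sum.distrib scaleR_sum_right)

lemmas cvec_add = linear_add[OF linear_cvec]
  and cvec_scaleR = linear_scale[OF linear_cvec]

lemma cvec_axis: "cvec (axis k 1) = cgen k"
proof -
  have "cvec (axis k 1) = (\<Sum>j\<in>UNIV. if j = k then cgen j else 0)"
    unfolding cvec_def by (intro sum.cong refl) (simp add: axis_def)
  then show ?thesis by simp
qed

lemma cconj_cvec: "cconj (cvec x) = - cvec x"
  unfolding cvec_def by (simp add: cconj_sum cconj_scaleR cconj_cgen sum_negf)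

lemma cvec_cmult_cvec: "cvec x \<odot> cvec y = (\<Sum>j\<in>UNIV. \<Sum>k\<in>UNIV. (x $ j * y $ k) *\<^sub>R (cgen j \<odot> cgen k))"
  unfolding cvec_def
  by (subst sum.swap)
    (simp add: cmult.sum_left cmult.sum_right cmult.scaleR_left cmult.scaleR_right scaleR_sum_right
        mult.commute)

lemma cvec_anticommute: "cvec x \<odot> cvec y + cvec y \<odot> cvec x = (- 2 * (x \<bullet> y)) *\<^sub>R cone"
proof -
  have "cvec x \<odot> cvec y + cvec y \<odot> cvec x
      = (\<Sum>j\<in>UNIV. \<Sum>k\<in>UNIV. (x $ j * y $ k) *\<^sub>R (cgen j \<odot> cgen k + cgen k \<odot> cgen j))"
    unfolding cvec_cmult_cvec by (subst (2) sum.swap) (simp add: scaleR_add_right sum.distrib mult_ac)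
  also have "\<dots> = (\<Sum>j\<in>UNIV. \<Sum>k\<in>UNIV. if k = j then (- 2 * (x $ j * y $ j)) *\<^sub>R cone else 0)"
    by (intro sum.cong refl) (simp add: cgen_anticommute)
  also have "\<dots> = (- 2 * (x \<bullet> y)) *\<^sub>R cone"
    by (simp add: inner_vec_def sum_distrib_left sum_negf flip: scaleR_sum_left)
  finally show ?thesis .
qed

lemma cvec_square: "cvec x \<odot> cvec x = (- (norm x)\<^sup>2) *\<^sub>R cone"
proof -
  have "(2::real) *\<^sub>R (cvec x \<odot> cvec x) = (2::real) *\<^sub>R ((- (norm x)\<^sup>2) *\<^sub>R cone)"
    using cvec_anticommute[of x x] by (simp add: power2_norm_eq_inner scaleR_2)
  then show ?thesis by (simp only: scaleR_cancel_left) simp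
qed

text \<open>In the double sum for the product, the terms with k < j fold onto those with j < k by
  anticommutation, and the diagonal gives minus the inner product. Bivector identities thereby
  reduce to moving vectors past each other.\<close>

lemma wedge_eq:
  fixes x y :: "(real, 'n::{finite,linorder}) vec"
  shows "wedge x y = cvec x \<odot> cvec y + (x \<bullet> y) *\<^sub>R cone"
proof -
  let ?f = "\<lambda>(j, k). (x $ j * y $ k) *\<^sub>R (cgen j \<odot> cgen k)"
  let ?A = "{(j::'n, k). j < k}" and ?B = "{(j::'n, k). k < j}" and ?D = "{(j::'n, k). j = k}"
  have "cvec x \<odot> cvec y = (\<Sum>j\<in>UNIV. \<Sum>k\<in>UNIV. ?f (j, k))"
    by (simp add: cvec_cmult_cvec)
  also have "\<dots> = sum ?f UNIV" by (simp add: sum.cartesian_product)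
  also have "UNIV = ?A \<union> ?B \<union> ?D" by (auto simp: not_less)
  also have "sum ?f \<dots> = sum ?f ?A + sum ?f ?B + sum ?f ?D"
    by (subst sum.union_disjoint; (subst sum.union_disjoint)?) auto
  also have "sum ?f ?B = (\<Sum>(j, k)\<in>?A. - ((x $ k * y $ j) *\<^sub>R (cgen j \<odot> cgen k)))"
  proof (rule sum.reindex_bij_witness[where i = prod.swap and j = prod.swap])
    fix a :: "'n \<times> 'n" assume "a \<in> ?B"
    then obtain j k where a: "a = (j, k)" "k < j" by auto
    then have "cgen j \<odot> cgen k = - (cgen k \<odot> cgen j)"
      using cgen_anticommute[of j k] by (simp add: eq_neg_iff_add_eq_0)
    then show "(case prod.swap a of (j, k) \<Rightarrow> - ((x $ k * y $ j) *\<^sub>R (cgen j \<odot> cgen k))) = ?f a"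
      by (simp add: a)
  qed auto
  also have "sum ?f ?D = (\<Sum>j\<in>UNIV. ?f (j, j))"
    by (rule sum.reindex_bij_witness[where i = "\<lambda>j. (j, j)" and j = fst]) auto
  also have "\<dots> = (\<Sum>j\<in>UNIV. (- (x $ j * y $ j)) *\<^sub>R cone)"
    by (intro sum.cong refl) (simp add: cmult_basis csign_self)
  also have "\<dots> = - ((x \<bullet> y) *\<^sub>R cone)"
    by (simp add: inner_vec_def sum_negf scaleR_sum_left)
  finally show ?thesis
    unfolding wedge_def by (simp add: case_prod_unfold scaleR_diff_left sum_subtractf sum_negf)
qed

lemma bounded_bilinear_wedge: "bounded_bilinear wedge"
proof -
  have "bilinear wedge"
    unfolding bilinear_def wedge_eq
    by (auto intro!: linearI simp: cvec_add cvec_scaleR cmult.add_left cmult.add_right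
        cmult.scaleR_left cmult.scaleR_right algebra_simps)
  then show ?thesis by (simp add: bilinear_conv_bounded_bilinear)
qed

interpretation wedge: bounded_bilinear wedge
  by (rule bounded_bilinear_wedge)

lemma wedge_self [simp]: "wedge x x = 0"
  by (simp add: wedge_eq cvec_square power2_norm_eq_inner)

lemma wedge_commute: "wedge y x = - wedge x y"
  using cvec_anticommute[of x y]
  by (simp add: wedge_eq inner_commute eq_neg_iff_add_eq_0 algebra_simps flip: scaleR_add_left)

lemma cconj_wedge: "cconj (wedge x y) = - wedge x y"
proof -
  have "cconj (wedge x y) = wedge y x"
    by (simp add: wedge_eq cconj_add cconj_scaleR cconj_cmult cconj_cvec cmult.minus_left
        cmult.minus_right inner_commute)
  then show ?thesis by (simp add: wedge_commute[of y x])
qed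

lemma cvec_swap: "cvec y \<odot> cvec x = (- 2 * (x \<bullet> y)) *\<^sub>R cone - cvec x \<odot> cvec y"
  using cvec_anticommute[of x y] by (simp add: algebra_simps)

text \<open>Exchanging the two middle factors of x y x y. The scalar is - t^2 with the t of the
  kernel, so \<open>wedge x y\<close> behaves like t times an imaginary unit.\<close>

lemma wedge_square: "wedge x y \<odot> wedge x y = ((x \<bullet> y)\<^sup>2 - (norm x)\<^sup>2 * (norm y)\<^sup>2) *\<^sub>R cone"
proof -
  let ?X = "cvec x" and ?Y = "cvec y"
  have "?X \<odot> ?Y \<odot> (?X \<odot> ?Y) = ?X \<odot> (?Y \<odot> ?X) \<odot> ?Y" by (simp add: cmult_assoc)
  also have "\<dots> = (- 2 * (x \<bullet> y)) *\<^sub>R (?X \<odot> ?Y) - (?X \<odot> ?X) \<odot> (?Y \<odot> ?Y)"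
    by (simp add: cvec_swap[of y x] cmult.diff_right cmult.diff_left cmult.minus_left
        cmult.minus_right cmult.scaleR_left cmult.scaleR_right cmult_assoc)
  also have "\<dots> = (- 2 * (x \<bullet> y)) *\<^sub>R (?X \<odot> ?Y) - ((norm x)\<^sup>2 * (norm y)\<^sup>2) *\<^sub>R cone"
    by (simp add: cvec_square cmult.scaleR_left cmult.scaleR_right cmult.minus_left cmult.minus_right)
  finally have *: "?X \<odot> ?Y \<odot> (?X \<odot> ?Y) = (- 2 * (x \<bullet> y)) *\<^sub>R (?X \<odot> ?Y) - ((norm x)\<^sup>2 * (norm y)\<^sup>2) *\<^sub>R cone" .
  show ?thesis
    unfolding wedge_eq cmult.add_left cmult.add_right cmult.scaleR_left cmult.scaleR_right *
    by (simp add: vec_eq_iff algebra_simps power2_eq_square)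
qed

lemma vec_eq_sum_axis: "x = (\<Sum>k\<in>UNIV. (x $ k) *\<^sub>R axis k (1::real))"
  by (simp add: vec_eq_iff axis_def if_distrib cong: if_cong)

lemma wedge_axis_right: "(\<Sum>k\<in>UNIV. (y $ k) *\<^sub>R wedge x (axis k 1)) = wedge x y"
  by (subst (2) vec_eq_sum_axis[of y]) (simp add: wedge.sum_right wedge.scaleR_right)

text \<open>Conjugating \<open>cgen j\<close> by \<open>cgen k\<close> gives \<open>cgen j\<close>
  for j \<noteq> k and \<open>- cgen k\<close> for j = k, so each coordinate of x is counted d - 1
  times positively and once negatively.\<close>

lemma sum_cgen_sandwich:
  fixes x :: "(real, 'n::{finite,linorder}) vec"
  shows "(\<Sum>k\<in>UNIV. cgen k \<odot> cvec x \<odot> cgen k) = (real CARD('n) - 2) *\<^sub>R cvec x"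
proof -
  have "cgen k \<odot> cvec x \<odot> cgen k = cvec x - (2 * x $ k) *\<^sub>R cgen k" for k
  proof -
    have "cgen k \<odot> cvec x = (- 2 * x $ k) *\<^sub>R cone - cvec x \<odot> cgen k"
      using cvec_swap[of "axis k 1" x] by (simp add: cvec_axis inner_axis)
    moreover have "cvec x \<odot> cgen k \<odot> cgen k = - cvec x"
      by (simp add: cmult_assoc cmult_basis csign_self cmult.minus_right)
    ultimately show ?thesis
      by (simp add: cmult.diff_left cmult.minus_left cmult.scaleR_left)
  qed
  moreover have "(\<Sum>k\<in>UNIV. (2 * x $ k) *\<^sub>R cgen k) = 2 *\<^sub>R cvec x"
    by (simp add: cvec_def scaleR_sum_right)
  ultimately show ?thesis
    by (simp add: sum_subtractf scaleR_diff_left sum_constant_scaleR del: sum_constant)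
qed

text \<open>Source of the dimension constants d - 1 and d - 2 in \<Gamma>: this is the contribution
  of differentiating the bivector \<open>wedge x y\<close> in y.\<close>

lemma sum_wedge_axis_wedge:
  fixes x y :: "(real, 'n::{finite,linorder}) vec"
  shows "(\<Sum>k\<in>UNIV. wedge y (axis k 1) \<odot> wedge x (axis k 1))
    = - ((real CARD('n) - 1) * (x \<bullet> y)) *\<^sub>R cone - (real CARD('n) - 2) *\<^sub>R wedge x y"
proof -
  have "wedge y (axis k 1) \<odot> wedge x (axis k 1)
    = cvec y \<odot> (cgen k \<odot> cvec x \<odot> cgen k) + (x $ k) *\<^sub>R (cvec y \<odot> cgen k)
      + (y $ k) *\<^sub>R (cvec x \<odot> cgen k) + (x $ k * y $ k) *\<^sub>R cone" for k
    by (simp add: wedge_eq cvec_axis inner_axis cmult.add_left cmult.add_right cmult.scaleR_left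
        cmult.scaleR_right cmult_assoc scaleR_add_right)
  then have "(\<Sum>k\<in>UNIV. wedge y (axis k 1) \<odot> wedge x (axis k 1))
    = cvec y \<odot> (\<Sum>k\<in>UNIV. cgen k \<odot> cvec x \<odot> cgen k) + cvec y \<odot> cvec x + cvec x \<odot> cvec y + (x \<bullet> y) *\<^sub>R cone"
    by (simp add: sum.distrib cmult.sum_right cvec_def cmult.scaleR_right inner_vec_def scaleR_sum_left)
  also have "\<dots> = (real CARD('n) - 2) *\<^sub>R ((- 2 * (x \<bullet> y)) *\<^sub>R cone - cvec x \<odot> cvec y)
      + (- 2 * (x \<bullet> y)) *\<^sub>R cone + (x \<bullet> y) *\<^sub>R cone"
    unfolding sum_cgen_sandwich cmult.scaleR_right cvec_swap[of y x] by simp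
  finally show ?thesis
    unfolding wedge_eq by (simp add: vec_eq_iff algebra_simps)
qed

section \<open>Half-integer Bessel functions\<close>

text \<open>
  \<open>hbessel m (t\<^sup>2)\<close> is \<open>(\<pi>/2)\<^sup>1\<^sup>/\<^sup>2\<close> times the normalized Bessel function of order \<open>m - 1/2\<close>, so that
  \<open>hbessel 0 (t\<^sup>2) = cos t\<close>. It is entire in \<open>t\<^sup>2\<close>, which removes the singularity of the kernel at \<open>t = 0\<close>.
\<close>

definition hbessel :: "nat \<Rightarrow> real \<Rightarrow> real" where
  "hbessel m z = sqrt (pi / 2) * 2 powr (1 / 2 - real m)
     * (\<Sum>k. (-1) ^ k / (fact k * Gamma (real k + real m + 1 / 2)) * (z / 4) ^ k)"

lemma hbessel_summable:
  "summable (\<lambda>k. (-1) ^ k / (fact k * Gamma (real k + real m + 1 / 2)) * (y :: real) ^ k)"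
  using summable_bessel[of "real m - 1 / 2" y] by (simp add: add_ac)

lemma bessel_J_tilde_eq_hbessel:
  assumes "t \<ge> 0"
  shows "bessel_J_tilde (real m - 1 / 2) t = hbessel m (t\<^sup>2) / sqrt (pi / 2)"
  using assms
  by (simp add: bessel_J_tilde_series hbessel_def power_divide add_ac)

lemma hbessel_0_0: "hbessel 0 0 = 1"
proof -
  have "(\<Sum>k. (-1) ^ k / (fact k * Gamma (real k + real 0 + 1 / 2)) * (0 / 4 :: real) ^ k) = 1 / sqrt pi"
    using powser_zero[of "\<lambda>k. (-1) ^ k / (fact k * Gamma (real k + real 0 + 1 / 2)) :: real"]
    by (simp add: Gamma_one_half_real)
  then show ?thesis
    by (simp add: hbessel_def powr_half_sqrt real_sqrt_divide)
qed

lemma powr_half_step: "(2::real) powr (1 / 2 - real (Suc m)) = 2 powr (1 / 2 - real m) / 2"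
proof -
  have "(2::real) powr (1 / 2 - real (Suc m)) = 2 powr ((1 / 2 - real m) - 1)"
    by (simp add: algebra_simps)
  then show ?thesis by (simp only: powr_diff) simp
qed

text \<open>Termwise differentiation: the factor k + 1 cancels against the factorial, and the index
  shift of the Gamma function raises the order by one.\<close>

lemma hbessel_has_field_derivative:
  "(hbessel m has_field_derivative - hbessel (Suc m) z / 2) (at z)"
proof -
  define c :: "nat \<Rightarrow> real" where "c k = (-1) ^ k / (fact k * Gamma (real k + real m + 1 / 2))" for k
  have summ: "summable (\<lambda>k. c k * y ^ k)" for y
    unfolding c_def by (rule hbessel_summable)
  have d: "diffs c k = - ((-1) ^ k / (fact k * Gamma (real k + real (Suc m) + 1 / 2)))" for k
    by (simp add: diffs_def c_def field_simps del: of_nat_Suc fact_Suc)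
       (simp add: add_ac)
  have "((\<lambda>y. \<Sum>k. c k * y ^ k) has_field_derivative (\<Sum>k. diffs c k * (z / 4) ^ k)) (at (z / 4))"
    using summ by (intro termdiffs_strong_converges_everywhere)
  then have "((\<lambda>z. \<Sum>k. c k * (z / 4) ^ k) has_field_derivative (\<Sum>k. diffs c k * (z / 4) ^ k) * (1 / 4))
      (at z)"
    by (rule DERIV_chain2) (auto intro!: derivative_eq_intros)
  then have "(hbessel m has_field_derivative sqrt (pi / 2) * 2 powr (1 / 2 - real m)
      * ((\<Sum>k. diffs c k * (z / 4) ^ k) * (1 / 4))) (at z)"
    unfolding hbessel_def[abs_def] c_def by (rule DERIV_cmult)
  moreover have "(\<Sum>k. diffs c k * (z / 4) ^ k)
      = - (\<Sum>k. (-1) ^ k / (fact k * Gamma (real k + real (Suc m) + 1 / 2)) * (z / 4) ^ k)"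
    unfolding d using hbessel_summable[of "Suc m" "z / 4"] by (simp add: suminf_minus)
  moreover have "(2::real) powr (1 / 2 - real m) = 2 * 2 powr (1 / 2 - real (Suc m))"
    unfolding powr_half_step by simp
  ultimately show ?thesis
    by (simp add: hbessel_def mult.assoc)
qed

text \<open>The three-term recurrence J_(\<alpha>-1) + J_(\<alpha>+1) = (2 \<alpha> / t) J_\<alpha>
  for \<alpha> = m + 1/2, freed of powers of t by the normalization.\<close>

lemma hbessel_recurrence:
  "z * hbessel (Suc (Suc m)) z = (2 * real m + 1) * hbessel (Suc m) z - hbessel m z"
proof -
  define A where "A = sqrt (pi / 2) * 2 powr (1 / 2 - real m)"
  define a where "a m k = (-1) ^ k / (fact k * Gamma (real k + real m + 1 / 2)) * (z / 4) ^ k" for m k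
  have S: "summable (a m)" for m
    unfolding a_def by (rule hbessel_summable)
  have p: "(2::real) powr (1 / 2 - real (Suc m)) = 2 powr (1 / 2 - real m) / 2" for m
    by (rule powr_half_step)
  have h: "hbessel m z = A * (\<Sum>k. a m k)" "hbessel (Suc m) z = A / 2 * (\<Sum>k. a (Suc m) k)"
    "hbessel (Suc (Suc m)) z = A / 4 * (\<Sum>k. a (Suc (Suc m)) k)"
    unfolding hbessel_def a_def A_def p by simp_all
  have G: "Gamma (real k + real (Suc m) + 1 / 2)
      = (real k + real m + 1 / 2) * Gamma (real k + real m + 1 / 2)" for k m
  proof -
    have "real k + real m + 1 / 2 \<notin> \<int>\<^sub>\<le>\<^sub>0" by (auto elim!: nonpos_Ints_cases)
    then show ?thesis using Gamma_plus1[of "real k + real m + 1 / 2"] by (simp add: add_ac)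
  qed
  have Gp: "Gamma (real k + real m + 1 / 2) > 0" for k m
    by (intro Gamma_real_pos) (simp add: add_nonneg_pos)
  have am: "a m k = (real k + real m + 1 / 2) * a (Suc m) k" for k
  proof -
    have "x / (f * g) * q = p * (x / (f * (p * g)) * q)" if "p \<noteq> 0" for x f g q p :: real
      using that by simp
    moreover have "real k + real m + 1 / 2 \<noteq> 0" by (simp add: add_nonneg_pos less_imp_neq[symmetric])
    ultimately show ?thesis unfolding a_def G by blast
  qed
  have "a (Suc m) (Suc k) * real (Suc k) = - (z / 4) * a (Suc (Suc m)) k" for k
    by (simp add: a_def field_simps del: of_nat_Suc) (auto simp: algebra_simps)
  then have 1: "(\<Sum>k. a (Suc m) (Suc k) * real (Suc k)) = - (z / 4) * (\<Sum>k. a (Suc (Suc m)) k)"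
    by (simp only: suminf_mult[OF S])
  \<comment> \<open>Here \<open>a m k\<close> is k + m + 1/2 times \<open>a (Suc m) k\<close>, so
    the constant m + 1/2 drops out. The surviving factor k kills the term k = 0, and shifting the
    index brings out z / 4.\<close>
  have 2: "(2 * real m + 1) / 2 * a (Suc m) k - a m k = - (a (Suc m) k * real k)" for k
    unfolding am by (simp add: field_simps)
  have s2: "summable (\<lambda>k. (2 * real m + 1) / 2 * a (Suc m) k - a m k)"
    by (intro summable_diff summable_mult S)
  then have s3: "summable (\<lambda>k. a (Suc m) k * real k)"
    unfolding 2 by (simp add: summable_minus_iff)
  have "(2 * real m + 1) / 2 * (\<Sum>k. a (Suc m) k) - (\<Sum>k. a m k)
      = (\<Sum>k. (2 * real m + 1) / 2 * a (Suc m) k - a m k)"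
    by (simp only: suminf_mult[OF S, symmetric] suminf_diff[OF summable_mult[OF S] S])
  also have "\<dots> = - (\<Sum>k. a (Suc m) k * real k)"
    unfolding 2 using s3 by (simp add: suminf_minus)
  also have "(\<Sum>k. a (Suc m) k * real k) = (\<Sum>k. a (Suc m) (Suc k) * real (Suc k))"
    using suminf_split_head[OF s3] by simp
  finally have "A * ((2 * real m + 1) / 2 * (\<Sum>k. a (Suc m) k) - (\<Sum>k. a m k))
      = A * (z / 4 * (\<Sum>k. a (Suc (Suc m)) k))"
    unfolding 1 by simp
  then show ?thesis
    unfolding h by (simp add: algebra_simps)
qed

lemma continuous_on_hbessel: "continuous_on S (hbessel m)"
  using hbessel_has_field_derivative by (meson DERIV_isCont continuous_at_imp_continuous_on)

text \<open>This is cos^2 t + sin^2 t = 1. The derivative in t vanishes by the recurrence with m =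
  0, so no closed form of the series is required.\<close>

lemma hbessel_energy: "(hbessel 0 (t\<^sup>2))\<^sup>2 + (t * hbessel 1 (t\<^sup>2))\<^sup>2 = 1"
proof -
  have "((\<lambda>t. (hbessel 0 (t\<^sup>2))\<^sup>2 + (t * hbessel 1 (t\<^sup>2))\<^sup>2) has_field_derivative 0) (at t)" for t
  proof -
    have d: "((\<lambda>t. hbessel m (t\<^sup>2)) has_field_derivative - hbessel (Suc m) (t\<^sup>2) / 2 * (2 * t)) (at t)" for m
      by (rule DERIV_chain2[OF hbessel_has_field_derivative]) (auto intro!: derivative_eq_intros)
    show ?thesis
      using hbessel_recurrence[of "t\<^sup>2" 0]
      by (auto intro!: derivative_eq_intros d) (simp add: power2_eq_square algebra_simps)
  qed
  then have "(\<lambda>t. (hbessel 0 (t\<^sup>2))\<^sup>2 + (t * hbessel 1 (t\<^sup>2))\<^sup>2) t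
      = (\<lambda>t. (hbessel 0 (t\<^sup>2))\<^sup>2 + (t * hbessel 1 (t\<^sup>2))\<^sup>2) 0"
    by (intro DERIV_isconst_all) blast
  then show ?thesis by (simp add: hbessel_0_0)
qed

text \<open>Read as a formula for the order m + 2, the recurrence divides by z, which preserves
  bounds for z \<ge> 1; compactness covers [0, 1]. For negative z the growth is hyperbolic: order 0
  becomes cosh.\<close>

lemma hbessel_bounded: "\<exists>C. \<forall>z\<ge>0. \<bar>hbessel m z\<bar> \<le> C"
proof (induction m rule: induct_nat_012)
  case 0
  have "\<bar>hbessel 0 z\<bar> \<le> 1" if "z \<ge> 0" for z
  proof -
    have "(hbessel 0 z)\<^sup>2 + (sqrt z * hbessel 1 z)\<^sup>2 = 1"
      using hbessel_energy[of "sqrt z"] that by simp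
    then have "(hbessel 0 z)\<^sup>2 \<le> 1\<^sup>2" by (smt (verit) zero_le_power2 one_power2)
    then show ?thesis by (auto simp only: abs_le_square_iff[symmetric] abs_one)
  qed
  then show ?case by blast
next
  have *: "\<exists>C. \<forall>z\<ge>0. \<bar>hbessel m z\<bar> \<le> C" if "\<And>z. z \<ge> 1 \<Longrightarrow> \<bar>hbessel m z\<bar> \<le> B" for m B
  proof -
    have "bounded (hbessel m ` {0..1})"
      by (intro compact_imp_bounded compact_continuous_image continuous_on_hbessel compact_Icc)
    then obtain C where "\<forall>z\<in>{0..1}. \<bar>hbessel m z\<bar> \<le> C"
      by (auto simp: bounded_iff)
    then have "\<forall>z\<ge>0. \<bar>hbessel m z\<bar> \<le> max B C"
      using that by (smt (verit) atLeastAtMost_iff)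
    then show ?thesis by blast
  qed
  {
    case 1
    show ?case
    proof (rule *)
      fix z :: real assume z: "z \<ge> 1"
      have "(hbessel 0 z)\<^sup>2 + (sqrt z * hbessel 1 z)\<^sup>2 = 1"
        using hbessel_energy[of "sqrt z"] z by simp
      then have "(sqrt z * hbessel 1 z)\<^sup>2 \<le> 1\<^sup>2" by (smt (verit) zero_le_power2 one_power2)
      then have "\<bar>sqrt z * hbessel 1 z\<bar> \<le> 1" by (auto simp only: abs_le_square_iff[symmetric] abs_one)
      moreover have "1 * \<bar>hbessel 1 z\<bar> \<le> sqrt z * \<bar>hbessel 1 z\<bar>"
        using z by (intro mult_right_mono) auto
      ultimately show "\<bar>hbessel (Suc 0) z\<bar> \<le> 1" using z by (simp add: abs_mult)
    qed
  next
    case (ge2 m)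
    then obtain C D where C: "\<forall>z\<ge>0. \<bar>hbessel m z\<bar> \<le> C" and D: "\<forall>z\<ge>0. \<bar>hbessel (Suc m) z\<bar> \<le> D"
      by blast
    show ?case
    proof (rule *)
      fix z :: real assume z: "z \<ge> 1"
      have "1 * \<bar>hbessel (Suc (Suc m)) z\<bar> \<le> z * \<bar>hbessel (Suc (Suc m)) z\<bar>"
        using z by (intro mult_right_mono) auto
      also have "\<dots> = \<bar>(2 * real m + 1) * hbessel (Suc m) z - hbessel m z\<bar>"
        using z by (simp add: abs_mult flip: hbessel_recurrence)
      also have "\<dots> \<le> (2 * real m + 1) * \<bar>hbessel (Suc m) z\<bar> + \<bar>hbessel m z\<bar>"
        by (rule order_trans[OF abs_triangle_ineq4]) (simp add: abs_mult)
      also have "\<dots> \<le> (2 * real m + 1) * D + C"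
        using C D z by (intro add_mono mult_left_mono) auto
      finally show "\<bar>hbessel (Suc (Suc m)) z\<bar> \<le> (2 * real m + 1) * D + C" by simp
    qed
  }
qed

section \<open>An explicit flow joining the Fourier kernel to the Clifford-Fourier kernel\<close>

text \<open>
  Expressions in \<open>\<theta>\<close>, \<open>s\<close> and \<open>p\<close> form a class closed under all partial derivatives. Taking these
  derivatives symbolically makes their commutation an induction over expressions. \<open>FExp\<close> is
  \<open>exp (- i s cos \<theta>)\<close> and \<open>FBessel m\<close> is \<open>hbessel m (t\<^sup>2 sin\<^sup>2 \<theta>)\<close> with \<open>t\<^sup>2 = p - s\<^sup>2\<close>.
\<close>

datatype flow_exp = FConst complex | FCos | FSin | FS | FP | FExp | FBessel nat
  | FAdd flow_exp flow_exp | FMul flow_exp flow_exp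

primrec flow_eval :: "flow_exp \<Rightarrow> real \<Rightarrow> real \<Rightarrow> real \<Rightarrow> complex" where
  "flow_eval (FConst c) \<theta> s p = c"
| "flow_eval FCos \<theta> s p = of_real (cos \<theta>)"
| "flow_eval FSin \<theta> s p = of_real (sin \<theta>)"
| "flow_eval FS \<theta> s p = of_real s"
| "flow_eval FP \<theta> s p = of_real p"
| "flow_eval FExp \<theta> s p = cis (- (s * cos \<theta>))"
| "flow_eval (FBessel m) \<theta> s p = of_real (hbessel m ((sin \<theta>)\<^sup>2 * (p - s\<^sup>2)))"
| "flow_eval (FAdd a b) \<theta> s p = flow_eval a \<theta> s p + flow_eval b \<theta> s p"
| "flow_eval (FMul a b) \<theta> s p = flow_eval a \<theta> s p * flow_eval b \<theta> s p"

abbreviation FZ :: flow_exp where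
  "FZ \<equiv> FAdd FP (FMul (FConst (-1)) (FMul FS FS))"

text \<open>In the Bessel clause the factor -1/2 from differentiating \<open>hbessel\<close> has
  already been multiplied with the factor 2 of the derivative of sin^2 \<theta>;
  \<open>deriv_s\<close> treats the derivative of s^2 alike.\<close>

primrec deriv_theta :: "flow_exp \<Rightarrow> flow_exp" where
  "deriv_theta (FConst c) = FConst 0"
| "deriv_theta FCos = FMul (FConst (-1)) FSin"
| "deriv_theta FSin = FCos"
| "deriv_theta FS = FConst 0"
| "deriv_theta FP = FConst 0"
| "deriv_theta FExp = FMul (FMul (FConst \<i>) (FMul FS FSin)) FExp"
| "deriv_theta (FBessel m) = FMul (FMul (FConst (-1)) (FMul (FMul FSin FCos) FZ)) (FBessel (Suc m))"
| "deriv_theta (FAdd a b) = FAdd (deriv_theta a) (deriv_theta b)"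
| "deriv_theta (FMul a b) = FAdd (FMul (deriv_theta a) b) (FMul a (deriv_theta b))"

primrec deriv_s :: "flow_exp \<Rightarrow> flow_exp" where
  "deriv_s (FConst c) = FConst 0"
| "deriv_s FCos = FConst 0"
| "deriv_s FSin = FConst 0"
| "deriv_s FS = FConst 1"
| "deriv_s FP = FConst 0"
| "deriv_s FExp = FMul (FMul (FConst (-\<i>)) FCos) FExp"
| "deriv_s (FBessel m) = FMul (FMul (FMul FSin FSin) FS) (FBessel (Suc m))"
| "deriv_s (FAdd a b) = FAdd (deriv_s a) (deriv_s b)"
| "deriv_s (FMul a b) = FAdd (FMul (deriv_s a) b) (FMul a (deriv_s b))"

primrec deriv_p :: "flow_exp \<Rightarrow> flow_exp" where
  "deriv_p (FConst c) = FConst 0"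
| "deriv_p FCos = FConst 0"
| "deriv_p FSin = FConst 0"
| "deriv_p FS = FConst 0"
| "deriv_p FP = FConst 1"
| "deriv_p FExp = FConst 0"
| "deriv_p (FBessel m) = FMul (FMul (FConst (-1/2)) (FMul FSin FSin)) (FBessel (Suc m))"
| "deriv_p (FAdd a b) = FAdd (deriv_p a) (deriv_p b)"
| "deriv_p (FMul a b) = FAdd (FMul (deriv_p a) b) (FMul a (deriv_p b))"

section \<open>Derivatives, continuity and growth of flow expressions\<close>

lemma cis_has_vector_derivative:
  assumes "(f has_real_derivative D) (at u)"
  shows "((\<lambda>u. cis (f u)) has_vector_derivative (\<i> * of_real D) * cis (f u)) (at u)"
proof -
  have "((\<lambda>u. \<i> * of_real (f u)) has_vector_derivative \<i> * of_real D) (at u)"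
    by (intro has_vector_derivative_mult_right has_vector_derivative_of_real assms)
  from field_vector_diff_chain_at[OF this DERIV_exp] show ?thesis
    by (simp add: o_def cis_conv_exp)
qed

text \<open>Stated along a curve because moving y in a coordinate direction changes s and p
  simultaneously.\<close>

lemma flow_eval_has_vector_derivative:
  assumes "(\<theta> has_real_derivative \<theta>') (at u)" "(s has_real_derivative s') (at u)"
    "(p has_real_derivative p') (at u)"
  shows "((\<lambda>u. flow_eval e (\<theta> u) (s u) (p u)) has_vector_derivative
    \<theta>' *\<^sub>R flow_eval (deriv_theta e) (\<theta> u) (s u) (p u) + s' *\<^sub>R flow_eval (deriv_s e) (\<theta> u) (s u) (p u)
      + p' *\<^sub>R flow_eval (deriv_p e) (\<theta> u) (s u) (p u)) (at u)"
proof (induction e)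
  case FCos
  have "((\<lambda>u. cos (\<theta> u)) has_real_derivative - sin (\<theta> u) * \<theta>') (at u)"
    using assms by (auto intro!: derivative_eq_intros)
  from has_vector_derivative_of_real[OF this] show ?case
    by (simp add: scaleR_conv_of_real mult_ac)
next
  case FSin
  have "((\<lambda>u. sin (\<theta> u)) has_real_derivative cos (\<theta> u) * \<theta>') (at u)"
    using assms by (auto intro!: derivative_eq_intros)
  from has_vector_derivative_of_real[OF this] show ?case
    by (simp add: scaleR_conv_of_real mult_ac)
next
  case FS
  from has_vector_derivative_of_real[OF assms(2)] show ?case
    by (simp add: scaleR_conv_of_real)
next
  case FP
  from has_vector_derivative_of_real[OF assms(3)] show ?case
    by (simp add: scaleR_conv_of_real)
next
  case FExp
  let ?D = "s u * sin (\<theta> u) * \<theta>' - s' * cos (\<theta> u)"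
  have "((\<lambda>u. - (s u * cos (\<theta> u))) has_real_derivative ?D) (at u)"
    using assms by (auto intro!: derivative_eq_intros simp: algebra_simps)
  from cis_has_vector_derivative[OF this] show ?case
    by (simp add: scaleR_conv_of_real algebra_simps)
next
  case (FBessel m)
  let ?z = "\<lambda>u. (sin (\<theta> u))\<^sup>2 * (p u - (s u)\<^sup>2)"
  let ?D = "2 * sin (\<theta> u) * cos (\<theta> u) * \<theta>' * (p u - (s u)\<^sup>2) + (sin (\<theta> u))\<^sup>2 * (p' - 2 * s u * s')"
  define H where "H = hbessel (Suc m) (?z u)"
  have "(?z has_real_derivative ?D) (at u)"
    using assms by (auto intro!: derivative_eq_intros simp: algebra_simps)
  then have "((\<lambda>u. hbessel m (?z u)) has_real_derivative - hbessel (Suc m) (?z u) / 2 * ?D) (at u)"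
    by (rule DERIV_chain2[OF hbessel_has_field_derivative])
  also have "- hbessel (Suc m) (?z u) / 2 * ?D
      = \<theta>' * (- (sin (\<theta> u) * cos (\<theta> u) * (p u + - (s u * s u))) * H)
        + s' * (sin (\<theta> u) * sin (\<theta> u) * s u * H) + p' * (- 1 / 2 * (sin (\<theta> u) * sin (\<theta> u)) * H)"
    unfolding H_def[symmetric] by (simp add: algebra_simps power2_eq_square)
  finally have d: "((\<lambda>u. flow_eval (FBessel m) (\<theta> u) (s u) (p u)) has_vector_derivative of_real
      (\<theta>' * (- (sin (\<theta> u) * cos (\<theta> u) * (p u + - (s u * s u))) * H)
        + s' * (sin (\<theta> u) * sin (\<theta> u) * s u * H) + p' * (- 1 / 2 * (sin (\<theta> u) * sin (\<theta> u)) * H))) (at u)"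
    unfolding flow_eval.simps by (rule has_vector_derivative_of_real)
  show ?case
    by (rule has_vector_derivative_eq_rhs[OF d]) (simp add: scaleR_conv_of_real H_def)
next
  case (FAdd a b)
  from has_vector_derivative_add[OF FAdd.IH] show ?case
    by (simp add: algebra_simps)
next
  case (FMul a b)
  from has_vector_derivative_mult[OF FMul.IH] show ?case
    by (simp add: algebra_simps)
qed simp

lemma flow_eval_deriv_s_has_vector_derivative: "((\<lambda>s. flow_eval e \<theta> s p) has_vector_derivative flow_eval
    (deriv_s e) \<theta> s p) (at s)"
  using flow_eval_has_vector_derivative[of "\<lambda>_. \<theta>" 0 s "\<lambda>s. s" 1 "\<lambda>_. p" 0 e] by simp

lemma flow_eval_deriv_theta_has_vector_derivative: "((\<lambda>\<theta>. flow_eval e \<theta> s p) has_vector_derivative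
    flow_eval (deriv_theta e) \<theta> s p) (at \<theta>)"
  using flow_eval_has_vector_derivative[of "\<lambda>t. t" 1 \<theta> "\<lambda>_. s" 0 "\<lambda>_. p" 0 e] by simp

text \<open>Symbolic derivatives depend on syntax. Uniqueness of the analytic derivative allows an
  identity valid for all s to be differentiated even when its two sides are different
  expressions.\<close>

lemma flow_eval_deriv_s_eqI:
  assumes "\<And>s. flow_eval e \<theta> s p = f s" "(f has_vector_derivative f') (at s)"
  shows "flow_eval (deriv_s e) \<theta> s p = f'"
proof -
  have "(f has_vector_derivative flow_eval (deriv_s e) \<theta> s p) (at s)"
    using flow_eval_deriv_s_has_vector_derivative[of e \<theta> p s] unfolding assms(1) .
  then show ?thesis using assms(2) by (rule vector_derivative_unique_at)
qed

lemma flow_eval_deriv_s_cong: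
  assumes "\<And>s. flow_eval e \<theta> s p = flow_eval e' \<theta> s p"
  shows "flow_eval (deriv_s e) \<theta> s p = flow_eval (deriv_s e') \<theta> s p"
  using assms flow_eval_deriv_s_has_vector_derivative by (rule flow_eval_deriv_s_eqI)

lemma flow_eval_deriv_theta_deriv_s: "flow_eval (deriv_theta (deriv_s e)) \<theta> s p
    = flow_eval (deriv_s (deriv_theta e)) \<theta> s p"
  by (induction e) (simp_all add: algebra_simps power2_eq_square)

lemma continuous_on_flow_eval:
  fixes \<theta> s p :: "'b::t2_space \<Rightarrow> real"
  assumes "continuous_on A \<theta>" "continuous_on A s" "continuous_on A p"
  shows "continuous_on A (\<lambda>x. flow_eval e (\<theta> x) (s x) (p x))"
proof (induction e)
  case (FBessel m)
  have "continuous_on A (\<lambda>x. hbessel m ((sin (\<theta> x))\<^sup>2 * (p x - (s x)\<^sup>2)))"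
    by (rule continuous_on_compose2[OF continuous_on_hbessel]) (auto intro!: continuous_intros assms)
  then show ?case by (simp add: continuous_on_of_real)
qed (auto intro!: continuous_intros assms simp: cis_conv_exp)

text \<open>The condition on s and p is Cauchy-Schwarz for the actual arguments; it keeps the Bessel
  argument nonnegative, where \<open>hbessel\<close> is bounded. The bound is uniform in \<theta>,
  as Fubini over the flow time demands.\<close>

lemma norm_flow_eval_le:
  "\<exists>C\<ge>0. \<exists>N. \<forall>\<theta> s p. s\<^sup>2 \<le> p \<longrightarrow> norm (flow_eval e \<theta> s p) \<le> C * (1 + p) ^ N"
proof (induction e)
  case (FConst c)
  have "norm (flow_eval (FConst c) \<theta> s p) \<le> norm c * (1 + p) ^ 0" for \<theta> s p by simp
  then show ?case by (meson norm_ge_zero)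
next
  case FS
  have "norm (flow_eval FS \<theta> s p) \<le> 1 * (1 + p) ^ 1" if "s\<^sup>2 \<le> p" for \<theta> s p
  proof -
    have "\<bar>s\<bar> \<le> 1 + \<bar>s\<bar>\<^sup>2"
      using sum_power2_ge_zero[of "\<bar>s\<bar> - 1" 0] abs_ge_zero[of s] unfolding power2_diff power2_abs
      by (simp add: power2_eq_square)
    then show ?thesis using that by simp
  qed
  then show ?case by (meson zero_le_one)
next
  case FP
  have "norm (flow_eval FP \<theta> s p) \<le> 1 * (1 + p) ^ 1" if "s\<^sup>2 \<le> p" for \<theta> s p
    using order_trans[OF zero_le_power2 that] by simp
  then show ?case by (meson zero_le_one)
next
  case (FBessel m)
  obtain C where C: "\<forall>z\<ge>0. \<bar>hbessel m z\<bar> \<le> C" using hbessel_bounded by blast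
  have "norm (flow_eval (FBessel m) \<theta> s p) \<le> \<bar>C\<bar> * (1 + p) ^ 0" if "s\<^sup>2 \<le> p" for \<theta> s p
    using C[rule_format, of "(sin \<theta>)\<^sup>2 * (p - s\<^sup>2)"] that by simp
  then show ?case by (meson abs_ge_zero)
next
  case (FAdd a b)
  then obtain C M D N where C: "C \<ge> 0" "\<And>\<theta> s p. s\<^sup>2 \<le> p \<Longrightarrow> norm (flow_eval a \<theta> s p) \<le> C * (1 + p) ^ M"
    and D: "D \<ge> 0" "\<And>\<theta> s p. s\<^sup>2 \<le> p \<Longrightarrow> norm (flow_eval b \<theta> s p) \<le> D * (1 + p) ^ N"
    by blast
  have "norm (flow_eval (FAdd a b) \<theta> s p) \<le> (C + D) * (1 + p) ^ (M + N)" if sp: "s\<^sup>2 \<le> p" for \<theta> s p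
  proof -
    have p: "p \<ge> 0" using sp order_trans[OF zero_le_power2] by auto
    have "norm (flow_eval (FAdd a b) \<theta> s p) \<le> C * (1 + p) ^ M + D * (1 + p) ^ N"
      using C(2)[OF sp] D(2)[OF sp] by (auto intro: norm_triangle_mono)
    also have "\<dots> \<le> C * (1 + p) ^ (M + N) + D * (1 + p) ^ (M + N)"
      using C(1) D(1) p by (intro add_mono mult_left_mono power_increasing) auto
    finally show ?thesis by (simp add: algebra_simps)
  qed
  then show ?case using C(1) D(1) by (meson add_nonneg_nonneg)
next
  case (FMul a b)
  then obtain C M D N where C: "C \<ge> 0" "\<And>\<theta> s p. s\<^sup>2 \<le> p \<Longrightarrow> norm (flow_eval a \<theta> s p) \<le> C * (1 + p) ^ M"
    and D: "D \<ge> 0" "\<And>\<theta> s p. s\<^sup>2 \<le> p \<Longrightarrow> norm (flow_eval b \<theta> s p) \<le> D * (1 + p) ^ N"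
    by blast
  have "norm (flow_eval (FMul a b) \<theta> s p) \<le> (C * D) * (1 + p) ^ (M + N)" if sp: "s\<^sup>2 \<le> p" for \<theta> s p
  proof -
    have p: "p \<ge> 0" using sp order_trans[OF zero_le_power2] by auto
    have "norm (flow_eval (FMul a b) \<theta> s p) \<le> (C * (1 + p) ^ M) * (D * (1 + p) ^ N)"
      using C(2)[OF sp, of \<theta>] D(2)[OF sp, of \<theta>] C(1) p by (auto simp: norm_mult intro!: mult_mono)
    then show ?thesis by (simp add: algebra_simps power_add)
  qed
  then show ?case using C(1) D(1) by (meson mult_nonneg_nonneg)
next
  case FCos
  have "norm (flow_eval FCos \<theta> s p) \<le> 1 * (1 + p) ^ 0" for \<theta> s p by simp
  then show ?case by (meson zero_le_one)
next
  case FSin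
  have "norm (flow_eval FSin \<theta> s p) \<le> 1 * (1 + p) ^ 0" for \<theta> s p by simp
  then show ?case by (meson zero_le_one)
next
  case FExp
  have "norm (flow_eval FExp \<theta> s p) \<le> 1 * (1 + p) ^ 0" for \<theta> s p by simp
  then show ?case by (meson zero_le_one)
qed

section \<open>The raising step and the flow equation\<close>

abbreviation FRot :: flow_exp where
  "FRot \<equiv> FMul (FConst \<i>) (FAdd FCos (FMul (FConst \<i>) FSin))"

text \<open>
  The coefficients of \<open>u\<^sub>\<theta> = a + b W\<close> in dimension \<open>2 l + 2\<close>.
\<close>

fun flow_a flow_b :: "nat \<Rightarrow> flow_exp" where
  "flow_a 0 = FMul FExp (FBessel 0)"
| "flow_b 0 = FMul FSin (FMul FExp (FBessel 1))"
| "flow_a (Suc l) = FMul FRot (FAdd (deriv_s (flow_a l)) (FMul (FConst (-1)) (flow_b l)))"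
| "flow_b (Suc l) = FMul FRot (deriv_s (flow_b l))"

lemma flow_equation_0:
  "flow_eval (deriv_theta (flow_a 0)) \<theta> s p = \<i> * (of_real s * flow_eval (flow_b 0) \<theta> s p - of_real (p -
      s\<^sup>2) * flow_eval (deriv_s (flow_b 0)) \<theta> s p)"
  "flow_eval (deriv_theta (flow_b 0)) \<theta> s p = \<i> * flow_eval (deriv_s (flow_a 0)) \<theta> s p"
proof -
  define x where "x = (sin \<theta>)\<^sup>2 * (p - s\<^sup>2)"
  define h where "h m = complex_of_real (hbessel m x)" for m
  have X: "complex_of_real x = (of_real (sin \<theta>))\<^sup>2 * (of_real p - (of_real s)\<^sup>2)" by (simp add: x_def)
  have "complex_of_real x * h (Suc (Suc 0)) = h (Suc 0) - h 0"
    using hbessel_recurrence[of x 0] unfolding h_def by (simp flip: of_real_mult of_real_diff)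
  \<comment> \<open>Eliminating order 0 by the recurrence leaves polynomial identities in which the
    Bessel factors of orders 1 and 2 are free unknowns.\<close>
  then have r: "h 0 = h (Suc 0) - (of_real (sin \<theta>))\<^sup>2 * (of_real p - (of_real s)\<^sup>2) * h (Suc (Suc 0))"
    unfolding X by (simp add: algebra_simps)
  have i: "\<i> * (\<i> * z) = - z" for z by (simp flip: mult.assoc)
  show "flow_eval (deriv_theta (flow_a 0)) \<theta> s p
      = \<i> * (of_real s * flow_eval (flow_b 0) \<theta> s p - of_real (p - s\<^sup>2) * flow_eval (deriv_s (flow_b 0))
          \<theta> s p)"
    by (simp add: x_def[symmetric] h_def[symmetric]) (simp add: r algebra_simps power2_eq_square i)
  show "flow_eval (deriv_theta (flow_b 0)) \<theta> s p = \<i> * flow_eval (deriv_s (flow_a 0)) \<theta> s p"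
    by (simp add: x_def[symmetric] h_def[symmetric]) (simp add: r algebra_simps power2_eq_square i)
qed

text \<open>The coefficients of d u / d \<theta> = i \<Gamma> u in dimension d = 2 l + 2. The
  induction differentiates both equations in s, commutes the derivatives in \<theta> and s, and lets
  the \<theta>-derivative of the rotation factor supply the shift by 1 between consecutive even
  dimensions.\<close>

lemma flow_equation:
  "flow_eval (deriv_theta (flow_a l)) \<theta> s p = \<i> * (of_real ((2 * real l + 1) * s) * flow_eval (flow_b l)
      \<theta> s p - of_real (p - s\<^sup>2) * flow_eval (deriv_s (flow_b l)) \<theta> s p)"
  "flow_eval (deriv_theta (flow_b l)) \<theta> s p = \<i> * (flow_eval (deriv_s (flow_a l)) \<theta> s p + of_real (2 *
      real l) * flow_eval (flow_b l) \<theta> s p)"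
proof (induction l arbitrary: \<theta> s p)
  case 0
  {
    case 1
    show ?case using flow_equation_0(1) by simp
  next
    case 2
    show ?case using flow_equation_0(2) by simp
  }
next
  case (Suc l)
  \<comment> \<open>The right-hand side of the induction hypothesis is encoded as a flow expression
    so that its s-derivative can be taken symbolically too.\<close>
  have a: "flow_eval (deriv_s (deriv_theta (flow_a l))) \<theta> s p
      = flow_eval (deriv_s (FMul (FConst \<i>) (FAdd (FMul (FMul (FConst (of_real (2 * real l + 1))) FS)
          (flow_b l))
      (FMul (FMul (FConst (-1)) FZ) (deriv_s (flow_b l)))))) \<theta> s p" for \<theta> s p
    by (rule flow_eval_deriv_s_cong) (simp add: Suc.IH algebra_simps power2_eq_square)
  have b: "flow_eval (deriv_s (deriv_theta (flow_b l))) \<theta> s p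
      = flow_eval (deriv_s (FMul (FConst \<i>) (FAdd (deriv_s (flow_a l)) (FMul (FConst (of_real (2 * real
          l))) (flow_b l))))) \<theta> s p" for \<theta> s p
    by (rule flow_eval_deriv_s_cong) (simp add: Suc.IH)
  {
    case 1
    show ?case
      by (simp add: a flow_eval_deriv_theta_deriv_s Suc.IH) (simp add: algebra_simps power2_eq_square)
  next
    case 2
    show ?case
      by (simp add: b flow_eval_deriv_theta_deriv_s Suc.IH) (simp add: algebra_simps power2_eq_square)
  }
qed

text \<open>exp (- i s) is an eigenfunction of d/ds with eigenvalue - i, which the factor i of
  \<open>FRot\<close> at \<theta> = 0 cancels.\<close>

lemma flow_start: "flow_eval (flow_a l) 0 s p = cis (- s) \<and> flow_eval (flow_b l) 0 s p = 0"
proof (induction l arbitrary: s)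
  case 0
  then show ?case by (simp add: hbessel_0_0)
next
  case (Suc l)
  have "((\<lambda>s. cis (- s)) has_vector_derivative - \<i> * cis (- s)) (at s)"
    using cis_has_vector_derivative[of "\<lambda>s. - s" "-1" s] by (simp add: DERIV_minus[OF DERIV_ident])
  with Suc have "flow_eval (deriv_s (flow_a l)) 0 s p = - \<i> * cis (- s)"
    by (intro flow_eval_deriv_s_eqI) auto
  moreover have "flow_eval (deriv_s (flow_b l)) 0 s p = 0"
    by (rule flow_eval_deriv_s_eqI[where f = "\<lambda>_. 0"]) (use Suc in auto)
  ultimately show ?case using Suc[of s] by (simp flip: mult.assoc)
qed

section \<open>The end of the flow and the Bessel sums of the kernel\<close>

text \<open>The \<open>n\<close>-th derivative of \<open>hbessel m (p - s\<^sup>2)\<close> with respect to \<open>s\<close>.\<close>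

fun hbessel_deriv :: "nat \<Rightarrow> nat \<Rightarrow> real \<Rightarrow> real \<Rightarrow> real" where
  "hbessel_deriv 0 m s p = hbessel m (p - s\<^sup>2)"
| "hbessel_deriv (Suc n) m s p = s * hbessel_deriv n (Suc m) s p + real n * hbessel_deriv (n - 1) (Suc m) s p"

text \<open>The recursion is Leibniz' rule for s times a function of order \<open>Suc m\<close>;
  only two terms survive because s is linear. At n = 0 the factor \<open>real n\<close> vanishes, so
  the truncated \<open>n - 1\<close> is harmless.\<close>

lemma hbessel_deriv_has_real_derivative: "((\<lambda>s. hbessel_deriv n m s p) has_real_derivative hbessel_deriv
    (Suc n) m s p) (at s)"
proof (induction n arbitrary: m rule: less_induct)
  case (less n)
  show ?case
  proof (cases n)
    case 0
    have "((\<lambda>s. hbessel m (p - s\<^sup>2)) has_real_derivative - hbessel (Suc m) (p - s\<^sup>2) / 2 * (- 2 * s)) (at s)"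
      by (rule DERIV_chain2[OF hbessel_has_field_derivative]) (auto intro!: derivative_eq_intros)
    then show ?thesis by (simp add: 0 mult.commute)
  next
    case (Suc k)
    have 1: "((\<lambda>s. hbessel_deriv k (Suc m) s p) has_real_derivative hbessel_deriv (Suc k) (Suc m) s p) (at s)"
      using less Suc by auto
    have 2: "((\<lambda>s. real k * hbessel_deriv (k - 1) (Suc m) s p) has_real_derivative real k * hbessel_deriv
        k (Suc m) s p) (at s)"
    proof (cases k)
      case (Suc j)
      then show ?thesis using less[of j "Suc m"] \<open>n = Suc k\<close> by (intro DERIV_cmult) auto
    qed simp
    have "((\<lambda>s. s * hbessel_deriv k (Suc m) s p + real k * hbessel_deriv (k - 1) (Suc m) s p)
        has_real_derivative
        (1 * hbessel_deriv k (Suc m) s p + hbessel_deriv (Suc k) (Suc m) s p * s) + real k *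
            hbessel_deriv k (Suc m) s p) (at s)"
      by (intro DERIV_add DERIV_mult DERIV_ident 1 2)
    then show ?thesis by (simp only: Suc hbessel_deriv.simps(2) diff_Suc_1) (simp add: algebra_simps)
  qed
qed

text \<open>At \<theta> = \<pi>/2 the exponential is 1 and i exp (i \<theta>) is -1, so each step
  maps (a, b) to - (a_s - b, b_s). Every step subtracts b once more from a, whence the factor l.
  Both values are real.\<close>

lemma flow_end:
  "flow_eval (flow_a l) (pi / 2) s p = of_real ((-1) ^ l * (hbessel_deriv l 0 s p - real l *
      hbessel_deriv (l - 1) 1 s p))
    \<and> flow_eval (flow_b l) (pi / 2) s p = of_real ((-1) ^ l * hbessel_deriv l 1 s p)"
proof (induction l arbitrary: s)
  case 0
  then show ?case by simp
next
  case (Suc l)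
  have "((\<lambda>s. real l * hbessel_deriv (l - 1) 1 s p) has_real_derivative real l * hbessel_deriv l 1 s p)
      (at s)"
  proof (cases l)
    case (Suc j)
    then show ?thesis
      using DERIV_cmult[OF hbessel_deriv_has_real_derivative[of j 1 p s], of "real l"] by simp
  qed simp
  then have "((\<lambda>s. (-1) ^ l * (hbessel_deriv l 0 s p - real l * hbessel_deriv (l - 1) 1 s p))
      has_real_derivative
      (-1) ^ l * (hbessel_deriv (Suc l) 0 s p - real l * hbessel_deriv l 1 s p)) (at s)"
    by (rule DERIV_cmult[OF DERIV_diff[OF hbessel_deriv_has_real_derivative]])
  from has_vector_derivative_of_real[OF this] have 1:
    "flow_eval (deriv_s (flow_a l)) (pi / 2) s p
        = of_real ((-1) ^ l * (hbessel_deriv (Suc l) 0 s p - real l * hbessel_deriv l 1 s p))"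
    using Suc by (intro flow_eval_deriv_s_eqI) auto
  have "((\<lambda>s. (-1) ^ l * hbessel_deriv l 1 s p) has_real_derivative (-1) ^ l * hbessel_deriv (Suc l) 1 s
      p) (at s)"
    by (intro DERIV_cmult hbessel_deriv_has_real_derivative)
  from has_vector_derivative_of_real[OF this] have 2:
    "flow_eval (deriv_s (flow_b l)) (pi / 2) s p = of_real ((-1) ^ l * hbessel_deriv (Suc l) 1 s p)"
    using Suc by (intro flow_eval_deriv_s_eqI) auto
  show ?case
    using Suc[of s] 1 2 by (simp del: hbessel_deriv.simps) (simp del: hbessel_deriv.simps add: algebra_simps)
qed

text \<open>The number of ways to choose k disjoint pairs among n points, which is also the absolute
  value of a coefficient of the n-th Hermite polynomial. The value 0 out of range neutralizes
  truncated exponents.\<close>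

definition hcoeff :: "nat \<Rightarrow> nat \<Rightarrow> real" where
  "hcoeff n k = (if 2 * k \<le> n then fact n / (2 ^ k * fact k * fact (n - 2 * k)) else 0)"

text \<open>In terms of pairings: the new point stays single or is paired with one of the n others.
  Arithmetically, n + 1 = 2 (k + 1) + r splits the numerator.\<close>

lemma hcoeff_Suc_Suc: "hcoeff (Suc n) (Suc k) = hcoeff n (Suc k) + real n * hcoeff (n - 1) k"
proof (cases "2 * k + 1 \<le> n")
  case True
  then obtain r where r: "n = 2 * k + 1 + r" using le_Suc_ex by blast
  have a: "hcoeff (Suc n) (Suc k) = real (Suc n) * fact n / (2 ^ k * 2 * (real (Suc k) * fact k) * fact r)"
    by (simp add: hcoeff_def r mult_ac)
  have b: "hcoeff n (Suc k) = real r * fact n / (2 ^ k * 2 * (real (Suc k) * fact k) * fact r)"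
    by (cases r) (simp_all add: hcoeff_def r mult_ac del: fact_Suc add: fact_Suc[of k], simp add: fact_Suc)
  have c: "real n * hcoeff (n - 1) k = fact n / (2 ^ k * fact k * fact r)"
    by (simp add: hcoeff_def r)
  have d: "real (Suc n) = 2 * real (Suc k) + real r" by (simp add: r)
  show ?thesis
    unfolding a b c d by (simp add: add_divide_distrib distrib_right del: of_nat_Suc)
next
  case False
  then show ?thesis by (cases n) (auto simp: hcoeff_def)
qed

text \<open>The bound M is free because the recursion combines two sums of different length, one of
  them shifted by one index.\<close>

lemma hbessel_deriv_eq_sum:
  assumes "n < M"
  shows "hbessel_deriv n m s p = (\<Sum>k<M. hcoeff n k * s ^ (n - 2 * k) * hbessel (m + n - k) (p - s\<^sup>2))"
  using assms
proof (induction n arbitrary: m M rule: less_induct)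
  case (less n)
  show ?case
  proof (cases n)
    case 0
    have "hcoeff 0 k = (if k = 0 then 1 else 0)" for k by (simp add: hcoeff_def)
    then show ?thesis using less.prems 0 by (simp add: if_distrib[of "\<lambda>c. c * _"] sum.delta cong: if_cong)
  next
    case (Suc j)
    then obtain M' where M: "M = Suc M'" "j < M'" using less.prems by (cases M) auto
    let ?h = "\<lambda>m. hbessel m (p - s\<^sup>2)"
    have 1: "hbessel_deriv j (Suc m) s p = (\<Sum>k<M. hcoeff j k * s ^ (j - 2 * k) * ?h (Suc m + j - k))"
      by (rule less.IH) (use M Suc in auto)
    have 2: "real j * hbessel_deriv (j - 1) (Suc m) s p
        = (\<Sum>k<M'. real j * hcoeff (j - 1) k * s ^ (j - 1 - 2 * k) * ?h (Suc m + (j - 1) - k))"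
      by (subst less.IH[of _ M']) (use M Suc in \<open>auto simp: sum_distrib_left mult.assoc\<close>)
    have 3: "s * (hcoeff j (Suc k) * s ^ (j - 2 * Suc k) * ?h (Suc m + j - Suc k))
      + real j * hcoeff (j - 1) k * s ^ (j - 1 - 2 * k) * ?h (Suc m + (j - 1) - k)
      = hcoeff (Suc j) (Suc k) * s ^ (Suc j - 2 * Suc k) * ?h (m + Suc j - Suc k)" for k
    proof -
      \<comment> \<open>If 2 (k + 1) exceeds j, the exponent is truncated and the powers of s
        differ, but then the coefficient is 0.\<close>
      have "s * (hcoeff j (Suc k) * s ^ (j - 2 * Suc k)) = hcoeff j (Suc k) * s ^ (Suc j - 2 * Suc k)"
      proof (cases "2 * Suc k \<le> j")
        case True
        then have "Suc j - 2 * Suc k = Suc (j - 2 * Suc k)" by linarith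
        then show ?thesis by (simp only: power_Suc mult_ac)
      qed (simp add: hcoeff_def)
      then have "s * (hcoeff j (Suc k) * s ^ (j - 2 * Suc k) * ?h (Suc m + j - Suc k))
        = hcoeff j (Suc k) * s ^ (Suc j - 2 * Suc k) * ?h (m + Suc j - Suc k)" by (simp flip: mult.assoc)
      moreover have "real j * hcoeff (j - 1) k * s ^ (j - 1 - 2 * k) * ?h (Suc m + (j - 1) - k)
        = real j * hcoeff (j - 1) k * s ^ (Suc j - 2 * Suc k) * ?h (m + Suc j - Suc k)"
        by (cases j) auto
      ultimately show ?thesis
        unfolding hcoeff_Suc_Suc by (simp only: distrib_right)
    qed
    have "hbessel_deriv n m s p = s * (\<Sum>k<M. hcoeff j k * s ^ (j - 2 * k) * ?h (Suc m + j - k))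
       + (\<Sum>k<M'. real j * hcoeff (j - 1) k * s ^ (j - 1 - 2 * k) * ?h (Suc m + (j - 1) - k))"
      unfolding Suc hbessel_deriv.simps 1 2 ..
    also have "\<dots> = s * (hcoeff j 0 * s ^ j * ?h (Suc m + j)) + (\<Sum>k<M'. hcoeff (Suc j) (Suc k) * s ^ (Suc
        j - 2 * Suc k) * ?h (m + Suc j - Suc k))"
      unfolding M(1) sum.lessThan_Suc_shift distrib_left sum_distrib_left 3[symmetric] sum.distrib by simp
    also have "s * (hcoeff j 0 * s ^ j * ?h (Suc m + j)) = hcoeff (Suc j) 0 * s ^ (Suc j) * ?h (m + Suc j)"
      by (simp add: hcoeff_def)
    also have "hcoeff (Suc j) 0 * s ^ (Suc j) * ?h (m + Suc j) + (\<Sum>k<M'. hcoeff (Suc j) (Suc k) * s ^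
        (Suc j - 2 * Suc k) * ?h (m + Suc j - Suc k))
      = (\<Sum>k<M. hcoeff n k * s ^ (n - 2 * k) * ?h (m + n - k))"
      unfolding M(1) sum.lessThan_Suc_shift Suc by simp
    finally show ?thesis .
  qed
qed

lemma hbessel_deriv_eq_sum': "hbessel_deriv n m s p = (\<Sum>k | 2 * k
    \<le> n. hcoeff n k * s ^ (n - 2 * k) * hbessel (m + n - k) (p - s\<^sup>2))"
  unfolding hbessel_deriv_eq_sum[OF lessI] by (rule sum.mono_neutral_right) (auto simp: hcoeff_def)

lemma Gamma_nat_Suc: "Gamma (real n + 1) = fact n"
  using Gamma_fact[of n, where ?'a = real] by (simp add: add.commute)

text \<open>The order (2 l - 2 k - 1) / 2 is (l - k) - 1/2, and \<Gamma>(l + 1) = l (l - 1)! splits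
  off the factor l, leaving the Hermite coefficients of degree l - 1. The argument t^2 + s^2 plays
  the role of p.\<close>

lemma A_star_eq:
  assumes "l > 0" "t \<ge> 0"
  shows "A_star l s t = real l * hbessel_deriv (l - 1) 1 s (t\<^sup>2 + s\<^sup>2) / sqrt (pi / 2)"
proof -
  \<comment> \<open>The floor bound says 4 k + 1 \<le> 2 l, which by parity is 2 k \<le> l -
    1.\<close>
  have I: "{k. int k \<le> \<lfloor>(real l + 1) / 2 - 3 / 4\<rfloor>} = {k. 2 * k \<le> l - 1}"
  proof (intro Collect_cong)
    fix k
    have "int k \<le> \<lfloor>(real l + 1) / 2 - 3 / 4\<rfloor> \<longleftrightarrow> real (4 * k + 1) \<le> real (2 * l)"
      by (auto simp: le_floor_iff field_simps)
    also have "\<dots> \<longleftrightarrow> 2 * k \<le> l - 1"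
      unfolding of_nat_le_iff using assms(1) by auto
    finally show "int k \<le> \<lfloor>(real l + 1) / 2 - 3 / 4\<rfloor> \<longleftrightarrow> 2 * k \<le> l - 1" .
  qed
  have "s ^ (l - 1 - 2 * k) * (1 / (2 ^ k * fact k)) * (Gamma (real l + 1) / Gamma (real l - 2 * real k))
       * bessel_J_tilde ((2 * real l - 2 * real k - 1) / 2) t
     = real l / sqrt (pi / 2) * (hcoeff (l - 1) k * s ^ (l - 1 - 2 * k) * hbessel (1 + (l - 1) - k) (t\<^sup>2
         + s\<^sup>2 - s\<^sup>2))"
    if k: "2 * k \<le> l - 1" for k
  proof -
    have "(2 * real l - 2 * real k - 1) / 2 = real (l - k) - 1 / 2"
      using k assms by (simp add: of_nat_diff field_simps)
    then have "bessel_J_tilde ((2 * real l - 2 * real k - 1) / 2) t = hbessel (l - k) (t\<^sup>2) / sqrt (pi / 2)"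
      by (simp only: bessel_J_tilde_eq_hbessel[OF assms(2)])
    moreover have "Gamma (real l - 2 * real k) = fact (l - 1 - 2 * k)"
      using Gamma_nat_Suc[of "l - 1 - 2 * k"] k assms(1) by (simp add: of_nat_diff algebra_simps)
    moreover have "Gamma (real l + 1) = real l * fact (l - 1)"
      unfolding Gamma_nat_Suc using assms(1) by (simp add: fact_reduce)
    ultimately show ?thesis
      using assms k by (simp add: hcoeff_def mult_ac)
  qed
  then have "A_star l s t = (\<Sum>k | 2 * k \<le> l - 1. real l / sqrt (pi / 2)
      * (hcoeff (l - 1) k * s ^ (l - 1 - 2 * k) * hbessel (1 + (l - 1) - k) (t\<^sup>2 + s\<^sup>2 - s\<^sup>2)))"
    unfolding A_star_def I by (intro sum.cong refl) simp
  then show ?thesis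
    unfolding sum_distrib_left[symmetric] hbessel_deriv_eq_sum'[symmetric] by simp
qed

lemma B_star_eq:
  assumes "t \<ge> 0"
  shows "B_star l s t = - hbessel_deriv l 0 s (t\<^sup>2 + s\<^sup>2) / sqrt (pi / 2)"
    and "C_star l s t = - hbessel_deriv l 1 s (t\<^sup>2 + s\<^sup>2) / sqrt (pi / 2)"
proof -
  have I: "{k. int k \<le> \<lfloor>real l / 2\<rfloor>} = {k. 2 * k \<le> l}"
    by (auto simp: le_floor_iff)
  \<comment> \<open>One computation for both sums: m = 0 gives the orders in \<open>B_star\<close>,
    m = 1 those in \<open>C_star\<close>.\<close>
  have *: "s ^ (l - 2 * k) * (1 / (2 ^ k * fact k)) * (Gamma (real l + 1) / Gamma (real l - 2 * real k + 1))
       * bessel_J_tilde \<alpha> t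
     = 1 / sqrt (pi / 2) * (hcoeff l k * s ^ (l - 2 * k) * hbessel (m + l - k) (t\<^sup>2 + s\<^sup>2 - s\<^sup>2))"
    if k: "2 * k \<le> l" and "\<alpha> = real (m + l - k) - 1 / 2" for k m \<alpha>
  proof -
    have "Gamma (real l - 2 * real k + 1) = fact (l - 2 * k)"
      using Gamma_nat_Suc[of "l - 2 * k"] k by (simp add: of_nat_diff algebra_simps)
    moreover have "bessel_J_tilde \<alpha> t = hbessel (m + l - k) (t\<^sup>2) / sqrt (pi / 2)"
      unfolding that(2) by (rule bessel_J_tilde_eq_hbessel[OF assms])
    ultimately show ?thesis
      using k by (simp add: hcoeff_def Gamma_nat_Suc mult_ac)
  qed
  have "B_star l s t = - (\<Sum>k | 2 * k \<le> l. 1 / sqrt (pi / 2)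
      * (hcoeff l k * s ^ (l - 2 * k) * hbessel (0 + l - k) (t\<^sup>2 + s\<^sup>2 - s\<^sup>2)))"
    unfolding B_star_def I
    by (intro arg_cong[where f = uminus] sum.cong refl *) (auto simp: of_nat_diff field_simps)
  then show "B_star l s t = - hbessel_deriv l 0 s (t\<^sup>2 + s\<^sup>2) / sqrt (pi / 2)"
    unfolding sum_distrib_left[symmetric] hbessel_deriv_eq_sum'[symmetric] by simp
  have "C_star l s t = - (\<Sum>k | 2 * k \<le> l. 1 / sqrt (pi / 2)
      * (hcoeff l k * s ^ (l - 2 * k) * hbessel (1 + l - k) (t\<^sup>2 + s\<^sup>2 - s\<^sup>2)))"
    unfolding C_star_def I
    by (intro arg_cong[where f = uminus] sum.cong refl *) (auto simp: of_nat_diff field_simps)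
  then show "C_star l s t = - hbessel_deriv l 1 s (t\<^sup>2 + s\<^sup>2) / sqrt (pi / 2)"
    unfolding sum_distrib_left[symmetric] hbessel_deriv_eq_sum'[symmetric] by simp
qed

section \<open>Gaussian integrals and polynomial growth\<close>

lemma integrable_norm_le:
  fixes f :: "'a \<Rightarrow> 'b::{banach, second_countable_topology}"
  assumes "integrable M g" "f \<in> borel_measurable M" "\<And>x. norm (f x) \<le> (g x :: real)"
  shows "integrable M f"
  by (rule Bochner_Integration.integrable_bound[OF assms(1,2)])
     (auto intro: order_trans[OF assms(3) abs_ge_self])

lemma lborel_integrable_translate:
  fixes f :: "'a::euclidean_space \<Rightarrow> 'b::{banach, second_countable_topology}"
  assumes "integrable lborel f"
  shows "integrable lborel (\<lambda>y. f (y + c))"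
proof -
  have "integrable (distr lborel borel ((+) c)) f" using assms by (simp add: lborel_distr_plus)
  then show ?thesis by (subst (asm) integrable_distr_eq) (use assms in \<open>auto simp: add.commute\<close>)
qed

lemma lborel_integral_translate:
  fixes f :: "'a::euclidean_space \<Rightarrow> 'b::{banach, second_countable_topology}"
  assumes [measurable]: "f \<in> borel_measurable borel"
  shows "(LINT y|lborel. f (y + c)) = (LINT y|lborel. f y)"
proof -
  have "(LINT y|lborel. f y) = (LINT y|distr lborel borel ((+) c). f y)" by (simp add: lborel_distr_plus)
  also have "\<dots> = (LINT y|lborel. f (y + c))" by (subst integral_distr) (auto simp: add.commute)
  finally show ?thesis by simp
qed

text \<open>Differentiation under the integral sign in integrated form: a bound on the L^1 norms of
  the derivative, uniform in t, replaces a pointwise dominating function.\<close>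

lemma integral_Fubini_primitive:
  fixes F :: "real \<Rightarrow> 'a::euclidean_space \<Rightarrow> 'b::euclidean_space"
  assumes T: "T \<ge> 0"
    and d: "\<And>t y. ((\<lambda>t. f t y) has_vector_derivative F t y) (at t)"
    and cont: "continuous_on UNIV (\<lambda>(t, y). F t y)"
    and int: "\<And>t. integrable lborel (F t)" "\<And>t. (LINT y|lborel. norm (F t y)) \<le> B"
    and f: "integrable lborel (f 0)" "integrable lborel (f T)"
  shows "(LINT y|lborel. f T y) - (LINT y|lborel. f 0 y)
      = (LINT t|lborel. indicator {0..T} t *\<^sub>R (LINT y|lborel. F t y))"
proof -
  have [measurable]: "(\<lambda>(t, y). F t y) \<in> borel_measurable (lborel \<Otimes>\<^sub>M lborel)"
    using borel_measurable_continuous_onI[OF cont] by (simp add: lborel_prod)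
  have c1: "continuous_on S (\<lambda>t. F t y)" for S y
  proof -
    have "continuous_on S (\<lambda>t. (t, y))" by (intro continuous_intros)
    from continuous_on_compose2[OF cont this] show ?thesis by simp
  qed
  have 1: "f T y - f 0 y = (LINT t|lborel. indicator {0..T} t *\<^sub>R F t y)" for y
  proof -
    have "((\<lambda>t. F t y) has_integral (f T y - f 0 y)) {0..T}"
      by (rule fundamental_theorem_of_calculus[OF T]) (rule has_vector_derivative_at_within[OF d])
    moreover have "set_integrable lborel {0..T} (\<lambda>t. F t y)"
      unfolding set_integrable_def by (rule borel_integrable_compact[OF compact_Icc c1])
    then have "(LINT t:{0..T}|lborel. F t y) = integral {0..T} (\<lambda>t. F t y)"
      by (rule set_borel_integral_eq_integral(2))
    ultimately show ?thesis
      unfolding set_lebesgue_integral_def by (simp add: integral_unique)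
  qed
  have "integrable (lborel \<Otimes>\<^sub>M lborel) (\<lambda>(t, y). indicator {0..T} t *\<^sub>R F t y)"
  proof (rule lborel_pair.Fubini_integrable)
    show "AE t in lborel. integrable lborel (\<lambda>y. case (t, y) of (t, y) \<Rightarrow> indicator {0..T} t *\<^sub>R F t y)"
      using int(1) by simp
    have "integrable lborel (\<lambda>t. indicator {0..T} t *\<^sub>R B :: real)"
      by (rule borel_integrable_compact[OF compact_Icc continuous_on_const])
    then show "integrable lborel (\<lambda>t. LINT y|lborel. norm (case (t, y) of (t, y) \<Rightarrow> indicator {0..T} t *\<^sub>R
        F t y))"
    proof (rule Bochner_Integration.integrable_bound)
      show "AE t in lborel. norm (LINT y|lborel. norm (case (t, y) of (t, y) \<Rightarrow> indicator {0..T} t *\<^sub>R F t y))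
          \<le> norm (indicator {0..T} t *\<^sub>R B)"
        using int(2) by (auto split: split_indicator intro!: AE_I2 order_trans[OF int(2)] simp:
            integral_nonneg_AE)
    qed measurable
  qed measurable
  from lborel_pair.Fubini_integral[OF this]
  have "(LINT y|lborel. LINT t|lborel. indicator {0..T} t *\<^sub>R F t y)
      = (LINT t|lborel. LINT y|lborel. indicator {0..T} t *\<^sub>R F t y)"
    by simp
  then show ?thesis
    using f by (simp flip: 1 add: Bochner_Integration.integral_diff)
qed

text \<open>Integration by parts without boundary terms: translates of f have the same integral,
  while the derivative along the translation integrates to a quantity that does not depend on
  t.\<close>

lemma integral_directional_derivative_eq_0:
  fixes f f' :: "'a::euclidean_space \<Rightarrow> 'b::euclidean_space"
  assumes d: "\<And>y u. ((\<lambda>u. f (y + u *\<^sub>R v)) has_vector_derivative f' (y + u *\<^sub>R v)) (at u)"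
    and cont: "continuous_on UNIV f'" and int: "integrable lborel f" "integrable lborel f'"
  shows "(LINT y|lborel. f' y) = 0"
proof -
  have [measurable]: "f \<in> borel_measurable borel" "f' \<in> borel_measurable borel"
    using int by (auto dest: borel_measurable_integrable)
  have "(LINT y|lborel. f (y + 1 *\<^sub>R v)) - (LINT y|lborel. f (y + 0 *\<^sub>R v))
      = (LINT t|lborel. indicator {0..1} t *\<^sub>R (LINT y|lborel. f' (y + t *\<^sub>R v)))"
  proof (rule integral_Fubini_primitive)
    show "continuous_on UNIV (\<lambda>(t, y). f' (y + t *\<^sub>R v))"
      unfolding case_prod_unfold by (rule continuous_on_compose2[OF cont]) (auto intro!: continuous_intros)
    show "(LINT y|lborel. norm (f' (y + t *\<^sub>R v))) \<le> (LINT y|lborel. norm (f' y))" for t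
      by (subst lborel_integral_translate[of "\<lambda>y. norm (f' y)"]) auto
  qed (auto intro!: d lborel_integrable_translate int)
  then show ?thesis
    by (simp add: lborel_integral_translate)
qed

section \<open>Product integrals and integrable weights\<close>

lemma lborel_prod_Basis:
  fixes f :: "'a::euclidean_space \<Rightarrow> real \<Rightarrow> 'b::{real_normed_field,banach,second_countable_topology}"
  assumes "\<And>b. b \<in> Basis \<Longrightarrow> integrable lborel (f b)"
  shows "integrable lborel (\<lambda>x::'a. \<Prod>b\<in>Basis. f b (x \<bullet> b))"
    and "(LINT x|lborel. (\<Prod>b\<in>Basis. f b (x \<bullet> b))) = (\<Prod>b\<in>(Basis::'a set). LINT t|lborel. f b t)"
proof -
  interpret product_sigma_finite "\<lambda>_::'a. lborel :: real measure" by standard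
  have [measurable]: "f b \<in> borel_measurable borel" if "b \<in> Basis" for b
    using assms[OF that] by (auto dest: borel_measurable_integrable)
  let ?F = "\<lambda>x::'a. \<Prod>b\<in>Basis. f b (x \<bullet> b)" and ?M = "\<Pi>\<^sub>M b\<in>(Basis::'a set). (lborel :: real measure)"
  have m[measurable]: "?F \<in> borel_measurable borel" by measurable
  have e: "?F (\<Sum>b\<in>Basis. g b *\<^sub>R b) = (\<Prod>b\<in>Basis. f b (g b))" for g
    by (intro prod.cong refl) (simp add: inner_sum_left inner_Basis if_distrib sum.delta cong: if_cong)
  have T[measurable]: "(\<lambda>g. \<Sum>b\<in>Basis. g b *\<^sub>R b) \<in> measurable ?M (borel :: 'a measure)" by measurable
  show "integrable lborel ?F"
    unfolding lborel_eq[where 'a = 'a] using product_integrable_prod[OF finite_Basis assms]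
    by (subst integrable_distr_eq) (auto simp: e)
  show "(LINT x|lborel. ?F x) = (\<Prod>b\<in>(Basis::'a set). LINT t|lborel. f b t)"
    unfolding lborel_eq[where 'a = 'a] using product_integral_prod[OF finite_Basis assms]
    by (subst integral_distr) (auto simp: e)
qed

text \<open>Two powers are spent on each coordinate, where they are dominated by the one-dimensional
  weight 1 / (1 + x^2).\<close>

lemma integrable_inverse_one_plus_norm_power:
  "integrable lborel (\<lambda>x::'a::euclidean_space. 1 / (1 + norm x) ^ (2 * DIM('a)))"
proof -
  have "integrable lborel (\<lambda>x::real. inverse (1 + x\<^sup>2))"
    using integrable_inverse_1_plus_square by (simp add: set_integrable_def)
  then have "integrable lborel (\<lambda>x::'a. \<Prod>b\<in>Basis. inverse (1 + (x \<bullet> b)\<^sup>2))"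
    by (intro lborel_prod_Basis) auto
  then show ?thesis
  proof (rule integrable_norm_le)
    have "1 / (1 + norm x) ^ (2 * DIM('a)) \<le> (\<Prod>b\<in>Basis. inverse (1 + (x \<bullet> b)\<^sup>2))" for x :: 'a
    proof -
      have "1 / (1 + norm x) ^ (2 * DIM('a)) = (\<Prod>b\<in>(Basis::'a set). inverse ((1 + norm x)\<^sup>2))"
        by (simp add: power_mult power_inverse divide_inverse)
      also have "\<dots> \<le> (\<Prod>b\<in>Basis. inverse (1 + (x \<bullet> b)\<^sup>2))"
      proof (intro prod_mono conjI le_imp_inverse_le)
        fix b :: 'a assume b: "b \<in> Basis"
        have "(x \<bullet> b)\<^sup>2 \<le> (norm x)\<^sup>2" using Basis_le_norm[OF b, of x]
            by (simp add: abs_le_square_iff[symmetric])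
        also have "1 + \<dots> \<le> (1 + norm x)\<^sup>2" by (simp add: power2_eq_square algebra_simps)
        finally show "1 + (x \<bullet> b)\<^sup>2 \<le> (1 + norm x)\<^sup>2" by simp
      qed (auto intro: add_pos_nonneg)
      finally show ?thesis .
    qed
    then show "norm (1 / (1 + norm x) ^ (2 * DIM('a)) :: real) \<le> (\<Prod>b\<in>Basis. inverse (1 + (x \<bullet> b)\<^sup>2))"
        for x :: 'a
      by simp
  qed measurable
qed

lemma power_le_exp: "x \<ge> 0 \<Longrightarrow> x ^ k \<le> fact k * exp (x::real)"
proof -
  assume x: "x \<ge> 0"
  have "(\<Sum>n\<in>{k}. x ^ n /\<^sub>R fact n) \<le> (\<Sum>n. x ^ n /\<^sub>R fact n)"
    using x by (intro sum_le_suminf summable_exp_generic) auto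
  then show ?thesis by (simp add: exp_def field_simps)
qed

lemma power_gauss_bounded:
  assumes "\<epsilon> > 0"
  shows "\<exists>C\<ge>0. \<forall>r\<ge>0. (1 + r) ^ M * exp (- \<epsilon> * r\<^sup>2 / 2) \<le> (C::real)"
proof (intro exI conjI allI impI)
  fix r :: real assume r: "r \<ge> 0"
  \<comment> \<open>Powers of 1 + r are traded for powers of r^2, which one term of the exponential
    series controls: 1 + r is at most 2 for r \<le> 1 and at most 2 r^2 otherwise.\<close>
  have "(1 + r) ^ M \<le> 2 ^ M * (1 + (r\<^sup>2) ^ M)"
  proof (cases "r \<le> 1")
    case True
    then have "(1 + r) ^ M \<le> 2 ^ M * 1" using r by (auto intro!: power_mono)
    also have "\<dots> \<le> 2 ^ M * (1 + (r\<^sup>2) ^ M)" by (intro mult_left_mono) auto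
    finally show ?thesis .
  next
    case False
    then have "r * 1 \<le> r * r" by (intro mult_left_mono) auto
    then have "1 + r \<le> 2 * r\<^sup>2" unfolding power2_eq_square using False by linarith
    then have "(1 + r) ^ M \<le> (2 * r\<^sup>2) ^ M" by (rule power_mono) (use r in simp)
    then have "(1 + r) ^ M \<le> 2 ^ M * (r\<^sup>2) ^ M" by (simp only: power_mult_distrib)
    moreover have "0 \<le> (2::real) ^ M" by simp
    ultimately show ?thesis unfolding distrib_left by linarith
  qed
  also have "(r\<^sup>2) ^ M = (2 / \<epsilon>) ^ M * (\<epsilon> * r\<^sup>2 / 2) ^ M"
    unfolding power_mult_distrib[symmetric] using assms by simp
  also have "\<dots> \<le> (2 / \<epsilon>) ^ M * (fact M * exp (\<epsilon> * r\<^sup>2 / 2))"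
    using assms by (intro mult_left_mono power_le_exp) auto
  finally have "(1 + r) ^ M \<le> 2 ^ M * (1 + (2 / \<epsilon>) ^ M * (fact M * exp (\<epsilon> * r\<^sup>2 / 2)))" by simp
  also have "\<dots> \<le> 2 ^ M * (exp (\<epsilon> * r\<^sup>2 / 2) + (2 / \<epsilon>) ^ M * (fact M * exp (\<epsilon> * r\<^sup>2 / 2)))"
    using assms by (intro mult_left_mono add_mono) auto
  also have "\<dots> = 2 ^ M * (1 + (2 / \<epsilon>) ^ M * fact M) * exp (\<epsilon> * r\<^sup>2 / 2)" by (simp add: algebra_simps)
  finally show "(1 + r) ^ M * exp (- \<epsilon> * r\<^sup>2 / 2) \<le> 2 ^ M * (1 + (2 / \<epsilon>) ^ M * fact M)"
    by (simp add: exp_minus field_simps)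
qed (use assms in auto)

lemma integrable_power_gauss:
  assumes "\<epsilon> > 0"
  shows "integrable lborel (\<lambda>x::'a::euclidean_space. (1 + norm x) ^ N * exp (- \<epsilon> * (norm x)\<^sup>2 / 2))"
proof -
  obtain C where C: "C \<ge> 0" "\<And>r. r \<ge> 0 \<Longrightarrow> (1 + r) ^ (N + 2 * DIM('a)) * exp (- \<epsilon> * r\<^sup>2 / 2) \<le> C"
    using power_gauss_bounded[OF assms] by blast
  have "integrable lborel (\<lambda>x::'a. C * (1 / (1 + norm x) ^ (2 * DIM('a))))"
    by (intro integrable_mult_right integrable_inverse_one_plus_norm_power)
  then show ?thesis
  proof (rule integrable_norm_le)
    have "(1 + norm x) ^ N * exp (- \<epsilon> * (norm x)\<^sup>2 / 2) \<le> C * (1 / (1 + norm x) ^ (2 * DIM('a)))" for x :: 'a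
    proof -
      have "(1 + norm x) ^ (2 * DIM('a)) > 0" by (simp add: add_pos_nonneg)
      then show ?thesis using C(2)[of "norm x"] by (simp add: power_add field_simps)
    qed
    then show "norm ((1 + norm x) ^ N * exp (- \<epsilon> * (norm x)\<^sup>2 / 2))
        \<le> C * (1 / (1 + norm x) ^ (2 * DIM('a)))" for x :: 'a
      by simp
  qed measurable
qed

section \<open>Functions of polynomial growth\<close>

text \<open>The bound is uniform in the index, which is the flow time in most uses; a single
  function is indexed by \<open>unit\<close>.\<close>

definition pgrowth :: "('i \<Rightarrow> 'a::real_normed_vector \<Rightarrow> 'b::real_normed_vector) \<Rightarrow> bool" where
  "pgrowth f \<longleftrightarrow> (\<exists>C\<ge>0. \<exists>N. \<forall>i y. norm (f i y) \<le> C * (1 + norm y) ^ N)"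

lemma pgrowthI: "C \<ge> 0 \<Longrightarrow> (\<And>i y. norm (f i y) \<le> C * (1 + norm y) ^ N) \<Longrightarrow> pgrowth f"
  unfolding pgrowth_def by blast

lemma pgrowth_const: "pgrowth (\<lambda>i y. c)"
  by (rule pgrowthI[of "norm c" _ 0]) auto

lemma pgrowth_bounded_linear:
  assumes "bounded_linear h" "pgrowth f"
  shows "pgrowth (\<lambda>i y. h (f i y))"
proof -
  obtain K where K: "K \<ge> 0" "\<And>x. norm (h x) \<le> norm x * K"
    using bounded_linear.nonneg_bounded[OF assms(1)] by blast
  obtain C N where C: "C \<ge> 0" "\<And>i y. norm (f i y) \<le> C * (1 + norm y) ^ N"
    using assms(2) unfolding pgrowth_def by blast
  have "norm (h (f i y)) \<le> C * K * (1 + norm y) ^ N" for i y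
    using mult_right_mono[OF C(2) K(1), of i y] K(2)[of "f i y"] by (simp add: mult_ac)
  then show ?thesis using C K by (intro pgrowthI[of "C * K"]) auto
qed

lemma pgrowth_ident: "pgrowth (\<lambda>i y. y)"
  by (rule pgrowthI[of 1 _ 1]) auto

lemmas pgrowth_linear = pgrowth_bounded_linear[OF _ pgrowth_ident]

lemma pgrowth_bilinear:
  assumes "bounded_bilinear h" "pgrowth f" "pgrowth g"
  shows "pgrowth (\<lambda>i y. h (f i y) (g i y))"
proof -
  obtain K where K: "K \<ge> 0" "\<And>x y. norm (h x y) \<le> norm x * norm y * K"
    using bounded_bilinear.nonneg_bounded[OF assms(1)] by blast
  obtain C N D M where C: "C \<ge> 0" "\<And>i y. norm (f i y) \<le> C * (1 + norm y) ^ N"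
    and D: "D \<ge> 0" "\<And>i y. norm (g i y) \<le> D * (1 + norm y) ^ M"
    using assms(2,3) unfolding pgrowth_def by metis
  have "norm (h (f i y) (g i y)) \<le> C * D * K * (1 + norm y) ^ (N + M)" for i y
  proof -
    have "norm (f i y) * norm (g i y) * K \<le> (C * (1 + norm y) ^ N) * (D * (1 + norm y) ^ M) * K"
      using C D K by (intro mult_right_mono mult_mono) auto
    then show ?thesis using K(2)[of "f i y" "g i y"] by (simp add: power_add mult_ac)
  qed
  then show ?thesis using C D K by (intro pgrowthI[of "C * D * K"]) auto
qed

lemmas pgrowth_scaleR = pgrowth_bilinear[OF bounded_bilinear_scaleR]
  and pgrowth_mult = pgrowth_bilinear[OF bounded_bilinear_mult]

lemma pgrowth_add:
  assumes "pgrowth f" "pgrowth g"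
  shows "pgrowth (\<lambda>i y. f i y + g i y)"
proof -
  obtain C N D M where C: "C \<ge> 0" "\<And>i y. norm (f i y) \<le> C * (1 + norm y) ^ N"
    and D: "D \<ge> 0" "\<And>i y. norm (g i y) \<le> D * (1 + norm y) ^ M"
    using assms unfolding pgrowth_def by metis
  have "norm (f i y + g i y) \<le> (C + D) * (1 + norm y) ^ (N + M)" for i y
  proof -
    have "norm (f i y + g i y) \<le> C * (1 + norm y) ^ N + D * (1 + norm y) ^ M"
      using C(2)[of i y] D(2)[of i y] norm_triangle_ineq[of "f i y" "g i y"] by linarith
    also have "\<dots> \<le> C * (1 + norm y) ^ (N + M) + D * (1 + norm y) ^ (N + M)"
      using C(1) D(1) by (intro add_mono mult_left_mono power_increasing) auto
    finally show ?thesis by (simp add: algebra_simps)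
  qed
  then show ?thesis using C D by (intro pgrowthI[of "C + D"]) auto
qed

lemma pgrowth_minus: "pgrowth f \<Longrightarrow> pgrowth (\<lambda>i y. - f i y)"
  unfolding pgrowth_def by simp

lemma pgrowth_diff: "pgrowth f \<Longrightarrow> pgrowth g \<Longrightarrow> pgrowth (\<lambda>i y. f i y - g i y)"
  using pgrowth_add[OF _ pgrowth_minus, of f g] by simp

lemma pgrowth_sum: "finite A \<Longrightarrow> (\<And>k. k \<in> A \<Longrightarrow> pgrowth (f k)) \<Longrightarrow> pgrowth (\<lambda>i y. \<Sum>k\<in>A. f k i y)"
  by (induction A rule: finite_induct) (auto intro: pgrowth_const pgrowth_add)

lemma one_plus_norm_Pair_le: "1 + norm (x, y) \<le> (1 + norm x) * (1 + norm y)"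
proof -
  have "norm (x, y) \<le> norm x + norm y" by (rule norm_Pair_le)
  moreover have "0 \<le> norm x * norm y" by simp
  moreover have "(1 + norm x) * (1 + norm y) = 1 + norm x + norm y + norm x * norm y"
    by (simp add: algebra_simps)
  ultimately show ?thesis by linarith
qed

lemma pgrowth_Pair:
  assumes "pgrowth (\<lambda>i (x, y). f i x y)"
  obtains C N where "C \<ge> 0" "\<And>i x y. norm (f i x y) \<le> C * (1 + norm x) ^ N * (1 + norm y) ^ N"
proof -
  obtain C N where C: "C \<ge> 0" "\<And>i x y. norm (f i x y) \<le> C * (1 + norm (x, y)) ^ N"
    using assms unfolding pgrowth_def by (auto simp: case_prod_unfold)
  have "norm (f i x y) \<le> C * (1 + norm x) ^ N * (1 + norm y) ^ N" for i x y
  proof -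
    have "C * (1 + norm (x, y)) ^ N \<le> C * ((1 + norm x) * (1 + norm y)) ^ N"
      using C(1) by (intro mult_left_mono power_mono one_plus_norm_Pair_le) auto
    then show ?thesis using C(2)[of i x y] by (simp add: power_mult_distrib)
  qed
  then show ?thesis using C(1) that by blast
qed

lemma pgrowth_Pair1:
  assumes "pgrowth (\<lambda>i (x, y). f i x y)"
  shows "pgrowth (\<lambda>i y. f i x y)"
proof -
  obtain C N where "C \<ge> 0" "\<And>i x y. norm (f i x y) \<le> C * (1 + norm x) ^ N * (1 + norm y) ^ N"
    using pgrowth_Pair[OF assms] by metis
  then show ?thesis by (intro pgrowthI[of "C * (1 + norm x) ^ N"]) auto
qed

text \<open>One B serves all indices, as the hypothesis on L^1 norms in
  \<open>integral_Fubini_primitive\<close> requires.\<close>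

lemma pgrowth_gauss:
  fixes f :: "'i \<Rightarrow> 'a::euclidean_space \<Rightarrow> 'b::{banach, second_countable_topology}"
  assumes "pgrowth f" "\<epsilon> > 0"
  obtains B where "\<And>i. f i \<in> borel_measurable borel
      \<Longrightarrow> integrable lborel (\<lambda>y. exp (- \<epsilon> * (norm y)\<^sup>2 / 2) *\<^sub>R f i y)"
    "\<And>i. f i \<in> borel_measurable borel \<Longrightarrow> (LINT y|lborel. norm (exp (- \<epsilon> * (norm y)\<^sup>2 / 2) *\<^sub>R f i y)) \<le> B"
proof -
  obtain C N where C: "C \<ge> 0" "\<And>i y. norm (f i y) \<le> C * (1 + norm y) ^ N"
    using assms unfolding pgrowth_def by metis
  let ?G = "\<lambda>y::'a. C * ((1 + norm y) ^ N * exp (- \<epsilon> * (norm y)\<^sup>2 / 2))"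
  have G: "integrable lborel ?G" by (intro integrable_mult_right integrable_power_gauss assms)
  have le: "norm (exp (- \<epsilon> * (norm y)\<^sup>2 / 2) *\<^sub>R f i y) \<le> ?G y" for i y
    using mult_left_mono[OF C(2), of "exp (- \<epsilon> * (norm y)\<^sup>2 / 2)" i y] by (simp add: mult_ac)
  have int: "integrable lborel (\<lambda>y. exp (- \<epsilon> * (norm y)\<^sup>2 / 2) *\<^sub>R f i y)"
      if [measurable]: "f i \<in> borel_measurable borel" for i
    by (rule integrable_norm_le[OF G _ le]) measurable
  show ?thesis
    by (rule that[of "integral\<^sup>L lborel ?G", OF int]) (assumption, intro integral_mono integrable_norm
        int G le)
qed

section \<open>The Fourier transform of a Gaussian\<close>

text \<open>Rescaling by c = 1 / sqrt \<epsilon> reduces the integral to the characteristic function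
  of the standard normal distribution.\<close>

lemma gauss_fourier_real:
  fixes v :: real
  assumes "\<epsilon> > 0"
  shows "integrable lborel (\<lambda>x. exp (- \<epsilon> * x\<^sup>2 / 2) *\<^sub>R iexp (v * x))"
    and "(LINT x|lborel. exp (- \<epsilon> * x\<^sup>2 / 2) *\<^sub>R iexp (v * x))
      = of_real (sqrt (2 * pi / \<epsilon>) * exp (- v\<^sup>2 / (2 * \<epsilon>)))"
proof -
  interpret N: real_distribution std_normal_distribution by (rule real_dist_normal_dist)
  define c where "c = 1 / sqrt \<epsilon>"
  define w where "w = v * c"
  define f where "f x = exp (- \<epsilon> * x\<^sup>2 / 2) *\<^sub>R iexp (v * x)" for x :: real
  have c: "c > 0" "c \<noteq> 0" "\<epsilon> * c\<^sup>2 = 1" "c\<^sup>2 = 1 / \<epsilon>" using assms by (auto simp: c_def power_divide)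
  have f: "f (0 + c * x) = sqrt (2 * pi) *\<^sub>R (std_normal_density x *\<^sub>R iexp (w * x))" for x
  proof -
    have "\<epsilon> * (c * x)\<^sup>2 = (\<epsilon> * c\<^sup>2) * x\<^sup>2" by (simp add: power_mult_distrib)
    then have "\<epsilon> * (c * x)\<^sup>2 = x\<^sup>2" unfolding c(3) by simp
    then have "- \<epsilon> * (0 + c * x)\<^sup>2 / 2 = - x\<^sup>2 / 2" by simp
    then show ?thesis
      unfolding f_def std_normal_density_def w_def by (simp add: mult_ac)
  qed
  have "integrable std_normal_distribution (\<lambda>x. iexp (w * x))"
    by (rule N.integrable_iexp) auto
  then have i: "integrable lborel (\<lambda>x. std_normal_density x *\<^sub>R iexp (w * x))"
    by (subst (asm) integrable_density) auto
  have "char std_normal_distribution w = (LINT x|lborel. std_normal_density x *\<^sub>R iexp (w * x))"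
    unfolding char_def by (subst integral_density) auto
  then have e: "(LINT x|lborel. std_normal_density x *\<^sub>R iexp (w * x)) = of_real (exp (- w\<^sup>2 / 2))"
    by (simp add: char_std_normal_distribution)
  have "integrable lborel (\<lambda>x. f (0 + c * x))"
    unfolding f using i by (rule integrable_scaleR_right)
  then show "integrable lborel (\<lambda>x. exp (- \<epsilon> * x\<^sup>2 / 2) *\<^sub>R iexp (v * x))"
    using lborel_integrable_real_affine_iff[OF c(2), of f 0] unfolding f_def by blast
  have "(LINT x|lborel. f x) = c *\<^sub>R (LINT x|lborel. f (0 + c * x))"
    using lborel_integral_real_affine[OF c(2), of f 0] c(1) by simp
  also have "\<dots> = of_real (c * sqrt (2 * pi) * exp (- w\<^sup>2 / 2))"
    unfolding f integral_scaleR_right e by (simp add: scaleR_conv_of_real)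
  also have "c * sqrt (2 * pi) * exp (- w\<^sup>2 / 2) = sqrt (2 * pi / \<epsilon>) * exp (- v\<^sup>2 / (2 * \<epsilon>))"
    by (simp add: w_def power_mult_distrib c(4)) (simp add: c_def real_sqrt_divide)
  finally show "(LINT x|lborel. exp (- \<epsilon> * x\<^sup>2 / 2) *\<^sub>R iexp (v * x))
      = of_real (sqrt (2 * pi / \<epsilon>) * exp (- v\<^sup>2 / (2 * \<epsilon>)))"
    unfolding f_def .
qed

lemma gauss_fourier:
  fixes v :: "'a::euclidean_space"
  assumes "\<epsilon> > 0"
  shows "(LINT y|lborel. exp (- \<epsilon> * (norm y)\<^sup>2 / 2) * cos (v \<bullet> y))
    = (2 * pi / \<epsilon>) powr (real DIM('a) / 2) * exp (- (norm v)\<^sup>2 / (2 * \<epsilon>))"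
proof -
  define f where "f b t = exp (- \<epsilon> * t\<^sup>2 / 2) *\<^sub>R iexp ((v \<bullet> b) * t)" for b :: 'a and t :: real
  have nrm: "(norm y)\<^sup>2 = (\<Sum>b\<in>Basis. (y \<bullet> b)\<^sup>2)" for y :: 'a
    by (subst norm_eq_sqrt_inner, subst euclidean_inner) (simp add: power2_eq_square sum_nonneg)
  have f: "(\<Prod>b\<in>Basis. f b (y \<bullet> b)) = exp (- \<epsilon> * (norm y)\<^sup>2 / 2) *\<^sub>R cis (v \<bullet> y)" for y
  proof -
    have "(\<Prod>b\<in>Basis. f b (y \<bullet> b)) = of_real (\<Prod>b\<in>Basis. exp (- \<epsilon> * (y \<bullet> b)\<^sup>2 / 2)) * (\<Prod>b\<in>Basis. iexp ((v \<bullet>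
        b) * (y \<bullet> b)))"
      unfolding f_def scaleR_conv_of_real prod.distrib by simp
    also have "(\<Prod>b\<in>Basis. iexp ((v \<bullet> b) * (y \<bullet> b))) = iexp (v \<bullet> y)"
      by (subst euclidean_inner[of v y]) (simp add: exp_sum[symmetric] sum_distrib_left)
    also have "(\<Prod>b\<in>Basis. exp (- \<epsilon> * (y \<bullet> b)\<^sup>2 / 2)) = exp (- \<epsilon> * (norm y)\<^sup>2 / 2)"
      unfolding nrm by (simp add: exp_sum[symmetric] sum_distrib_left sum_divide_distrib sum_negf)
    finally show ?thesis by (simp add: scaleR_conv_of_real cis_conv_exp)
  qed
  have i: "integrable lborel (f b)" for b unfolding f_def using gauss_fourier_real(1)[OF assms] .
  have I: "integrable lborel (\<lambda>y. exp (- \<epsilon> * (norm y)\<^sup>2 / 2) *\<^sub>R cis (v \<bullet> y))"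
    using lborel_prod_Basis(1)[of f, OF i] unfolding f .
  have "(LINT y|lborel. exp (- \<epsilon> * (norm y)\<^sup>2 / 2) * cos (v \<bullet> y))
      = (LINT y|lborel. Re (exp (- \<epsilon> * (norm y)\<^sup>2 / 2) *\<^sub>R cis (v \<bullet> y)))"
    by simp
  also have "\<dots> = Re (LINT y|lborel. exp (- \<epsilon> * (norm y)\<^sup>2 / 2) *\<^sub>R cis (v \<bullet> y))"
    by (rule integral_Re[OF I])
  also have "(LINT y|lborel. exp (- \<epsilon> * (norm y)\<^sup>2 / 2) *\<^sub>R cis (v \<bullet> y))
      = (\<Prod>b\<in>Basis. of_real (sqrt (2 * pi / \<epsilon>) * exp (- (v \<bullet> b)\<^sup>2 / (2 * \<epsilon>))))"
    unfolding f[symmetric] lborel_prod_Basis(2)[of f, OF i] unfolding f_def gauss_fourier_real(2)[OF assms] ..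
  also have "Re \<dots> = (\<Prod>b\<in>(Basis::'a set). sqrt (2 * pi / \<epsilon>) * exp (- (v \<bullet> b)\<^sup>2 / (2 * \<epsilon>)))"
    unfolding of_real_prod[symmetric] Re_complex_of_real ..
  also have "\<dots> = sqrt (2 * pi / \<epsilon>) ^ DIM('a) * exp (- (norm v)\<^sup>2 / (2 * \<epsilon>))"
    unfolding nrm by (simp add: prod.distrib exp_sum[symmetric] sum_divide_distrib sum_negf)
  also have "sqrt (2 * pi / \<epsilon>) ^ DIM('a) = (2 * pi / \<epsilon>) powr (real DIM('a) / 2)"
    using assms by (simp add: powr_half_sqrt[symmetric] powr_powr flip: powr_realpow)
  finally show ?thesis .
qed

section \<open>Orthogonality of the kernel against Gaussians\<close>

lemma pgrowth_reindex: "pgrowth f \<Longrightarrow> pgrowth (\<lambda>j. f (h j))"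
  unfolding pgrowth_def by blast

lemma pgrowth_gauss_integrable:
  fixes f :: "'i \<Rightarrow> 'a::euclidean_space \<Rightarrow> 'b::{banach, second_countable_topology}"
  assumes "pgrowth f" "\<epsilon> > 0" "continuous_on UNIV (f i)"
  shows "integrable lborel (\<lambda>y. exp (- \<epsilon> * (norm y)\<^sup>2 / 2) *\<^sub>R f i y)"
  by (rule pgrowth_gauss[OF assms(1,2)]) (use borel_measurable_continuous_onI[OF assms(3)] in blast)

lemmas pgrowth_cmult = pgrowth_bilinear[OF bounded_bilinear_cmult]
  and pgrowth_cconj = pgrowth_bounded_linear[OF bounded_linear_cconj]

lemma continuous_on_cconj [continuous_intros]:
  "continuous_on S f \<Longrightarrow> continuous_on S (\<lambda>x. cconj (f x))"
  by (rule bounded_linear.continuous_on[OF bounded_linear_cconj])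

lemmas continuous_on_cmult [continuous_intros] = bounded_bilinear.continuous_on[OF bounded_bilinear_cmult]
  and continuous_on_wedge [continuous_intros] = bounded_bilinear.continuous_on[OF bounded_bilinear_wedge]

text \<open>
  \<open>\<Gamma>\<^sub>y = - \<Sum>\<^sub>k (y \<and> e\<^sub>k) \<partial>\<^sub>k\<close>, where \<open>D k\<close> stands for the partial derivative of the argument in direction \<open>k\<close>.
\<close>

definition gamma_op :: "('n \<Rightarrow> (real, 'n::{finite,linorder}) vec \<Rightarrow> 'n clifford) \<Rightarrow> (real, 'n) vec \<Rightarrow> 'n
    clifford" where
  "gamma_op D y = - (\<Sum>k\<in>UNIV. wedge y (axis k 1) \<odot> D k y)"

lemma gauss_has_vector_derivative:
  fixes y :: "(real, 'n::finite) vec"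
  shows "((\<lambda>u. exp (- \<epsilon> * (norm (y + u *\<^sub>R axis k 1))\<^sup>2 / 2)) has_real_derivative
    - \<epsilon> * (y + u *\<^sub>R axis k 1) $ k * exp (- \<epsilon> * (norm (y + u *\<^sub>R axis k 1))\<^sup>2 / 2)) (at u)"
proof -
  have e: "(norm (y + u *\<^sub>R axis k 1))\<^sup>2 = (norm y)\<^sup>2 + 2 * u * y $ k + u\<^sup>2" for u
    unfolding power2_norm_eq_inner
    by (simp add: inner_add_left inner_add_right inner_axis inner_commute[of "axis k 1"] power2_eq_square
        algebra_simps)
  have "((\<lambda>u. - \<epsilon> * ((norm y)\<^sup>2 + 2 * u * y $ k + u\<^sup>2) / 2) has_real_derivative - \<epsilon> * (y + u *\<^sub>R axis k
      1) $ k) (at u)"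
    by (auto intro!: derivative_eq_intros simp: axis_def field_simps)
  from DERIV_fun_exp[OF this] show ?thesis
    unfolding e by (simp add: mult.commute)
qed

text \<open>Integration by parts in every coordinate. The sign it produces is compensated by the
  conjugation, which negates the bivectors in \<Gamma>; derivatives of the coefficients and of the
  weight contribute nothing.\<close>

lemma gamma_op_symmetric:
  fixes f g :: "(real, 'n::{finite,linorder}) vec \<Rightarrow> 'n clifford"
  assumes df: "\<And>k y u. ((\<lambda>u. f (y + u *\<^sub>R axis k 1)) has_vector_derivative Df k (y + u *\<^sub>R axis k 1)) (at u)"
    and dg: "\<And>k y u. ((\<lambda>u. g (y + u *\<^sub>R axis k 1)) has_vector_derivative Dg k (y + u *\<^sub>R axis k 1)) (at u)"
    and cont [continuous_intros]: "continuous_on UNIV f" "continuous_on UNIV g" "\<And>k. continuous_on UNIV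
        (Df k)" "\<And>k. continuous_on UNIV (Dg k)"
    and gr: "pgrowth (\<lambda>_::unit. f)" "pgrowth (\<lambda>_::unit. g)" "\<And>k. pgrowth (\<lambda>_::unit. Df k)" "\<And>k. pgrowth
        (\<lambda>_::unit. Dg k)"
    and \<epsilon>: "\<epsilon> > 0"
  defines "w \<equiv> \<lambda>y::(real, 'n) vec. exp (- \<epsilon> * (norm y)\<^sup>2 / 2)"
  shows "(LINT y|lborel. w y *\<^sub>R (cconj (gamma_op Df y) \<odot> g y))
      = (LINT y|lborel. w y *\<^sub>R (cconj (f y) \<odot> gamma_op Dg y))"
proof -
  define N where "N k y = wedge y (axis k 1)" for k :: 'n and y :: "(real, 'n) vec"
  define X where "X k y = cconj (f y) \<odot> N k y \<odot> g y" for k y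
  define X' where "X' k y = cconj (Df k y) \<odot> N k y \<odot> g y + cconj (f y) \<odot> N k y \<odot> Dg k y - (\<epsilon> * y $ k) *\<^sub>R
      X k y" for k y
  have cN [continuous_intros]: "continuous_on UNIV (N k)" for k
    unfolding N_def by (intro continuous_intros)
  have cX [continuous_intros]: "continuous_on UNIV (X k)" for k
    unfolding X_def by (intro continuous_intros)
  have cX': "continuous_on UNIV (X' k)" for k
    unfolding X'_def by (intro continuous_intros)
  have cg: "continuous_on UNIV (gamma_op D)" if "\<And>k. continuous_on UNIV (D k)"
      for D :: "'n \<Rightarrow> (real, 'n) vec \<Rightarrow> 'n clifford"
    unfolding gamma_op_def by (intro continuous_intros that)
  have gN: "pgrowth (\<lambda>_::unit. N k)" for k
    unfolding N_def by (intro pgrowth_linear wedge.bounded_linear_left)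
  have gX: "pgrowth (\<lambda>_::unit. X k)" for k
    unfolding X_def by (intro pgrowth_cmult pgrowth_cconj gr gN)
  have gX': "pgrowth (\<lambda>_::unit. X' k)" for k
    unfolding X'_def
    by (intro pgrowth_add pgrowth_diff pgrowth_scaleR pgrowth_mult pgrowth_const pgrowth_cmult
        pgrowth_cconj gr gN gX
      pgrowth_linear bounded_linear_vec_nth)
  have gg: "pgrowth (\<lambda>_::unit. gamma_op D)" if "\<And>k. pgrowth (\<lambda>_::unit. D k)"
      for D :: "'n \<Rightarrow> (real, 'n) vec \<Rightarrow> 'n clifford"
    unfolding gamma_op_def N_def[symmetric] by (intro pgrowth_minus pgrowth_sum pgrowth_cmult gN that) auto
  have int: "integrable lborel (\<lambda>y. w y *\<^sub>R h y)"
    if "pgrowth (\<lambda>_::unit. h)" "continuous_on UNIV h" for h :: "(real, 'n) vec \<Rightarrow> 'n clifford"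
    unfolding w_def by (rule pgrowth_gauss_integrable[OF that(1) \<epsilon> that(2)])
  have cw: "continuous_on UNIV w" unfolding w_def by (auto intro!: continuous_intros)
  have dX: "((\<lambda>u. w (y + u *\<^sub>R axis k 1) *\<^sub>R X k (y + u *\<^sub>R axis k 1)) has_vector_derivative
      w (y + u *\<^sub>R axis k 1) *\<^sub>R X' k (y + u *\<^sub>R axis k 1)) (at u)" for k y u
  proof -
    let ?z = "y + u *\<^sub>R axis k 1"
    \<comment> \<open>The coefficient is constant in direction k because
      \<open>wedge (axis k 1) (axis k 1)\<close> is 0.\<close>
    have "((\<lambda>u. N k (y + u *\<^sub>R axis k 1)) has_vector_derivative 0) (at u)"
      unfolding N_def wedge.add_left wedge.scaleR_left by simp
    from bounded_bilinear.has_vector_derivative[OF bounded_bilinear_cmult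
        bounded_bilinear.has_vector_derivative[OF bounded_bilinear_cmult
          bounded_linear.has_vector_derivative[OF bounded_linear_cconj df] this] dg]
    have "((\<lambda>u. X k (y + u *\<^sub>R axis k 1)) has_vector_derivative
      cconj (f ?z) \<odot> N k ?z \<odot> Dg k ?z + cconj (Df k ?z) \<odot> N k ?z \<odot> g ?z) (at u)"
      unfolding X_def by (simp add: cmult.zero_right)
    from has_vector_derivative_scaleR[OF gauss_has_vector_derivative this]
    show ?thesis
      unfolding w_def by (rule has_vector_derivative_eq_rhs) (simp add: X'_def algebra_simps)
  qed
  have 0: "(LINT y|lborel. w y *\<^sub>R X' k y) = 0" for k
    by (rule integral_directional_derivative_eq_0[where f = "\<lambda>y. w y *\<^sub>R X k y" and v = "axis k 1"])
       (auto intro!: dX int gX gX' cX cX' continuous_on_scaleR cw)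
  have "(\<Sum>k\<in>UNIV. X' k y) = cconj (gamma_op Df y) \<odot> g y - cconj (f y) \<odot> gamma_op Dg y" for y
  proof -
    \<comment> \<open>The derivative of the Gaussian is radial, so its terms add up to a multiple of
      \<open>wedge y y\<close>.\<close>
    have "(\<Sum>k\<in>UNIV. (\<epsilon> * y $ k) *\<^sub>R X k y) = \<epsilon> *\<^sub>R (cconj (f y) \<odot> (\<Sum>k\<in>UNIV. (y $ k) *\<^sub>R wedge y (axis k
        1)) \<odot> g y)"
      unfolding X_def N_def
      by (simp add: cmult.sum_left cmult.sum_right cmult.scaleR_left cmult.scaleR_right scaleR_sum_right)
    also have "\<dots> = 0" unfolding wedge_axis_right by (simp add: cmult.zero_left cmult.zero_right)
    finally show ?thesis
      unfolding X'_def gamma_op_def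
      by (simp add: sum.distrib sum_subtractf linear_neg[OF linear_cconj] cconj_sum cconj_cmult cconj_wedge
          cmult.minus_left cmult.minus_right cmult.sum_left cmult.sum_right cmult_assoc N_def sum_negf)
  qed
  then have "(LINT y|lborel. w y *\<^sub>R (cconj (gamma_op Df y) \<odot> g y - cconj (f y) \<odot> gamma_op Dg y))
      = (LINT y|lborel. (\<Sum>k\<in>UNIV. w y *\<^sub>R X' k y))"
    by (simp flip: scaleR_sum_right)
  also have "\<dots> = 0"
    using 0 by (subst Bochner_Integration.integral_sum) (auto intro!: int gX' cX')
  finally show ?thesis
    using int[of "\<lambda>y. cconj (gamma_op Df y) \<odot> g y"] int[of "\<lambda>y. cconj (f y) \<odot> gamma_op Dg y"]
    by (simp add: scaleR_diff_right Bochner_Integration.integral_diff gr cont cg gg pgrowth_cmult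
        pgrowth_cconj
        continuous_on_cmult continuous_on_cconj)
qed

section \<open>The flow as a Clifford-valued kernel\<close>

text \<open>
  The parameter \<open>r\<close> is \<open>Re\<close> or \<open>Im\<close>: since the Clifford algebra is real, \<open>u\<^sub>\<theta>\<close> is handled through its
  real and imaginary parts.
\<close>

definition flow_kernel :: "(complex \<Rightarrow> real) \<Rightarrow> flow_exp \<Rightarrow> flow_exp \<Rightarrow> real
    \<Rightarrow> (real, 'n::{finite,linorder}) vec \<Rightarrow> (real, 'n) vec \<Rightarrow> 'n clifford" where
  "flow_kernel r A B \<theta> x y = r (flow_eval A \<theta> (x \<bullet> y) ((norm x)\<^sup>2 * (norm y)\<^sup>2)) *\<^sub>R cone
     + r (flow_eval B \<theta> (x \<bullet> y) ((norm x)\<^sup>2 * (norm y)\<^sup>2)) *\<^sub>R wedge x y"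

text \<open>The chain rule in direction k: \<open>x $ k\<close> is the derivative of s, twice |x|^2
  times \<open>y $ k\<close> that of p, and \<open>wedge x (axis k 1)\<close> that of the
  bivector.\<close>

definition flow_partial :: "(complex \<Rightarrow> real) \<Rightarrow> flow_exp \<Rightarrow> flow_exp \<Rightarrow> real
    \<Rightarrow> (real, 'n::{finite,linorder}) vec \<Rightarrow> 'n \<Rightarrow> (real, 'n) vec \<Rightarrow> 'n clifford" where
  "flow_partial r A B \<theta> x k y = (x $ k) *\<^sub>R flow_kernel r (deriv_s A) (deriv_s B) \<theta> x y
     + (2 * (norm x)\<^sup>2 * y $ k) *\<^sub>R flow_kernel r (deriv_p A) (deriv_p B) \<theta> x y
     + r (flow_eval B \<theta> (x \<bullet> y) ((norm x)\<^sup>2 * (norm y)\<^sup>2)) *\<^sub>R wedge x (axis k 1)"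

lemma inner_square_le: "(x \<bullet> y)\<^sup>2 \<le> (norm x)\<^sup>2 * (norm y)\<^sup>2"
  using Cauchy_Schwarz_ineq[of x y] by (simp add: power2_norm_eq_inner)

lemma pgrowth_flow_eval:
  assumes "bounded_linear r"
  shows "pgrowth (\<lambda>\<theta> (x, y). r (flow_eval e \<theta> (x \<bullet> y) ((norm x)\<^sup>2 * (norm y)\<^sup>2)))"
proof -
  obtain C N where C: "C \<ge> 0" "\<And>\<theta> s p. s\<^sup>2 \<le> p \<Longrightarrow> norm (flow_eval e \<theta> s p) \<le> C * (1 + p) ^ N"
    using norm_flow_eval_le by metis
  have "norm (flow_eval e \<theta> (x \<bullet> y) ((norm x)\<^sup>2 * (norm y)\<^sup>2)) \<le> C * (1 + norm (x, y)) ^ (4 * N)" for \<theta> x y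
  proof -
    have 1: "1 + a\<^sup>2 \<le> (1 + a)\<^sup>2" if "a \<ge> 0" for a :: real using that
        by (simp add: power2_eq_square algebra_simps)
    have "norm x * norm y \<le> norm (x, y) * norm (x, y)"
      using norm_fst_le[of x y] norm_snd_le[of y x] by (intro mult_mono) auto
    also have "1 + \<dots> \<le> (1 + norm (x, y))\<^sup>2" using 1[of "norm (x, y)"] by (simp add: power2_eq_square)
    finally have "(1 + norm x * norm y)\<^sup>2 \<le> ((1 + norm (x, y))\<^sup>2)\<^sup>2" by (intro power_mono) auto
    then have "1 + (norm x)\<^sup>2 * (norm y)\<^sup>2 \<le> (1 + norm (x, y)) ^ 4"
      using 1[of "norm x * norm y"] by (simp add: power_mult_distrib flip: power_mult)
    then have "(1 + (norm x)\<^sup>2 * (norm y)\<^sup>2) ^ N \<le> (1 + norm (x, y)) ^ (4 * N)"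
      unfolding power_mult by (intro power_mono) auto
    from mult_left_mono[OF this C(1)] C(2)[OF inner_square_le, of \<theta> x y] show ?thesis by linarith
  qed
  then have "pgrowth (\<lambda>\<theta> z. flow_eval e \<theta> (fst z \<bullet> snd z) ((norm (fst z))\<^sup>2 * (norm (snd z))\<^sup>2))"
    using C(1) by (intro pgrowthI[of C _ "4 * N"]) (auto simp: case_prod_unfold)
  from pgrowth_bounded_linear[OF assms this] show ?thesis by (simp add: case_prod_unfold)
qed

lemma pgrowth_flow_kernel:
  assumes "bounded_linear r"
  shows "pgrowth (\<lambda>\<theta> (x, y). flow_kernel r A B \<theta> x y)"
proof -
  note e = pgrowth_flow_eval[OF assms, unfolded case_prod_unfold]
  have "pgrowth (\<lambda>_::real. \<lambda>z. wedge (fst z) (snd z))"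
    by (intro pgrowth_bilinear[OF bounded_bilinear_wedge] pgrowth_linear bounded_linear_fst
        bounded_linear_snd)
  then show ?thesis
    unfolding flow_kernel_def case_prod_unfold by (intro pgrowth_add pgrowth_scaleR pgrowth_const e)
qed

lemma pgrowth_flow_partial:
  assumes "bounded_linear r"
  shows "pgrowth (\<lambda>\<theta> y. flow_partial r A B \<theta> x k y)"
  unfolding flow_partial_def
  by (intro pgrowth_add pgrowth_scaleR pgrowth_const pgrowth_Pair1[OF pgrowth_flow_kernel[OF assms]]
     pgrowth_Pair1[OF pgrowth_flow_eval[OF assms]] pgrowth_mult pgrowth_linear bounded_linear_vec_nth)

lemma continuous_on_flow_kernel:
  fixes f :: "'b::t2_space \<Rightarrow> real"
  assumes "bounded_linear r" "continuous_on S f" "continuous_on S g" "continuous_on S h"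
  shows "continuous_on S (\<lambda>z. flow_kernel r A B (f z) (g z) (h z))"
  unfolding flow_kernel_def
  by (intro continuous_intros bounded_linear.continuous_on[OF assms(1)] continuous_on_flow_eval assms)

lemma continuous_on_flow_partial:
  assumes "bounded_linear r"
  shows "continuous_on UNIV (flow_partial r A B \<theta> x k)"
  unfolding flow_partial_def
  by (intro continuous_intros bounded_linear.continuous_on[OF assms(1)] continuous_on_flow_eval
      continuous_on_flow_kernel assms)

lemma flow_kernel_has_vector_derivative:
  assumes "bounded_linear r"
  shows "((\<lambda>\<theta>. flow_kernel r A B \<theta> x y) has_vector_derivative flow_kernel r (deriv_theta A) (deriv_theta
      B) \<theta> x y) (at \<theta>)"
proof -
  have d: "((\<lambda>\<theta>. r (flow_eval e \<theta> s p)) has_real_derivative r (flow_eval (deriv_theta e) \<theta> s p)) (at \<theta>)"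
      for e s p
    unfolding has_real_derivative_iff_has_vector_derivative
    by (rule bounded_linear.has_vector_derivative[OF assms flow_eval_deriv_theta_has_vector_derivative])
  show ?thesis
    unfolding flow_kernel_def
    by (rule has_vector_derivative_eq_rhs)
       (rule has_vector_derivative_add has_vector_derivative_scaleR has_vector_derivative_const d | simp)+
qed

lemma flow_partial_has_vector_derivative:
  assumes "bounded_linear r"
  shows "((\<lambda>u. flow_kernel r A B \<theta> x (y + u *\<^sub>R axis k 1)) has_vector_derivative
     flow_partial r A B \<theta> x k (y + u *\<^sub>R axis k 1)) (at u)"
proof -
  let ?s = "\<lambda>u. x \<bullet> (y + u *\<^sub>R axis k 1)"
  let ?p = "\<lambda>u. (norm x)\<^sup>2 * (norm (y + u *\<^sub>R axis k 1))\<^sup>2"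
  have deriv_s: "(?s has_real_derivative x $ k) (at u)"
    unfolding inner_add_right inner_scaleR_right inner_axis by (auto intro!: derivative_eq_intros)
  have e: "(norm (y + u *\<^sub>R axis k 1))\<^sup>2 = (norm y)\<^sup>2 + 2 * u * y $ k + u\<^sup>2" for u
    unfolding power2_norm_eq_inner
    by (simp add: inner_add_left inner_add_right inner_axis inner_commute[of "axis k 1"] power2_eq_square
        algebra_simps)
  have deriv_p: "(?p has_real_derivative 2 * (norm x)\<^sup>2 * (y + u *\<^sub>R axis k 1) $ k) (at u)"
    unfolding e by (auto intro!: derivative_eq_intros simp: axis_def algebra_simps)
  interpret r: bounded_linear r by fact
  have d: "((\<lambda>u. r (flow_eval e \<theta> (?s u) (?p u))) has_real_derivative
      (x $ k) * r (flow_eval (deriv_s e) \<theta> (?s u) (?p u)) + 2 * (norm x)\<^sup>2 * (y + u *\<^sub>R axis k 1) $ k * r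
          (flow_eval (deriv_p e) \<theta> (?s u) (?p u))) (at u)" for e
    using bounded_linear.has_vector_derivative[OF assms flow_eval_has_vector_derivative[where e
        = e, OF DERIV_const[of \<theta>] deriv_s deriv_p]]
    by (simp add: has_real_derivative_iff_has_vector_derivative r.add r.scaleR)
  have dW: "((\<lambda>u. wedge x (y + u *\<^sub>R axis k 1)) has_vector_derivative wedge x (axis k 1)) (at u)"
    unfolding wedge.add_right wedge.scaleR_right
    by (auto intro!: derivative_eq_intros)
  show ?thesis
    unfolding flow_kernel_def
    by (rule has_vector_derivative_eq_rhs[OF has_vector_derivative_add[OF
          has_vector_derivative_scaleR[OF d has_vector_derivative_const] has_vector_derivative_scaleR[OF
              d dW]]])
       (simp add: flow_partial_def flow_kernel_def algebra_simps)
qed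

text \<open>The s-derivatives come with the sum of x_k (y \<and> e_k), which is minus W, and W^2 =
  s^2 - p mixes a and b. The p-derivatives come with \<open>wedge y y\<close> = 0. Differentiating W
  itself yields the dimension constants.\<close>

lemma gamma_op_flow_kernel:
  fixes x y :: "(real, 'n::{finite,linorder}) vec"
  defines "s \<equiv> x \<bullet> y" and "p \<equiv> (norm x)\<^sup>2 * (norm y)\<^sup>2"
  shows "gamma_op (flow_partial r A B \<theta> x) y =
    ((real CARD('n) - 1) * s * r (flow_eval B \<theta> s p) - (p - s\<^sup>2) * r (flow_eval (deriv_s B) \<theta> s p)) *\<^sub>R cone
    + (r (flow_eval (deriv_s A) \<theta> s p) + (real CARD('n) - 2) * r (flow_eval B \<theta> s p)) *\<^sub>R wedge x y"
proof -
  let ?N = "\<lambda>k. wedge y (axis k (1::real))"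
  have 1: "(\<Sum>k\<in>UNIV. ?N k \<odot> ((x $ k) *\<^sub>R c)) = - wedge x y \<odot> c" for c
    using wedge_axis_right[of x y]
    by (simp add: cmult.scaleR_right wedge_commute[of x y] flip: cmult.scaleR_left cmult.sum_left)
  have 2: "(\<Sum>k\<in>UNIV. ?N k \<odot> ((2 * (norm x)\<^sup>2 * y $ k) *\<^sub>R c)) = 0" for c
  proof -
    have "(\<Sum>k\<in>UNIV. ?N k \<odot> ((2 * (norm x)\<^sup>2 * y $ k) *\<^sub>R c))
        = (2 * (norm x)\<^sup>2) *\<^sub>R ((\<Sum>k\<in>UNIV. (y $ k) *\<^sub>R ?N k) \<odot> c)"
      by (simp add: cmult.scaleR_right cmult.scaleR_left cmult.sum_left scaleR_sum_right)
    then show ?thesis by (simp add: wedge_axis_right cmult.zero_left)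
  qed
  have 3: "(\<Sum>k\<in>UNIV. ?N k \<odot> (b *\<^sub>R wedge x (axis k 1)))
    = b *\<^sub>R (- ((real CARD('n) - 1) * (x \<bullet> y)) *\<^sub>R cone - (real CARD('n) - 2) *\<^sub>R wedge x y)" for b
    unfolding cmult.scaleR_right scaleR_sum_right[symmetric] sum_wedge_axis_wedge ..
  have W: "wedge x y \<odot> wedge x y = (s\<^sup>2 - p) *\<^sub>R cone" unfolding s_def p_def by (rule wedge_square)
  have "gamma_op (flow_partial r A B \<theta> x) y = - (- wedge x y \<odot> flow_kernel r (deriv_s A) (deriv_s B) \<theta> x y + 0
      + r (flow_eval B \<theta> s p) *\<^sub>R (- ((real CARD('n) - 1) * s) *\<^sub>R cone - (real CARD('n) - 2) *\<^sub>R wedge x y))"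
    unfolding gamma_op_def flow_partial_def cmult.add_right sum.distrib 1 2 3 s_def p_def ..
  then show ?thesis
    unfolding flow_kernel_def s_def[symmetric] p_def[symmetric] cmult.add_right cmult.scaleR_right
        cmult.minus_left W cmult_cone
    by (simp add: vec_eq_iff algebra_simps)
qed

text \<open>With u = P + i Q, the equation u' = i \<Gamma> u separates into P' = - \<Gamma> Q and Q'
  = \<Gamma> P.\<close>

lemma flow_kernel_deriv_theta:
  fixes x y :: "(real, 'n::{finite,linorder}) vec"
  assumes "CARD('n) = 2 * l + 2"
  shows "flow_kernel Re (deriv_theta (flow_a l)) (deriv_theta (flow_b l)) \<theta> x y
      = - gamma_op (flow_partial Im (flow_a l) (flow_b l) \<theta> x) y"
    and "flow_kernel Im (deriv_theta (flow_a l)) (deriv_theta (flow_b l)) \<theta> x y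
        = gamma_op (flow_partial Re (flow_a l) (flow_b l) \<theta> x) y"
  unfolding gamma_op_flow_kernel flow_kernel_def flow_equation assms
  by (simp_all add: vec_eq_iff algebra_simps)

text \<open>Unitarity of the flow in weak form: \<open>m\<close> is the real part of the product of
  the conjugate of u(x, y) with u(x', y), where real means free of the scalar i commuting with the
  Clifford algebra.\<close>

lemma flow_kernel_gauss_integral_const:
  fixes x x' :: "(real, 'n::{finite,linorder}) vec"
  assumes "CARD('n) = 2 * l + 2" "\<epsilon> > 0" "\<tau> \<ge> 0"
  defines "m \<equiv> \<lambda>\<theta> y. cconj (flow_kernel Re (flow_a l) (flow_b l) \<theta> x y) \<odot> flow_kernel Re (flow_a l)
      (flow_b l) \<theta> x' y
      + cconj (flow_kernel Im (flow_a l) (flow_b l) \<theta> x y) \<odot> flow_kernel Im (flow_a l) (flow_b l) \<theta> x' y"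
    and "w \<equiv> \<lambda>y. exp (- \<epsilon> * (norm y)\<^sup>2 / 2)"
  shows "(LINT y|lborel. w y *\<^sub>R m \<tau> y) = (LINT y|lborel. w y *\<^sub>R m 0 y)"
proof -
  note [intro] = bounded_linear_Re bounded_linear_Im
  let ?P = "flow_kernel Re (flow_a l) (flow_b l)" and ?Q = "flow_kernel Im (flow_a l) (flow_b l)"
    and ?P' = "flow_kernel Re (deriv_theta (flow_a l)) (deriv_theta (flow_b l))" and ?Q'
        = "flow_kernel Im (deriv_theta (flow_a l)) (deriv_theta (flow_b l))"
  define m' where "m' \<theta> y = cconj (?P' \<theta> x y) \<odot> ?P \<theta> x' y + cconj (?P \<theta> x y) \<odot> ?P' \<theta> x' y
    + (cconj (?Q' \<theta> x y) \<odot> ?Q \<theta> x' y + cconj (?Q \<theta> x y) \<odot> ?Q' \<theta> x' y)" for \<theta> y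
  note g = pgrowth_Pair1[OF pgrowth_flow_kernel]
  have gm: "pgrowth m" unfolding m_def by (intro pgrowth_add pgrowth_cmult pgrowth_cconj g) auto
  have gm': "pgrowth m'" unfolding m'_def by (intro pgrowth_add pgrowth_cmult pgrowth_cconj g) auto
  have cm: "continuous_on UNIV (m \<theta>)" for \<theta> unfolding m_def
      by (intro continuous_intros continuous_on_flow_kernel) auto
  have cm': "continuous_on UNIV (\<lambda>(\<theta>, y). m' \<theta> y)"
    unfolding m'_def case_prod_unfold by (intro continuous_intros continuous_on_flow_kernel) auto
  have [measurable]: "m \<theta> \<in> borel_measurable borel" for \<theta>
    using borel_measurable_continuous_onI[OF cm] .
  have [measurable]: "m' \<theta> \<in> borel_measurable borel" for \<theta>
  proof -
    have "continuous_on UNIV (\<lambda>y. (\<theta>, y))" by (intro continuous_intros)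
    from borel_measurable_continuous_onI[OF continuous_on_compose2[OF cm' this]] show ?thesis by simp
  qed
  have d: "((\<lambda>\<theta>. w y *\<^sub>R m \<theta> y) has_vector_derivative w y *\<^sub>R m' \<theta> y) (at \<theta>)" for \<theta> y
  proof -
    note D = flow_kernel_has_vector_derivative
    note C = bounded_bilinear.has_vector_derivative[OF bounded_bilinear_cmult
        bounded_linear.has_vector_derivative[OF bounded_linear_cconj D] D]
    have "((\<lambda>\<theta>. m \<theta> y) has_vector_derivative m' \<theta> y) (at \<theta>)"
      unfolding m_def m'_def
      by (rule has_vector_derivative_eq_rhs,
          rule has_vector_derivative_add[OF C[OF bounded_linear_Re bounded_linear_Re] C[OF
              bounded_linear_Im bounded_linear_Im]])
         (simp add: add.commute)
    from has_vector_derivative_scaleR[OF DERIV_const this] show ?thesis by simp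
  qed
  obtain B where B: "\<And>\<theta>. integrable lborel (\<lambda>y. w y *\<^sub>R m' \<theta> y)" "\<And>\<theta>. (LINT y|lborel. norm (w y *\<^sub>R m' \<theta>
      y)) \<le> B"
    using pgrowth_gauss[OF gm' assms(2)] unfolding w_def by auto
  have im: "integrable lborel (\<lambda>y. w y *\<^sub>R m \<theta> y)" for \<theta>
    unfolding w_def by (rule pgrowth_gauss_integrable[OF gm assms(2) cm])
  have 0: "(LINT y|lborel. w y *\<^sub>R m' \<theta> y) = 0" for \<theta>
  proof -
    have gP: "gamma_op (flow_partial Im (flow_a l) (flow_b l) \<theta> x) = (\<lambda>y. - ?P' \<theta> x y)"
        for x :: "(real, 'n) vec"
      by (rule ext) (simp add: flow_kernel_deriv_theta(1)[OF assms(1)])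
    have gQ: "gamma_op (flow_partial Re (flow_a l) (flow_b l) \<theta> x) = (\<lambda>y. ?Q' \<theta> x y)"
        for x :: "(real, 'n) vec"
      by (rule ext) (simp only: flow_kernel_deriv_theta(2)[OF assms(1)])
    have sym: "(LINT y|lborel. w y *\<^sub>R (cconj (gamma_op (flow_partial r (flow_a l) (flow_b l) \<theta> x) y) \<odot>
        flow_kernel r' (flow_a l) (flow_b l) \<theta> x' y))
        = (LINT y|lborel. w y *\<^sub>R (cconj (flow_kernel r (flow_a l) (flow_b l) \<theta> x y) \<odot> gamma_op
            (flow_partial r' (flow_a l) (flow_b l) \<theta> x') y))"
      if "bounded_linear r" "bounded_linear r'" for r r'
      unfolding w_def
      by (rule gamma_op_symmetric)
         (use that assms(2) in \<open>auto intro!: flow_partial_has_vector_derivative continuous_on_flow_kernel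
             continuous_on_flow_partial
           pgrowth_reindex[OF pgrowth_flow_partial] pgrowth_reindex[OF g] continuous_intros\<close>)
    have int: "integrable lborel (\<lambda>y. w y *\<^sub>R (cconj (flow_kernel r A B \<theta> x y) \<odot> flow_kernel r' A' B' \<theta>
        x' y))"
      if "bounded_linear r" "bounded_linear r'" for r A B r' A' B'
    proof -
      have 1: "pgrowth (\<lambda>\<theta> y. cconj (flow_kernel r A B \<theta> x y) \<odot> flow_kernel r' A' B' \<theta> x' y)"
        by (intro pgrowth_cmult pgrowth_cconj g that)
      have 2: "continuous_on UNIV (\<lambda>y. cconj (flow_kernel r A B \<theta> x y) \<odot> flow_kernel r' A' B' \<theta> x' y)"
        by (intro continuous_intros continuous_on_flow_kernel that)
      show ?thesis
        unfolding w_def by (rule pgrowth_gauss_integrable[OF 1 assms(2) 2])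
    qed
    note int = int[OF bounded_linear_Re bounded_linear_Re] int[OF bounded_linear_Im bounded_linear_Im]
    have neg: "cconj (- a) = - cconj a" for a :: "'n clifford" by (rule linear_neg[OF linear_cconj])
    \<comment> \<open>Since Q' = \<Gamma> P and P' = - \<Gamma> Q, moving \<Gamma> to the other
      factor turns each term with Q' into minus a term with P'; the four terms of the derivative
      cancel in pairs.\<close>
    have e1: "(LINT y|lborel. w y *\<^sub>R (cconj (?Q' \<theta> x y) \<odot> ?Q \<theta> x' y))
        = - (LINT y|lborel. w y *\<^sub>R (cconj (?P \<theta> x y) \<odot> ?P' \<theta> x' y))"
      using sym[OF bounded_linear_Re bounded_linear_Im] by (simp add: gP gQ cmult.minus_right)
    have e2: "(LINT y|lborel. w y *\<^sub>R (cconj (?Q \<theta> x y) \<odot> ?Q' \<theta> x' y))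
        = - (LINT y|lborel. w y *\<^sub>R (cconj (?P' \<theta> x y) \<odot> ?P \<theta> x' y))"
      using sym[OF bounded_linear_Im bounded_linear_Re] by (simp add: gP gQ cmult.minus_left neg)
    show ?thesis
      unfolding m'_def scaleR_add_right by (simp add: int e1 e2)
  qed
  have "(LINT y|lborel. w y *\<^sub>R m \<tau> y) - (LINT y|lborel. w y *\<^sub>R m 0 y)
      = (LINT t|lborel. indicator {0..\<tau>} t *\<^sub>R (LINT y|lborel. w y *\<^sub>R m' t y))"
    by (rule integral_Fubini_primitive[OF assms(3) d _ B(1) B(2) im im])
       (use cm' in \<open>auto simp: w_def case_prod_unfold intro!: continuous_intros\<close>)
  then show ?thesis by (simp add: 0)
qed

section \<open>Identification of the kernel and its Gaussian orthogonality\<close>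

text \<open>The factor (\<pi>/2)^(1/2) of the kernel cancels the normalization of
  \<open>hbessel\<close>, and the additional -1 in its sign matches the minus signs of
  \<open>B_star\<close> and \<open>C_star\<close>. The imaginary part vanishes because the flow ends
  at real coefficients.\<close>

lemma K_minus_eq_flow_kernel:
  fixes x y :: "(real, 'n::{finite,linorder}) vec"
  assumes "CARD('n) = 2 * l + 2" "l > 0"
  shows "K_minus x y = flow_kernel Re (flow_a l) (flow_b l) (pi / 2) x y"
    and "flow_kernel Im (flow_a l) (flow_b l) (pi / 2) x y = 0"
proof -
  define s where "s = x \<bullet> y"
  define p where "p = (norm x)\<^sup>2 * (norm y)\<^sup>2"
  have l: "(CARD('n) - 2) div 2 = l" using assms(1) by simp
  \<comment> \<open>Cauchy-Schwarz makes the radicand nonnegative, so t^2 + s^2 really is p.\<close>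
  have sp: "(sqrt (p - s\<^sup>2))\<^sup>2 + s\<^sup>2 = p" "0 \<le> sqrt (p - s\<^sup>2)"
    using inner_square_le[of x y] by (simp_all add: s_def p_def)
  have q: "(pi / 2) powr (1 / 2) = sqrt (pi / 2)" "sqrt (pi / 2) \<noteq> 0" by (simp_all add: powr_half_sqrt)
  have "K_minus x y = ((-1) ^ (l + 1) * sqrt (pi / 2)) *\<^sub>R
      ((real l * hbessel_deriv (l - 1) 1 s p / sqrt (pi / 2) + - hbessel_deriv l 0 s p / sqrt (pi / 2))
          *\<^sub>R cone
        + (- hbessel_deriv l 1 s p / sqrt (pi / 2)) *\<^sub>R wedge x y)"
    unfolding K_minus_def Let_def l s_def[symmetric] p_def[symmetric] A_star_eq[OF assms(2) sp(2)]
      B_star_eq[OF sp(2)] sp(1) q(1) ..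
  also have "\<dots> = ((-1) ^ l * (hbessel_deriv l 0 s p - real l * hbessel_deriv (l - 1) 1 s p)) *\<^sub>R cone +
      ((-1) ^ l * hbessel_deriv l 1 s p) *\<^sub>R wedge x y"
  proof -
    define c where "c = sqrt (pi / 2)"
    have c: "c \<noteq> 0" using q(2) by (simp add: c_def)
    have 1: "a * c * (b / c) = a * b" for a b :: real using c by simp
    show ?thesis
      unfolding c_def[symmetric] add_divide_distrib[symmetric] scaleR_add_right scaleR_scaleR 1
      by (simp add: algebra_simps)
  qed
  finally show "K_minus x y = flow_kernel Re (flow_a l) (flow_b l) (pi / 2) x y"
    unfolding flow_kernel_def s_def[symmetric] p_def[symmetric] conjunct1[OF flow_end] conjunct2[OF
        flow_end] Re_complex_of_real .
  show "flow_kernel Im (flow_a l) (flow_b l) (pi / 2) x y = 0"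
    unfolding flow_kernel_def conjunct1[OF flow_end] conjunct2[OF flow_end] Im_complex_of_real by simp
qed

text \<open>The integral is transported back to \<theta> = 0. There P and Q are cos and - sin of the
  inner product, and the addition theorem leaves the Fourier integral of a Gaussian at x -
  x'.\<close>

lemma K_minus_gauss_integral:
  fixes x x' :: "(real, 'n::{finite,linorder}) vec"
  assumes "even CARD('n)" "CARD('n) > 2" "\<epsilon> > 0"
  shows "(LINT y|lborel. exp (- \<epsilon> * (norm y)\<^sup>2 / 2) *\<^sub>R (cconj (K_minus x y) \<odot> K_minus x' y))
    = ((2 * pi / \<epsilon>) powr (real CARD('n) / 2) * exp (- (norm (x - x'))\<^sup>2 / (2 * \<epsilon>))) *\<^sub>R cone"
proof -
  obtain l where l: "CARD('n) = 2 * l + 2" "l > 0"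
  proof -
    obtain m where "CARD('n) = 2 * m" using assms(1) by blast
    then show ?thesis using assms(2) that[of "m - 1"] by auto
  qed
  let ?P = "flow_kernel Re (flow_a l) (flow_b l)" and ?Q = "flow_kernel Im (flow_a l) (flow_b l)"
  let ?w = "\<lambda>y::(real, 'n) vec. exp (- \<epsilon> * (norm y)\<^sup>2 / 2)"
  have start: "?P 0 x y = cos (x \<bullet> y) *\<^sub>R cone" "?Q 0 x y = (- sin (x \<bullet> y)) *\<^sub>R cone"
      for x y :: "(real, 'n) vec"
    unfolding flow_kernel_def conjunct1[OF flow_start] conjunct2[OF flow_start] by simp_all
  have m0: "cconj (?P 0 x y) \<odot> ?P 0 x' y + cconj (?Q 0 x y) \<odot> ?Q 0 x' y = cos ((x - x') \<bullet> y) *\<^sub>R cone" for y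
    unfolding start
    by (simp add: cconj_scaleR linear_neg[OF linear_cconj] cmult.scaleR_left cmult.scaleR_right
        cmult.minus_left
        cmult.minus_right inner_diff_left cos_diff algebra_simps)
  have "(LINT y|lborel. ?w y *\<^sub>R (cconj (K_minus x y) \<odot> K_minus x' y))
      = (LINT y|lborel. ?w y *\<^sub>R (cconj (?P (pi / 2) x y) \<odot> ?P (pi / 2) x' y + cconj (?Q (pi / 2) x y) \<odot>
          ?Q (pi / 2) x' y))"
    unfolding K_minus_eq_flow_kernel[OF l] by (simp add: cmult.zero_right)
  also have "\<dots> = (LINT y|lborel. ?w y *\<^sub>R (cos ((x - x') \<bullet> y) *\<^sub>R cone))"
    unfolding m0[symmetric] using flow_kernel_gauss_integral_const[OF l(1) assms(3), of "pi / 2" x x'] by simp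
  also have "\<dots> = (LINT y|lborel. ?w y * cos ((x - x') \<bullet> y)) *\<^sub>R cone"
    unfolding scaleR_scaleR
  proof (rule integral_scaleR_left)
    have "pgrowth (\<lambda>(_::unit) (y::(real, 'n) vec). cos ((x - x') \<bullet> y))"
      by (rule pgrowthI[of 1 _ 0]) auto
    from pgrowth_gauss_integrable[OF this assms(3)]
    show "integrable lborel (\<lambda>y. ?w y * cos ((x - x') \<bullet> y))" by (simp add: continuous_intros)
  qed
  finally show ?thesis
    unfolding gauss_fourier[OF assms(3)] by simp
qed

text \<open>Read off from the flow form, where the Bessel factors are entire in t^2 and t = 0 is no
  exception.\<close>

lemma K_minus_continuous:
  fixes g h :: "'b::t2_space \<Rightarrow> (real, 'n::{finite,linorder}) vec"
  assumes "even CARD('n)" "CARD('n) > 2" "continuous_on S g" "continuous_on S h"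
  shows "continuous_on S (\<lambda>z. K_minus (g z) (h z))"
proof -
  obtain m where m: "CARD('n) = 2 * m" using assms(1) by blast
  then have l: "CARD('n) = 2 * (m - 1) + 2" "m - 1 > 0" using assms(2) by auto
  show ?thesis
    unfolding K_minus_eq_flow_kernel(1)[OF l]
    by (intro continuous_on_flow_kernel bounded_linear_Re continuous_on_const assms)
qed

lemma K_minus_growth:
  assumes "even CARD('n)" "CARD('n) > 2"
  obtains C N where "C \<ge> 0"
    "\<And>x y :: (real, 'n::{finite,linorder}) vec. norm (K_minus x y) \<le> C * (1 + norm x) ^ N * (1 + norm y) ^ N"
proof -
  obtain m where m: "CARD('n) = 2 * m" using assms(1) by blast
  then have l: "CARD('n) = 2 * (m - 1) + 2" "m - 1 > 0" using assms(2) by auto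
  obtain C N where "C \<ge> 0" "\<And>i (x :: (real, 'n) vec) y. norm (flow_kernel Re (flow_a (m - 1)) (flow_b (m
      - 1)) i x y) \<le> C * (1 + norm x) ^ N * (1 + norm y) ^ N"
    using pgrowth_Pair[OF pgrowth_flow_kernel[OF bounded_linear_Re, where 'a = 'n]] by metis
  then show ?thesis
    using that unfolding K_minus_eq_flow_kernel(1)[OF l] by blast
qed

section \<open>Translations in the space of square-integrable functions\<close>

definition L1_translation_continuous :: "(nat \<Rightarrow> 'a::euclidean_space) \<Rightarrow> ('a \<Rightarrow> real) \<Rightarrow> bool" where
  "L1_translation_continuous v f \<longleftrightarrow> (\<lambda>n. LINT t|lborel. \<bar>f (t + v n) - f t\<bar>) \<longlonglongrightarrow> 0"

text \<open>Three-epsilon argument: by translation invariance the approximation error after the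
  shift equals the one before it.\<close>

lemma L1_translation_continuous_approx:
  fixes f :: "'a::euclidean_space \<Rightarrow> real"
  assumes f: "integrable lborel f"
    and approx: "\<And>e. e > 0 \<Longrightarrow> \<exists>g. integrable lborel g \<and> L1_translation_continuous v g \<and> (LINT t|lborel. \<bar>f
        t - g t\<bar>) < e"
  shows "L1_translation_continuous v f"
  unfolding L1_translation_continuous_def
proof (rule LIMSEQ_I)
  fix r :: real assume "r > 0"
  then obtain g where g: "integrable lborel g" and gv: "L1_translation_continuous v g" and d: "(LINT
      t|lborel. \<bar>f t - g t\<bar>) < r / 3"
    using approx[of "r / 3"] by auto
  have "r / 3 > 0" using \<open>r > 0\<close> by simp
  from LIMSEQ_D[OF gv[unfolded L1_translation_continuous_def] this] obtain N where
    N: "\<And>n. n \<ge> N \<Longrightarrow> \<bar>LINT t|lborel. \<bar>g (t + v n) - g t\<bar>\<bar> < r / 3" by auto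
  note tr = lborel_integrable_translate
  show "\<exists>N. \<forall>n\<ge>N. norm ((LINT t|lborel. \<bar>f (t + v n) - f t\<bar>) - 0) < r"
  proof (intro exI allI impI)
    fix n assume n: "n \<ge> N"
    have [measurable]: "f \<in> borel_measurable borel" "g \<in> borel_measurable borel" using f g
        by (auto dest: borel_measurable_integrable)
    have "(LINT t|lborel. \<bar>f (t + v n) - f t\<bar>)
        \<le> (LINT t|lborel. \<bar>f (t + v n) - g (t + v n)\<bar> + \<bar>g (t + v n) - g t\<bar> + \<bar>f t - g t\<bar>)"
      by (intro integral_mono Bochner_Integration.integrable_add integrable_abs
          Bochner_Integration.integrable_diff tr f g) auto
    also have "\<dots> = (LINT t|lborel. \<bar>f (t + v n) - g (t + v n)\<bar>) + (LINT t|lborel. \<bar>g (t + v n) - g t\<bar>) +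
        (LINT t|lborel. \<bar>f t - g t\<bar>)"
      by (simp add: f g tr)
    also have "(LINT t|lborel. \<bar>f (t + v n) - g (t + v n)\<bar>) = (LINT t|lborel. \<bar>f t - g t\<bar>)"
      by (rule lborel_integral_translate[of "\<lambda>t. \<bar>f t - g t\<bar>"]) measurable
    finally have "(LINT t|lborel. \<bar>f (t + v n) - f t\<bar>) < r"
      using d N[OF n] by linarith
    moreover have "(LINT t|lborel. \<bar>f (t + v n) - f t\<bar>) \<ge> 0" by simp
    ultimately show "norm ((LINT t|lborel. \<bar>f (t + v n) - f t\<bar>) - 0) < r" by simp
  qed
qed

text \<open>Openness gives pointwise convergence only of the positive part of the indicator at t
  minus that at t + v n: a point of U eventually stays in U, but a boundary point may keep entering.
  The negative part has the same integral because U and its translates have equal measure.\<close>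

lemma L1_translation_continuous_open:
  fixes U :: "'a::euclidean_space set"
  assumes U: "open U" "emeasure lborel U < \<infinity>" and v: "v \<longlonglongrightarrow> 0"
  shows "L1_translation_continuous v (\<lambda>t. indicator U t * c)"
proof -
  let ?f = "indicator U :: 'a \<Rightarrow> real"
  have [measurable]: "U \<in> sets borel" using U(1) by simp
  have f: "integrable lborel ?f" using U by (simp add: integrable_indicator_iff)
  note ft = lborel_integrable_translate[OF f]
  have "(\<lambda>n. LINT t|lborel. max 0 (?f t - ?f (t + v n))) \<longlonglongrightarrow> (LINT t|lborel. (0::real) * indicator U (t::'a))"
  proof (rule integral_dominated_convergence[where w = ?f])
    show "AE t in lborel. (\<lambda>n. max 0 (?f t - ?f (t + v n))) \<longlonglongrightarrow> 0 * indicator U t"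
    proof (intro AE_I2)
      fix t :: 'a
      show "(\<lambda>n. max 0 (?f t - ?f (t + v n))) \<longlonglongrightarrow> 0 * indicator U t"
      proof (cases "t \<in> U")
        case True
        have "(\<lambda>n. t + v n) \<longlonglongrightarrow> t" using tendsto_add[OF tendsto_const v, of t] by simp
        then have "\<forall>\<^sub>F n in sequentially. t + v n \<in> U" using U(1) True by (rule topological_tendstoD)
        then have "\<forall>\<^sub>F n in sequentially. max 0 (?f t - ?f (t + v n)) = 0"
          by eventually_elim (use True in auto)
        then show ?thesis by (simp add: tendsto_eventually)
      next
        case False
        then have "max 0 (?f t - ?f (t + v n)) = 0" for n by (simp add: indicator_def)
        then show ?thesis by simp
      qed
    qed
  qed (use f in \<open>auto split: split_indicator\<close>)
  then have lim: "(\<lambda>n. LINT t|lborel. max 0 (?f t - ?f (t + v n))) \<longlonglongrightarrow> 0" by simp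
  have "(LINT t|lborel. \<bar>?f (t + v n) * c - ?f t * c\<bar>)
      = \<bar>c\<bar> * (2 * (LINT t|lborel. max 0 (?f t - ?f (t + v n))))" for n
  proof -
    have m: "integrable lborel (\<lambda>t. max 0 (?f t - ?f (t + v n)))"
      by (rule integrable_norm_le[OF f]) (auto split: split_indicator)
    \<comment> \<open>Pointwise |a - b| = (a - b) + 2 max 0 (b - a), and the bracket integrates to
      0.\<close>
    have "(LINT t|lborel. \<bar>?f (t + v n) * c - ?f t * c\<bar>)
        = (LINT t|lborel. \<bar>c\<bar> * ((?f (t + v n) - ?f t) + 2 * max 0 (?f t - ?f (t + v n))))"
      by (intro Bochner_Integration.integral_cong refl) (auto split: split_indicator)
    also have "\<dots> = \<bar>c\<bar> * (((LINT t|lborel. ?f (t + v n)) - (LINT t|lborel. ?f t)) + 2 * (LINT t|lborel.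
        max 0 (?f t - ?f (t + v n))))"
      using f ft m by simp
    finally show ?thesis by (simp add: lborel_integral_translate[of ?f])
  qed
  then show ?thesis
    unfolding L1_translation_continuous_def using tendsto_mult[OF tendsto_const[of "\<bar>c\<bar>"] tendsto_mult[OF
        tendsto_const[of 2] lim]] by simp
qed

text \<open>Outer regularity reduces indicators to open sets; sums and dominated limits do the
  rest.\<close>

lemma integrable_imp_L1_translation_continuous:
  fixes f :: "'a::euclidean_space \<Rightarrow> real"
  assumes "integrable lborel f" and v: "v \<longlonglongrightarrow> 0"
  shows "L1_translation_continuous v f"
  using assms(1)
proof (induction f rule: integrable_induct)
  case (base A c)
  have [measurable]: "A \<in> sets borel" using base by simp
  have fA: "integrable lborel (indicator A :: 'a \<Rightarrow> real)" using base by (simp add: integrable_indicator_iff)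
  show ?case
  proof (rule L1_translation_continuous_approx)
    show "integrable lborel (\<lambda>x. indicator A x *\<^sub>R c)" using fA by simp
    fix e :: real assume e: "e > 0"
    \<comment> \<open>The added 1 covers c = 0.\<close>
    define e' where "e' = e / (\<bar>c\<bar> + 1)"
    have e': "e' > 0" using e by (simp add: e'_def add_nonneg_pos)
    obtain U where U: "open U" "A \<subseteq> U" "emeasure lborel (U - A) < e'"
      using outer_regular_lborel[OF _ e', of A] by auto
    have [measurable]: "U \<in> sets borel" using U by simp
    have "emeasure lborel U \<le> emeasure lborel A + emeasure lborel (U - A)"
      using U(2) emeasure_subadditive[of A lborel "U - A"] by (simp add: Un_absorb1)
    also have "\<dots> < \<infinity>" using U(3) base(2) by (auto simp: less_top[symmetric] ennreal_add_eq_top)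
    finally have fin: "emeasure lborel U < \<infinity>" .
    have fU: "integrable lborel (indicator U :: 'a \<Rightarrow> real)" using fin by (simp add: integrable_indicator_iff)
    have "(LINT t|lborel. \<bar>indicator A t *\<^sub>R c - indicator U t * c\<bar>)
        = (LINT t|lborel. indicator (U - A) t * \<bar>c\<bar>)"
      using U(2) by (intro Bochner_Integration.integral_cong refl) (auto split: split_indicator)
    also have "\<dots> = measure lborel (U - A) * \<bar>c\<bar>" by simp
    also have "\<dots> \<le> e' * \<bar>c\<bar>"
    proof (intro mult_right_mono)
      have "ennreal (measure lborel (U - A)) = emeasure lborel (U - A)"
        using U(3) by (intro emeasure_eq_ennreal_measure[symmetric]) auto
      then show "measure lborel (U - A) \<le> e'" using U(3) e'
          by (metis ennreal_less_iff less_imp_le measure_nonneg)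
    qed simp
    also have "\<dots> < e" using e by (simp add: e'_def field_simps)
    finally show "\<exists>g. integrable lborel g \<and> L1_translation_continuous v g \<and> (LINT t|lborel. \<bar>indicator A
        t *\<^sub>R c - g t\<bar>) < e"
      using fU by (intro exI[of _ "\<lambda>t. indicator U t * c"] conjI L1_translation_continuous_open U(1) fin
          v) auto
  qed
next
  case (add f g)
  note tr = lborel_integrable_translate
  have "(\<lambda>n. (LINT t|lborel. \<bar>f (t + v n) - f t\<bar>) + (LINT t|lborel. \<bar>g (t + v n) - g t\<bar>)) \<longlonglongrightarrow> 0"
    using tendsto_add[OF add.IH[unfolded L1_translation_continuous_def]] by simp
  note lim = this
  show ?case
    unfolding L1_translation_continuous_def
  proof (rule Lim_null_comparison[OF _ lim])
    show "\<forall>\<^sub>F n in sequentially. norm (LINT t|lborel. \<bar>f (t + v n) + g (t + v n) - (f t + g t)\<bar>)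
        \<le> (LINT t|lborel. \<bar>f (t + v n) - f t\<bar>) + (LINT t|lborel. \<bar>g (t + v n) - g t\<bar>)"
    proof (intro always_eventually allI)
      fix n
      have "(LINT t|lborel. \<bar>f (t + v n) + g (t + v n) - (f t + g t)\<bar>)
          \<le> (LINT t|lborel. \<bar>f (t + v n) - f t\<bar> + \<bar>g (t + v n) - g t\<bar>)"
        by (intro integral_mono Bochner_Integration.integrable_add integrable_abs
            Bochner_Integration.integrable_diff tr add.hyps) auto
      then show "norm (LINT t|lborel. \<bar>f (t + v n) + g (t + v n) - (f t + g t)\<bar>)
        \<le> (LINT t|lborel. \<bar>f (t + v n) - f t\<bar>) + (LINT t|lborel. \<bar>g (t + v n) - g t\<bar>)"
        using add.hyps by (simp add: tr)
    qed
  qed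
next
  case (lim f s)
  show ?case
  proof (rule L1_translation_continuous_approx[OF lim.hyps(4)])
    fix e :: real assume e: "e > 0"
    have [measurable]: "f \<in> borel_measurable borel" "s i \<in> borel_measurable borel" for i
      using lim.hyps by (auto dest: borel_measurable_integrable)
    have "(\<lambda>i. LINT t|lborel. \<bar>f t - s i t\<bar>) \<longlonglongrightarrow> (LINT t|lborel. 0 * f t)"
    proof (rule integral_dominated_convergence[where w = "\<lambda>t. 3 * norm (f t)"])
      show "AE t in lborel. (\<lambda>i. \<bar>f t - s i t\<bar>) \<longlonglongrightarrow> 0 * f t"
        using lim.hyps(2) by (intro AE_I2) (auto intro!: tendsto_eq_intros)
      \<comment> \<open>The approximants satisfy |s i| \<le> 2 |f|, hence the factor 3.\<close>
      show "AE t in lborel. norm \<bar>f t - s i t\<bar> \<le> 3 * norm (f t)" for i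
      proof (intro AE_I2)
        fix t show "norm \<bar>f t - s i t\<bar> \<le> 3 * norm (f t)"
          using lim.hyps(3)[of t i] norm_triangle_ineq4[of "f t" "s i t"] by simp
      qed
    qed (use lim.hyps(4) in auto)
    then have "(\<lambda>i. LINT t|lborel. \<bar>f t - s i t\<bar>) \<longlonglongrightarrow> 0" by simp
    from LIMSEQ_D[OF this e] obtain i where "\<bar>LINT t|lborel. \<bar>f t - s i t\<bar>\<bar> < e" by auto
    then show "\<exists>g. integrable lborel g \<and> L1_translation_continuous v g \<and> (LINT t|lborel. \<bar>f t - g t\<bar>) < e"
      using lim.hyps(1) lim.IH by (intro exI[of _ "s i"]) auto
  qed
qed

text \<open>Because \<open>(a - b)\<^sup>2 \<le> |a\<^sup>2 - b\<^sup>2|\<close> for nonnegative \<open>a\<close> and \<open>b\<close>, the case of exponent 1 applies to \<open>f\<^sup>2\<close>.\<close>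

lemma L2_translation_tendsto_nonneg:
  fixes f :: "'a::euclidean_space \<Rightarrow> real"
  assumes [measurable]: "f \<in> borel_measurable borel" and f: "integrable lborel (\<lambda>t. (f t)\<^sup>2)" and nn:
      "\<And>t. f t \<ge> 0" and v: "v \<longlonglongrightarrow> 0"
  shows "(\<lambda>n. LINT t|lborel. (f (t + v n) - f t)\<^sup>2) \<longlonglongrightarrow> 0"
proof (rule Lim_null_comparison)
  show "(\<lambda>n. LINT t|lborel. \<bar>(f (t + v n))\<^sup>2 - (f t)\<^sup>2\<bar>) \<longlonglongrightarrow> 0"
    using integrable_imp_L1_translation_continuous[OF f v] by (simp add: L1_translation_continuous_def)
  have le: "(a - b)\<^sup>2 \<le> \<bar>a\<^sup>2 - b\<^sup>2\<bar>" if "a \<ge> 0" "b \<ge> 0" for a b :: real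
  proof -
    have "(a - b)\<^sup>2 = \<bar>a - b\<bar> * \<bar>a - b\<bar>" by (simp add: power2_eq_square)
    also have "\<dots> \<le> \<bar>a - b\<bar> * (a + b)" using that by (intro mult_left_mono) auto
    also have "\<dots> = \<bar>(a - b) * (a + b)\<bar>" using that by (simp add: abs_mult)
    also have "(a - b) * (a + b) = a\<^sup>2 - b\<^sup>2" by (simp add: power2_eq_square algebra_simps)
    finally show ?thesis .
  qed
  have i: "integrable lborel (\<lambda>t. \<bar>(f (t + v n))\<^sup>2 - (f t)\<^sup>2\<bar>)" for n
    using f lborel_integrable_translate[OF f] by simp
  have "integrable lborel (\<lambda>t. (f (t + v n) - f t)\<^sup>2)" for n
    by (rule integrable_norm_le[OF i]) (use le nn in auto)
  then show "\<forall>\<^sub>F n in sequentially. norm (LINT t|lborel. (f (t + v n) - f t)\<^sup>2)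
      \<le> (LINT t|lborel. \<bar>(f (t + v n))\<^sup>2 - (f t)\<^sup>2\<bar>)"
    using le nn i by (intro always_eventually allI) (auto intro!: integral_mono)
qed

lemma sum_power2_le: "(a + b)\<^sup>2 \<le> 2 * (a\<^sup>2 + b\<^sup>2)" for a b :: real
  using sum_squares_ge_zero[of "a - b" 0] by (simp add: power2_eq_square algebra_simps)

lemma integrable_power2_diff:
  fixes f g :: "'a \<Rightarrow> real"
  assumes [measurable]: "f \<in> borel_measurable M" "g \<in> borel_measurable M" and "integrable M (\<lambda>t. (f
      t)\<^sup>2)" "integrable M (\<lambda>t. (g t)\<^sup>2)"
  shows "integrable M (\<lambda>t. (f t - g t)\<^sup>2)"
proof (rule integrable_norm_le[where g = "\<lambda>t. 2 * ((f t)\<^sup>2 + (g t)\<^sup>2)"])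
  show "norm ((f t - g t)\<^sup>2) \<le> 2 * ((f t)\<^sup>2 + (g t)\<^sup>2)" for t
    using sum_power2_le[of "f t" "- g t"] by simp
qed (use assms in auto)

lemma L2_translation_tendsto_real:
  fixes f :: "'a::euclidean_space \<Rightarrow> real"
  assumes [measurable]: "f \<in> borel_measurable borel" and f: "integrable lborel (\<lambda>t. (f t)\<^sup>2)" and v: "v \<longlonglongrightarrow> 0"
  shows "(\<lambda>n. LINT t|lborel. (f (t + v n) - f t)\<^sup>2) \<longlonglongrightarrow> 0"
proof (rule Lim_null_comparison)
  let ?p = "\<lambda>t. max 0 (f t)" and ?m = "\<lambda>t. max 0 (- f t)"
  have i: "integrable lborel (\<lambda>t. (?p t)\<^sup>2)" "integrable lborel (\<lambda>t. (?m t)\<^sup>2)"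
    by (rule integrable_norm_le[OF f]; simp add: max_def)+
  have it: "integrable lborel (\<lambda>t. (?p (t + v n))\<^sup>2)" "integrable lborel (\<lambda>t. (?m (t + v n))\<^sup>2)" for n
    using lborel_integrable_translate[OF i(1)] lborel_integrable_translate[OF i(2)] by auto
  have I: "integrable lborel (\<lambda>t. (?p (t + v n) - ?p t)\<^sup>2)" "integrable lborel (\<lambda>t. (?m (t + v n) - ?m t)\<^sup>2)"
     "integrable lborel (\<lambda>t. (f (t + v n) - f t)\<^sup>2)" for n
    using i it f lborel_integrable_translate[OF f] by (auto intro!: integrable_power2_diff)
  show "(\<lambda>n. 2 * ((LINT t|lborel. (?p (t + v n) - ?p t)\<^sup>2) + (LINT t|lborel. (?m (t + v n) - ?m t)\<^sup>2))) \<longlonglongrightarrow> 0"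
    using tendsto_mult[OF tendsto_const[of 2] tendsto_add[OF L2_translation_tendsto_nonneg[OF _ i(1) _ v]
        L2_translation_tendsto_nonneg[OF _ i(2) _ v]]]
    by simp
  have "(LINT t|lborel. (f (t + v n) - f t)\<^sup>2)
      \<le> (LINT t|lborel. 2 * ((?p (t + v n) - ?p t)\<^sup>2 + (?m (t + v n) - ?m t)\<^sup>2))" for n
  proof (rule integral_mono)
    show "(f (t + v n) - f t)\<^sup>2 \<le> 2 * ((?p (t + v n) - ?p t)\<^sup>2 + (?m (t + v n) - ?m t)\<^sup>2)" for t
    proof -
      have e: "f t = ?p t - ?m t" for t by auto
      have "f (t + v n) - f t = (?p (t + v n) - ?p t) + - (?m (t + v n) - ?m t)"
          using e[of t] e[of "t + v n"] by linarith
      then show ?thesis using sum_power2_le[of "?p (t + v n) - ?p t" "- (?m (t + v n) - ?m t)"]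
          by (simp only: power2_minus)
    qed
  qed (use I in auto)
  then show "\<forall>\<^sub>F n in sequentially. norm (LINT t|lborel. (f (t + v n) - f t)\<^sup>2)
      \<le> 2 * ((LINT t|lborel. (?p (t + v n) - ?p t)\<^sup>2) + (LINT t|lborel. (?m (t + v n) - ?m t)\<^sup>2))"
    using I by (intro always_eventually allI) simp
qed

lemma L2_translation_tendsto:
  fixes f :: "'a::euclidean_space \<Rightarrow> 'b::euclidean_space"
  assumes [measurable]: "f \<in> borel_measurable borel" and f: "integrable lborel (\<lambda>t. (norm (f t))\<^sup>2)" and
      v: "v \<longlonglongrightarrow> 0"
  shows "(\<lambda>n. LINT t|lborel. (norm (f (t + v n) - f t))\<^sup>2) \<longlonglongrightarrow> 0"
proof -
  have nrm: "(norm x)\<^sup>2 = (\<Sum>b\<in>Basis. (x \<bullet> b)\<^sup>2)" for x :: 'b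
    by (subst norm_eq_sqrt_inner, subst euclidean_inner) (simp add: power2_eq_square sum_nonneg)
  have i: "integrable lborel (\<lambda>t. (f t \<bullet> b)\<^sup>2)" if "b \<in> Basis" for b
    by (rule integrable_norm_le[OF f]) (use Basis_le_norm[OF that] in \<open>auto simp:
        abs_le_square_iff[symmetric]\<close>)
  have I: "integrable lborel (\<lambda>t. (f (t + v n) \<bullet> b - f t \<bullet> b)\<^sup>2)" if "b \<in> Basis" for b n
    using i[OF that] lborel_integrable_translate[OF i[OF that]] by (auto intro!: integrable_power2_diff)
  have "(\<lambda>n. \<Sum>b\<in>Basis. LINT t|lborel. (f (t + v n) \<bullet> b - f t \<bullet> b)\<^sup>2) \<longlonglongrightarrow> (\<Sum>b\<in>(Basis::'b set). 0)"
    by (intro tendsto_sum L2_translation_tendsto_real[where f = "\<lambda>t. f t \<bullet> _"] i v) measurable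
  moreover have "(LINT t|lborel. (norm (f (t + v n) - f t))\<^sup>2)
      = (\<Sum>b\<in>Basis. LINT t|lborel. (f (t + v n) \<bullet> b - f t \<bullet> b)\<^sup>2)" for n
    unfolding nrm inner_diff_left using I by (intro Bochner_Integration.integral_sum) auto
  ultimately show ?thesis by simp
qed

section \<open>Bilinear estimates and correlations\<close>

text \<open>A weighted arithmetic-geometric mean inequality in place of Cauchy-Schwarz; the free
  weight c lets later arguments balance the two norms.\<close>

lemma integrable_bilinear_L2:
  fixes f :: "'a \<Rightarrow> 'b::{banach, second_countable_topology}" and g :: "'a \<Rightarrow> 'c::{banach,
      second_countable_topology}"
    and h :: "'b \<Rightarrow> 'c \<Rightarrow> 'd::{banach, second_countable_topology}"
  assumes h: "bounded_bilinear h" "\<And>x y. norm (h x y) \<le> norm x * norm y * K" "K \<ge> 0"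
    and [measurable]: "f \<in> borel_measurable M" "g \<in> borel_measurable M"
    and f: "integrable M (\<lambda>t. (norm (f t))\<^sup>2)" and g: "integrable M (\<lambda>t. (norm (g t))\<^sup>2)" and c: "c > 0"
  shows "integrable M (\<lambda>t. h (f t) (g t))"
    and "norm (LINT t|M. h (f t) (g t)) \<le> K / 2 * (c * (LINT t|M. (norm (f t))\<^sup>2) + (LINT t|M. (norm (g
        t))\<^sup>2) / c)"
proof -
  have le: "norm (h (f t) (g t)) \<le> K / 2 * (c * (norm (f t))\<^sup>2 + (norm (g t))\<^sup>2 / c)" for t
  proof -
    let ?a = "norm (f t)" and ?b = "norm (g t)"
    have "0 \<le> (c * ?a - ?b)\<^sup>2 / c" using c by simp
    also have "\<dots> = c * ?a\<^sup>2 + ?b\<^sup>2 / c - 2 * (?a * ?b)" using c by (simp add: power2_eq_square field_simps)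
    finally have "?a * ?b * K \<le> (c * ?a\<^sup>2 + ?b\<^sup>2 / c) / 2 * K" using h(3) by (intro mult_right_mono) auto
    then show ?thesis using h(2)[of "f t" "g t"] by (simp add: algebra_simps)
  qed
  have m: "(\<lambda>t. h (f t) (g t)) \<in> borel_measurable M"
    by (rule borel_measurable_continuous_Pair) (auto intro!: bounded_bilinear.continuous_on[OF h(1)]
        continuous_intros)
  have d: "integrable M (\<lambda>t. K / 2 * (c * (norm (f t))\<^sup>2 + (norm (g t))\<^sup>2 / c))" using f g by auto
  show i: "integrable M (\<lambda>t. h (f t) (g t))" by (rule integrable_norm_le[OF d m le])
  have "norm (LINT t|M. h (f t) (g t)) \<le> (LINT t|M. norm (h (f t) (g t)))" by (rule integral_norm_bound)
  also have "\<dots> \<le> (LINT t|M. K / 2 * (c * (norm (f t))\<^sup>2 + (norm (g t))\<^sup>2 / c))"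
    by (intro integral_mono integrable_norm i d le)
  also have "\<dots> = K / 2 * (c * (LINT t|M. (norm (f t))\<^sup>2) + (LINT t|M. (norm (g t))\<^sup>2) / c)" using f g by simp
  finally show "norm (LINT t|M. h (f t) (g t))
      \<le> K / 2 * (c * (LINT t|M. (norm (f t))\<^sup>2) + (LINT t|M. (norm (g t))\<^sup>2) / c)" .
qed

lemma correlation_tendsto:
  fixes f :: "'a::euclidean_space \<Rightarrow> 'b::euclidean_space" and g :: "'a \<Rightarrow> 'c::euclidean_space"
    and h :: "'b \<Rightarrow> 'c \<Rightarrow> 'd::{banach, second_countable_topology}"
  assumes h: "bounded_bilinear h"
    and [measurable]: "f \<in> borel_measurable borel" "g \<in> borel_measurable borel"
    and f: "integrable lborel (\<lambda>t. (norm (f t))\<^sup>2)" and g: "integrable lborel (\<lambda>t. (norm (g t))\<^sup>2)" and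
        v: "v \<longlonglongrightarrow> 0"
  shows "(\<lambda>n. LINT t|lborel. h (f t) (g (t + v n))) \<longlonglongrightarrow> (LINT t|lborel. h (f t) (g t))"
proof (rule LIMSEQ_I)
  fix r :: real assume r: "r > 0"
  obtain K where K: "K > 0" "\<And>x y. norm (h x y) \<le> norm x * norm y * K"
    using bounded_bilinear.pos_bounded[OF h] by blast
  define F where "F = (LINT t|lborel. (norm (f t))\<^sup>2)"
  have F: "F \<ge> 0" by (simp add: F_def)
  \<comment> \<open>With this weight the contribution of f is below r / 2 for every n, and that of
    the translation error is below r / 2 once the error is less than r c / K. The added 1 covers F =
    0.\<close>
  define c where "c = r / (K * (F + 1))"
  have c: "c > 0" using r K F by (simp add: c_def)
  have cF: "K / 2 * (c * F) < r / 2"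
  proof -
    have "K / 2 * (c * F) = r / 2 * (F / (F + 1))" using K F by (simp add: c_def)
    also have "\<dots> < r / 2 * 1" using r F by (intro mult_strict_left_mono) auto
    finally show ?thesis by simp
  qed
  have gt: "integrable lborel (\<lambda>t. (norm (g (t + v n)))\<^sup>2)" for n
    using lborel_integrable_translate[OF g] by simp
  have gd: "integrable lborel (\<lambda>t. (norm (g (t + v n) - g t))\<^sup>2)" for n
  proof (rule integrable_norm_le[where g = "\<lambda>t. 2 * ((norm (g (t + v n)))\<^sup>2 + (norm (g t))\<^sup>2)"])
    fix t
    have "(norm (g (t + v n) - g t))\<^sup>2 \<le> (norm (g (t + v n)) + norm (g t))\<^sup>2"
      by (intro power_mono norm_triangle_ineq4) auto
    also have "\<dots> \<le> 2 * ((norm (g (t + v n)))\<^sup>2 + (norm (g t))\<^sup>2)" by (rule sum_power2_le)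
    finally show "norm ((norm (g (t + v n) - g t))\<^sup>2) \<le> 2 * ((norm (g (t + v n)))\<^sup>2 + (norm (g t))\<^sup>2)" by simp
  qed (use g gt in auto)
  have e: "r * c / K > 0" using r c K by simp
  from LIMSEQ_D[OF L2_translation_tendsto[OF _ g v] this] obtain N where
    N: "\<And>n. n \<ge> N \<Longrightarrow> \<bar>LINT t|lborel. (norm (g (t + v n) - g t))\<^sup>2\<bar> < r * c / K" by auto
  show "\<exists>N. \<forall>n\<ge>N. norm ((LINT t|lborel. h (f t) (g (t + v n))) - (LINT t|lborel. h (f t) (g t))) < r"
  proof (intro exI allI impI)
    fix n assume n: "n \<ge> N"
    define D where "D = (LINT t|lborel. (norm (g (t + v n) - g t))\<^sup>2)"
    have "K / 2 * (D / c) < K / 2 * (r * c / K / c)"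
      using N[OF n] K c by (intro mult_strict_left_mono divide_strict_right_mono) (auto simp: D_def)
    also have "\<dots> = r / 2" using K c by simp
    finally have D: "K / 2 * (D / c) < r / 2" .
    have [simp]: "integrable lborel (\<lambda>t. h (f t) (g (t + v n)))" "integrable lborel (\<lambda>t. h (f t) (g t))"
      using integrable_bilinear_L2(1)[OF h K(2) less_imp_le[OF K(1)] _ _ f gt[of n] c]
        integrable_bilinear_L2(1)[OF h K(2) less_imp_le[OF K(1)] _ _ f g c] by auto
    have "(LINT t|lborel. h (f t) (g (t + v n))) - (LINT t|lborel. h (f t) (g t))
        = (LINT t|lborel. h (f t) (g (t + v n) - g t))"
      by (simp add: bounded_bilinear.diff_right[OF h])
    also have "norm \<dots> \<le> K / 2 * (c * F + D / c)"
      unfolding F_def D_def by (rule integrable_bilinear_L2(2)[OF h K(2) less_imp_le[OF K(1)] _ _ f gd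
          c]) measurable
    also have "\<dots> < r" unfolding distrib_left using cF D by linarith
    finally show "norm ((LINT t|lborel. h (f t) (g (t + v n))) - (LINT t|lborel. h (f t) (g t))) < r" .
  qed
qed

lemma lborel_integrable_pair_bilinear:
  fixes f :: "'a::euclidean_space \<Rightarrow> 'b::{banach, second_countable_topology}" and g ::
      "'e::euclidean_space \<Rightarrow> 'c::{banach, second_countable_topology}"
    and h :: "'b \<Rightarrow> 'c \<Rightarrow> 'd::{banach, second_countable_topology}"
  assumes h: "bounded_bilinear h" and f: "integrable lborel f" and g: "integrable lborel g"
  shows "integrable lborel (\<lambda>(x, y). h (f x) (g y))"
    and "(LINT z|lborel. (case z of (x, y) \<Rightarrow> h (f x) (g y))) = h (integral\<^sup>L lborel f) (integral\<^sup>L lborel g)"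
proof -
  obtain K where K: "K > 0" "\<And>x y. norm (h x y) \<le> norm x * norm y * K"
    using bounded_bilinear.pos_bounded[OF h] by blast
  have [measurable]: "f \<in> borel_measurable borel" "g \<in> borel_measurable borel" using f g
      by (auto dest: borel_measurable_integrable)
  have m: "(\<lambda>(x, y). h (f x) (g y)) \<in> borel_measurable (lborel \<Otimes>\<^sub>M lborel)"
    unfolding case_prod_unfold
    by (rule borel_measurable_continuous_Pair) (auto intro!: bounded_bilinear.continuous_on[OF h]
        continuous_intros)
  have lin: "bounded_linear (h a)" for a by (rule bounded_bilinear.bounded_linear_right[OF h])
  have i: "integrable (lborel \<Otimes>\<^sub>M lborel) (\<lambda>(x, y). h (f x) (g y))"
  proof (rule lborel_pair.Fubini_integrable[OF m])
    show "AE x in lborel. integrable lborel (\<lambda>y. case (x, y) of (x, y) \<Rightarrow> h (f x) (g y))"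
      using integrable_bounded_linear[OF lin g] by simp
    show "integrable lborel (\<lambda>x. LINT y|lborel. norm (case (x, y) of (x, y) \<Rightarrow> h (f x) (g y)))"
    proof (rule integrable_norm_le)
      show "integrable lborel (\<lambda>x. norm (f x) * ((LINT y|lborel. norm (g y)) * K))" using f by auto
      show "(\<lambda>x. LINT y|lborel. norm (case (x, y) of (x, y) \<Rightarrow> h (f x) (g y))) \<in> borel_measurable lborel"
        using m by measurable
      fix x
      have "(LINT y|lborel. norm (h (f x) (g y))) \<le> (LINT y|lborel. norm (f x) * norm (g y) * K)"
        using g by (intro integral_mono integrable_norm integrable_bounded_linear[OF lin g] K) auto
      also have "\<dots> = norm (f x) * ((LINT y|lborel. norm (g y)) * K)" by simp
      finally show "norm (LINT y|lborel. norm (case (x, y) of (x, y) \<Rightarrow> h (f x) (g y)))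
          \<le> norm (f x) * ((LINT y|lborel. norm (g y)) * K)"
        by simp
    qed
  qed
  then show "integrable lborel (\<lambda>(x, y). h (f x) (g y))" by (simp add: lborel_prod)
  have "(LINT z|lborel. (case z of (x, y) \<Rightarrow> h (f x) (g y))) = (LINT x|lborel. LINT y|lborel. h (f x) (g y))"
    using lborel_pair.integral_fst'[OF i] by (simp add: lborel_prod)
  also have "\<dots> = (LINT x|lborel. h (f x) (integral\<^sup>L lborel g))"
    using integral_bounded_linear[OF lin g] by simp
  also have "\<dots> = h (integral\<^sup>L lborel f) (integral\<^sup>L lborel g)"
    by (rule integral_bounded_linear[OF bounded_bilinear.bounded_linear_left[OF h] f])
  finally show "(LINT z|lborel. (case z of (x, y) \<Rightarrow> h (f x) (g y)))
      = h (integral\<^sup>L lborel f) (integral\<^sup>L lborel g)" .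
qed

lemma lborel_integral_scale:
  fixes f :: "'a::euclidean_space \<Rightarrow> 'b::{banach, second_countable_topology}"
  assumes [measurable]: "f \<in> borel_measurable borel" and c: "c \<noteq> 0"
  shows "(LINT x|lborel. f x) = \<bar>c\<bar> ^ DIM('a) *\<^sub>R (LINT x|lborel. f (c *\<^sub>R x))"
proof -
  have "(LINT x|lborel. f x) = (LINT x|density (distr lborel borel (\<lambda>x. 0 + c *\<^sub>R x)) (\<lambda>_. \<bar>c\<bar> ^
      DIM('a)). f x)"
    using lborel_affine[OF c, of "0::'a"] by simp
  also have "\<dots> = \<bar>c\<bar> ^ DIM('a) *\<^sub>R (LINT x|lborel. f (c *\<^sub>R x))"
    by (subst integral_density) (auto simp: integral_distr)
  finally show ?thesis .
qed

section \<open>Plancherel theorem for the Clifford-Fourier transform\<close>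

lemma borel_measurable_cmult [measurable (raw)]:
  assumes "f \<in> borel_measurable M" "g \<in> borel_measurable M"
  shows "(\<lambda>x. f x \<odot> g x) \<in> borel_measurable M"
  by (rule borel_measurable_continuous_Pair[OF assms]) (intro continuous_intros)

lemma borel_measurable_cconj [measurable (raw)]:
  assumes "f \<in> borel_measurable M"
  shows "(\<lambda>x. cconj (f x)) \<in> borel_measurable M"
  using measurable_compose[OF assms borel_measurable_continuous_onI[OF continuous_on_cconj[OF
      continuous_on_id]]] .

lemma bounded_bilinear_cconj_cmult: "bounded_bilinear (\<lambda>a b. cconj a \<odot> b)"
  by (rule bounded_bilinear.comp1[OF bounded_bilinear_cmult bounded_linear_cconj])

text \<open>The moments make the integral against the polynomially growing kernel converge.\<close>

definition admissible :: "((real, 'n::finite) vec \<Rightarrow> 'n clifford) \<Rightarrow> bool" where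
  "admissible h \<longleftrightarrow> h \<in> borel_measurable borel \<and> integrable lborel (\<lambda>t. (norm (h t))\<^sup>2)
     \<and> (\<forall>N. integrable lborel (\<lambda>t. (1 + norm t) ^ N * norm (h t)))"

lemma admissible_integrable:
  assumes "admissible h"
  shows "integrable lborel h"
proof (rule integrable_norm_cancel)
  have "integrable lborel (\<lambda>t. (1 + norm t) ^ 0 * norm (h t))"
    using assms unfolding admissible_def by blast
  then show "integrable lborel (\<lambda>t. norm (h t))" by simp
  show "h \<in> borel_measurable lborel" using assms by (simp add: admissible_def)
qed

text \<open>The factor (2 \<pi>)^(-d/2) is left out here, so the Plancherel formula carries (2
  \<pi>)^d.\<close>

definition clifford_FT :: "((real, 'n::{finite,linorder}) vec \<Rightarrow> 'n clifford) \<Rightarrow> (real, 'n) vec \<Rightarrow> 'n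
    clifford" where
  "clifford_FT h \<omega> = (LINT t|lborel. K_minus t \<omega> \<odot> h t)"

section \<open>The heat kernel as an approximate identity\<close>

text \<open>The Fourier integral of the Gaussian exp (- \<epsilon> |y|^2 / 2) over y. Its total mass
  is (2 \<pi>)^d for every \<epsilon> > 0.\<close>

definition heat :: "real \<Rightarrow> 'a::euclidean_space \<Rightarrow> real" where
  "heat \<epsilon> v = (2 * pi / \<epsilon>) powr (real DIM('a) / 2) * exp (- (norm v)\<^sup>2 / (2 * \<epsilon>))"

lemma heat_bounds: "heat \<epsilon> v \<ge> 0" "\<epsilon> > 0 \<Longrightarrow> heat \<epsilon> (v :: 'a)
    \<le> (2 * pi / \<epsilon>) powr (real DIM('a::euclidean_space) / 2)"
  unfolding heat_def by (simp, simp add: mult_left_le)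

lemma heat_measurable [measurable]: "heat \<epsilon> \<in> borel_measurable borel"
  unfolding heat_def[abs_def] by measurable

text \<open>Substituting t' = t + v and using that \<gamma> is even turns the double integral into
  \<gamma> against the correlation of f and g, whose continuity at 0 is accessible for
  square-integrable functions.\<close>

lemma correlation_integral_swap:
  fixes f g :: "(real, 'n::{finite,linorder}) vec \<Rightarrow> 'n clifford" and \<gamma> :: "(real, 'n) vec \<Rightarrow> real"
  assumes f: "integrable lborel f" and g: "integrable lborel g"
    and [measurable]: "\<gamma> \<in> borel_measurable borel" and \<gamma>: "\<And>v. \<bar>\<gamma> v\<bar> \<le> B" "\<And>v. \<gamma> (- v) = \<gamma> v"
  shows "(LINT z|lborel. \<gamma> (fst z - snd z) *\<^sub>R (cconj (f (fst z)) \<odot> g (snd z)))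
    = (LINT v|lborel. \<gamma> v *\<^sub>R (LINT t|lborel. cconj (f t) \<odot> g (t + v)))"
proof -
  have [measurable]: "f \<in> borel_measurable borel" "g \<in> borel_measurable borel" using f g
      by (auto dest: borel_measurable_integrable)
  have B: "B \<ge> 0" using \<gamma>(1)[of 0] by linarith
  obtain K where K: "K \<ge> 0" "\<And>x y. norm (cconj x \<odot> (y :: 'n clifford)) \<le> norm x * norm y * K"
    using bounded_bilinear.nonneg_bounded[OF bounded_bilinear_cconj_cmult] by blast
  note pair = lborel_integrable_pair_bilinear[OF bounded_bilinear_cconj_cmult f g]
  have "integrable lborel (\<lambda>z. \<gamma> (fst z - snd z) *\<^sub>R (cconj (f (fst z)) \<odot> g (snd z)))"
  proof (rule integrable_norm_le)
    show "integrable lborel (\<lambda>z. B * norm (case z of (t, t') \<Rightarrow> cconj (f t) \<odot> g t'))"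
      by (intro integrable_mult_right integrable_norm pair)
    show "norm (\<gamma> (fst z - snd z) *\<^sub>R (cconj (f (fst z)) \<odot> g (snd z)))
        \<le> B * norm (case z of (t, t') \<Rightarrow> cconj (f t) \<odot> g t')" for z
      using \<gamma>(1) by (auto simp: case_prod_unfold intro!: mult_right_mono)
  qed (simp add: lborel_prod[symmetric])
  then have "integrable (lborel \<Otimes>\<^sub>M lborel) (\<lambda>z. \<gamma> (fst z - snd z) *\<^sub>R (cconj (f (fst z)) \<odot> g (snd z)))"
    by (simp add: lborel_prod)
  from lborel_pair.integral_fst'[OF this]
  have "(LINT z|lborel. \<gamma> (fst z - snd z) *\<^sub>R (cconj (f (fst z)) \<odot> g (snd z)))
      = (LINT t|lborel. LINT t'|lborel. \<gamma> (t - t') *\<^sub>R (cconj (f t) \<odot> g t'))"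
    by (simp add: lborel_prod)
  also have "\<dots> = (LINT t|lborel. LINT v|lborel. \<gamma> v *\<^sub>R (cconj (f t) \<odot> g (t + v)))"
  proof -
    have "(LINT t'|lborel. \<gamma> (t - t') *\<^sub>R (cconj (f t) \<odot> g t'))
        = (LINT v|lborel. \<gamma> v *\<^sub>R (cconj (f t) \<odot> g (t + v)))" for t
    proof -
      have "(LINT t'|lborel. \<gamma> (t - t') *\<^sub>R (cconj (f t) \<odot> g t'))
          = (LINT v|lborel. \<gamma> (t - (v + t)) *\<^sub>R (cconj (f t) \<odot> g (v + t)))"
        by (rule lborel_integral_translate[symmetric]) measurable
      then show ?thesis by (simp add: \<gamma>(2) add.commute)
    qed
    then show ?thesis by simp
  qed
  also have "\<dots> = (LINT v|lborel. LINT t|lborel. \<gamma> v *\<^sub>R (cconj (f t) \<odot> g (t + v)))"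
  proof -
    have "integrable (lborel \<Otimes>\<^sub>M lborel) (\<lambda>(t, v). \<gamma> v *\<^sub>R (cconj (f t) \<odot> g (t + v)))"
    proof (rule lborel_pair.Fubini_integrable)
      have le: "norm (\<gamma> v *\<^sub>R (cconj (f t) \<odot> g (t + v))) \<le> (norm (f t) * (B * K)) * norm (g (v + t))" for t v
      proof -
        have "norm (\<gamma> v *\<^sub>R (cconj (f t) \<odot> g (t + v))) \<le> B * (norm (f t) * norm (g (t + v)) * K)"
          using \<gamma>(1)[of v] K(2)[of "f t" "g (t + v)"] B by (auto intro!: mult_mono)
        then show ?thesis by (simp add: mult_ac add.commute)
      qed
      have ig: "integrable lborel (\<lambda>v. (norm (f t) * (B * K)) * norm (g (v + t)))" for t
        using lborel_integrable_translate[OF g, of t] by auto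
      have i: "integrable lborel (\<lambda>v. \<gamma> v *\<^sub>R (cconj (f t) \<odot> g (t + v)))" for t
        by (rule integrable_norm_le[OF ig _ le]) measurable
      then show "AE t in lborel. integrable lborel (\<lambda>v. case (t, v) of (t, v) \<Rightarrow> \<gamma> v *\<^sub>R (cconj (f t) \<odot> g
          (t + v)))" by simp
      show "integrable lborel (\<lambda>t. LINT v|lborel. norm (case (t, v) of (t, v) \<Rightarrow> \<gamma> v *\<^sub>R (cconj (f t) \<odot> g
          (t + v))))"
      proof (rule integrable_norm_le)
        show "integrable lborel (\<lambda>t. norm (f t) * (B * K) * (LINT v|lborel. norm (g v)))" using f by auto
        fix t
        have "(LINT v|lborel. norm (\<gamma> v *\<^sub>R (cconj (f t) \<odot> g (t + v))))
            \<le> (LINT v|lborel. (norm (f t) * (B * K)) * norm (g (v + t)))"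
          by (intro integral_mono integrable_norm i ig le)
        also have "\<dots> = norm (f t) * (B * K) * (LINT v|lborel. norm (g v))"
          using lborel_integral_translate[of "\<lambda>v. norm (g v)" t] by simp
        finally show "norm (LINT v|lborel. norm (case (t, v) of (t, v) \<Rightarrow> \<gamma> v *\<^sub>R (cconj (f t) \<odot> g (t + v))))
            \<le> norm (f t) * (B * K) * (LINT v|lborel. norm (g v))" by simp
      qed measurable
    qed measurable
    from lborel_pair.Fubini_integral[OF this] show ?thesis by simp
  qed
  finally show ?thesis by simp
qed

text \<open>For \<epsilon> = 1 / a^2 the substitution v = u / a turns the heat kernel into a fixed
  Gaussian and moves the scaling into the correlation, which is bounded and continuous at 0. One
  factor (2 \<pi>)^(d/2) comes from the kernel, another from integrating the Gaussian.\<close>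

lemma heat_tendsto:
  fixes f g :: "(real, 'n::{finite,linorder}) vec \<Rightarrow> 'n clifford"
  assumes [measurable]: "f \<in> borel_measurable borel" "g \<in> borel_measurable borel"
    and f: "integrable lborel (\<lambda>t. (norm (f t))\<^sup>2)" and g: "integrable lborel (\<lambda>t. (norm (g t))\<^sup>2)"
  shows "(\<lambda>n. LINT v|lborel. heat (1 / (real (Suc n))\<^sup>2) v *\<^sub>R (LINT t|lborel. cconj (f t) \<odot> g (t + v)))
    \<longlonglongrightarrow> (2 * pi) ^ CARD('n) *\<^sub>R (LINT t|lborel. cconj (f t) \<odot> g t)"
proof -
  define \<phi> where "\<phi> v = (LINT t|lborel. cconj (f t) \<odot> g (t + v))" for v
  have [measurable]: "\<phi> \<in> borel_measurable borel" unfolding \<phi>_def by measurable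
  define c where "c = (2 * pi) powr (real CARD('n) / 2)"
  obtain K where K: "K \<ge> 0" "\<And>x y. norm (cconj x \<odot> (y :: 'n clifford)) \<le> norm x * norm y * K"
    using bounded_bilinear.nonneg_bounded[OF bounded_bilinear_cconj_cmult] by blast
  define B where "B = K / 2 * (1 * (LINT t|lborel. (norm (f t))\<^sup>2) + (LINT t|lborel. (norm (g t))\<^sup>2) / 1)"
  have B: "norm (\<phi> v) \<le> B" for v
  proof -
    have "integrable lborel (\<lambda>t. (norm (g (t + v)))\<^sup>2)" using lborel_integrable_translate[OF g] by simp
    from integrable_bilinear_L2(2)[OF bounded_bilinear_cconj_cmult K(2,1) _ _ f this zero_less_one]
    show ?thesis
      unfolding \<phi>_def B_def using lborel_integral_translate[of "\<lambda>t. (norm (g t))\<^sup>2" v] by simp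
  qed
  have G: "integrable lborel (\<lambda>u::(real, 'n) vec. exp (- (norm u)\<^sup>2 / 2))"
    using integrable_power_gauss[of 1 0, where 'a = "(real, 'n) vec"] by simp
  have G1: "(LINT u|lborel. exp (- (norm (u :: (real, 'n) vec))\<^sup>2 / 2)) = c"
    using gauss_fourier[of 1 "0 :: (real, 'n) vec"] by (simp add: c_def)
  have scale: "(LINT v|lborel. heat (1 / a\<^sup>2) v *\<^sub>R \<phi> v)
      = c *\<^sub>R (LINT u|lborel. exp (- (norm u)\<^sup>2 / 2) *\<^sub>R \<phi> ((1 / a) *\<^sub>R u))"
    if a: "a > 0" for a :: real
  proof -
    have h: "heat (1 / a\<^sup>2) ((1 / a) *\<^sub>R u) = a ^ CARD('n) * (c * exp (- (norm u)\<^sup>2 / 2))"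
        for u :: "(real, 'n) vec"
    proof -
      have "(2 * pi / (1 / a\<^sup>2)) powr (real CARD('n) / 2) = c * (a powr 2) powr (real CARD('n) / 2)"
        unfolding c_def using a by (simp add: powr_mult powr_numeral)
      also have "(a powr 2) powr (real CARD('n) / 2) = a ^ CARD('n)"
        using a by (simp only: powr_powr) (simp add: powr_realpow)
      finally show ?thesis
        unfolding heat_def using a by (simp add: power_divide power_mult_distrib)
    qed
    have "(LINT v|lborel. heat (1 / a\<^sup>2) v *\<^sub>R \<phi> v)
        = \<bar>1 / a\<bar> ^ CARD('n) *\<^sub>R (LINT u|lborel. heat (1 / a\<^sup>2) ((1 / a) *\<^sub>R u) *\<^sub>R \<phi> ((1 / a) *\<^sub>R u))"
      using lborel_integral_scale[of "\<lambda>v. heat (1 / a\<^sup>2) v *\<^sub>R \<phi> v" "1 / a"] a by simp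
    also have "\<dots> = \<bar>1 / a\<bar> ^ CARD('n) *\<^sub>R (LINT u|lborel. (a ^ CARD('n) * c) *\<^sub>R (exp (- (norm u)\<^sup>2 / 2)
        *\<^sub>R \<phi> ((1 / a) *\<^sub>R u)))"
      unfolding h by (simp add: mult.assoc)
    also have "\<dots> = c *\<^sub>R (LINT u|lborel. exp (- (norm u)\<^sup>2 / 2) *\<^sub>R \<phi> ((1 / a) *\<^sub>R u))"
      unfolding integral_scaleR_right using a by (simp add: power_divide)
    finally show ?thesis .
  qed
  have "(\<lambda>n. LINT u|lborel. exp (- (norm u)\<^sup>2 / 2) *\<^sub>R \<phi> ((1 / real (Suc n)) *\<^sub>R u))
      \<longlonglongrightarrow> (LINT u|lborel. exp (- (norm (u :: (real, 'n) vec))\<^sup>2 / 2) *\<^sub>R \<phi> 0)"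
  proof (rule integral_dominated_convergence[where w = "\<lambda>u. exp (- (norm u)\<^sup>2 / 2) * B"])
    show "AE u in lborel. (\<lambda>n. exp (- (norm u)\<^sup>2 / 2) *\<^sub>R \<phi> ((1 / real (Suc n)) *\<^sub>R u))
        \<longlonglongrightarrow> exp (- (norm (u :: (real, 'n) vec))\<^sup>2 / 2) *\<^sub>R \<phi> 0"
    proof (intro AE_I2 tendsto_scaleR tendsto_const)
      fix u :: "(real, 'n) vec"
      have "(\<lambda>n. (1 / real (Suc n)) *\<^sub>R u) \<longlonglongrightarrow> 0 *\<^sub>R u"
        by (intro tendsto_scaleR tendsto_const LIMSEQ_Suc lim_const_over_n[of 1, simplified])
      then show "(\<lambda>n. \<phi> ((1 / real (Suc n)) *\<^sub>R u)) \<longlonglongrightarrow> \<phi> 0"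
        using correlation_tendsto[OF bounded_bilinear_cconj_cmult _ _ f g] by (simp add: \<phi>_def)
    qed
    show "AE u in lborel. norm (exp (- (norm u)\<^sup>2 / 2) *\<^sub>R \<phi> ((1 / real (Suc n)) *\<^sub>R u))
        \<le> exp (- (norm u)\<^sup>2 / 2) * B" for n
      using B by (intro AE_I2) (auto intro!: mult_left_mono)
  qed (use G in auto)
  also have "(LINT u|lborel. exp (- (norm (u :: (real, 'n) vec))\<^sup>2 / 2) *\<^sub>R \<phi> 0) = c *\<^sub>R \<phi> 0"
    using G G1 by simp
  finally have "(\<lambda>n. c *\<^sub>R (LINT u|lborel. exp (- (norm u)\<^sup>2 / 2) *\<^sub>R \<phi> ((1 / real (Suc n)) *\<^sub>R u)))
      \<longlonglongrightarrow> c *\<^sub>R c *\<^sub>R \<phi> 0"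
    by (intro tendsto_scaleR tendsto_const)
  moreover have "c * c = (2 * pi) ^ CARD('n)"
    unfolding c_def by (simp add: powr_realpow flip: powr_add)
  ultimately show ?thesis
    unfolding \<phi>_def[symmetric] scale[OF of_nat_0_less_iff[THEN iffD2, OF zero_less_Suc]] by (simp add: \<phi>_def)
qed

section \<open>Gaussian regularization and its removal\<close>

context
  assumes even_dim: "even CARD('n::{finite,linorder})" and dim_gt_2: "CARD('n) > 2"
begin

lemma borel_measurable_K_minus [measurable (raw)]:
  fixes f g :: "'b \<Rightarrow> (real, 'n) vec"
  assumes "f \<in> borel_measurable M" "g \<in> borel_measurable M"
  shows "(\<lambda>x. K_minus (f x) (g x)) \<in> borel_measurable M"
  by (rule borel_measurable_continuous_Pair[OF assms])
     (intro K_minus_continuous even_dim dim_gt_2 continuous_intros)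

text \<open>The growth is separated: the Gaussian absorbs the power of \<omega>, the moments of an
  admissible function the power of t.\<close>

lemma K_minus_cmult_bound:
  obtains C N where "C \<ge> 0"
    "\<And>t \<omega> (a :: 'n clifford). norm (K_minus t \<omega> \<odot> a) \<le> C * (1 + norm \<omega>) ^ N * ((1 + norm t) ^ N * norm a)"
proof -
  obtain K where K: "K \<ge> 0" "\<And>x y. norm (x \<odot> (y :: 'n clifford)) \<le> norm x * norm y * K"
    using cmult.nonneg_bounded by blast
  obtain C N where C: "C \<ge> 0" "\<And>x y :: (real, 'n) vec. norm (K_minus x y)
      \<le> C * (1 + norm x) ^ N * (1 + norm y) ^ N"
    using K_minus_growth[OF even_dim dim_gt_2] by blast
  have "norm (K_minus t \<omega> \<odot> a) \<le> (C * K) * (1 + norm \<omega>) ^ N * ((1 + norm t) ^ N * norm a)"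
      for t \<omega> and a :: "'n clifford"
  proof -
    have "norm (K_minus t \<omega> \<odot> a) \<le> norm (K_minus t \<omega>) * norm a * K" by (rule K)
    also have "\<dots> \<le> (C * (1 + norm t) ^ N * (1 + norm \<omega>) ^ N) * norm a * K"
      using K(1) by (intro mult_right_mono C) auto
    finally show ?thesis by (simp add: mult_ac)
  qed
  then show ?thesis using that[of "C * K" N] C K by simp
qed

lemma clifford_FT_integrand_integrable:
  fixes h :: "(real, 'n) vec \<Rightarrow> 'n clifford"
  assumes "admissible h"
  shows "integrable lborel (\<lambda>t. K_minus t \<omega> \<odot> h t)"
proof -
  have [measurable]: "h \<in> borel_measurable borel" using assms by (simp add: admissible_def)
  obtain C N where C: "C \<ge> 0"
    "\<And>t \<omega> (a :: 'n clifford). norm (K_minus t \<omega> \<odot> a) \<le> C * (1 + norm \<omega>) ^ N * ((1 + norm t) ^ N * norm a)"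
    using K_minus_cmult_bound by blast
  have "integrable lborel (\<lambda>t. C * (1 + norm \<omega>) ^ N * ((1 + norm t) ^ N * norm (h t)))"
    using assms by (intro integrable_mult_right) (simp add: admissible_def)
  then show ?thesis by (rule integrable_norm_le) (use C in auto)
qed

lemma borel_measurable_clifford_FT:
  fixes h :: "(real, 'n) vec \<Rightarrow> 'n clifford"
  assumes "admissible h"
  shows "clifford_FT h \<in> borel_measurable borel"
proof -
  have [measurable]: "h \<in> borel_measurable borel" using assms by (simp add: admissible_def)
  show ?thesis unfolding clifford_FT_def[abs_def] by measurable
qed

text \<open>The product of the two transforms is an integral over pairs (t, t'). The Gaussian makes
  the triple integral absolutely convergent, and integrating over \<omega> first replaces the
  kernels by a real heat kernel in t - t'.\<close>

lemma clifford_FT_gauss_integral: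
  fixes h1 h2 :: "(real, 'n) vec \<Rightarrow> 'n clifford"
  assumes adm: "admissible h1" "admissible h2" and \<epsilon>: "\<epsilon> > 0"
  defines "w \<equiv> \<lambda>\<omega>::(real, 'n) vec. exp (- \<epsilon> * (norm \<omega>)\<^sup>2 / 2)"
  shows "integrable lborel (\<lambda>\<omega>. w \<omega> *\<^sub>R (cconj (clifford_FT h1 \<omega>) \<odot> clifford_FT h2 \<omega>))"
    and "(LINT \<omega>|lborel. w \<omega> *\<^sub>R (cconj (clifford_FT h1 \<omega>) \<odot> clifford_FT h2 \<omega>))
      = (LINT v|lborel. heat \<epsilon> v *\<^sub>R (LINT t|lborel. cconj (h1 t) \<odot> h2 (t + v)))"
proof -
  have [measurable]: "h1 \<in> borel_measurable borel" "h2 \<in> borel_measurable borel" using adm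
      by (auto simp: admissible_def)
  have [measurable]: "w \<in> borel_measurable borel" unfolding w_def by measurable
  obtain C N where C: "C \<ge> 0"
    "\<And>t \<omega> (a :: 'n clifford). norm (K_minus t \<omega> \<odot> a) \<le> C * (1 + norm \<omega>) ^ N * ((1 + norm t) ^ N * norm a)"
    using K_minus_cmult_bound by blast
  obtain K where K: "K \<ge> 0" "\<And>x y. norm (cconj x \<odot> (y :: 'n clifford)) \<le> norm x * norm y * K"
    using bounded_bilinear.nonneg_bounded[OF bounded_bilinear_cconj_cmult] by blast
  define \<Psi> where "\<Psi> \<omega> z = w \<omega> *\<^sub>R (cconj (K_minus (fst z) \<omega> \<odot> h1 (fst z)) \<odot> (K_minus (snd z) \<omega> \<odot> h2 (snd z)))"
    for \<omega> :: "(real, 'n) vec" and z :: "(real, 'n) vec \<times> (real, 'n) vec"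
  \<comment> \<open>The majorant factors as \<open>W\<close> times \<open>R\<close>, separating
    \<omega> from the pair; the exponent 2 N accounts for two kernels.\<close>
  define W where "W \<omega> = (1 + norm \<omega>) ^ (2 * N) * w \<omega>" for \<omega> :: "(real, 'n) vec"
  define R where "R z = C * C * K * (case z of (t, t') \<Rightarrow> ((1 + norm t) ^ N * norm (h1 t)) * ((1 + norm
      t') ^ N * norm (h2 t')))"
    for z :: "(real, 'n) vec \<times> (real, 'n) vec"
  have iW: "integrable lborel W" unfolding W_def w_def by (rule integrable_power_gauss[OF \<epsilon>])
  have iR: "integrable lborel R"
    unfolding R_def using adm
    by (intro integrable_mult_right lborel_integrable_pair_bilinear(1)[OF bounded_bilinear_mult]) (auto
        simp: admissible_def)
  have le: "norm (\<Psi> \<omega> z) \<le> W \<omega> * R z" for \<omega> z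
  proof -
    let ?a = "(1 + norm (fst z)) ^ N * norm (h1 (fst z))" and ?b
        = "(1 + norm (snd z)) ^ N * norm (h2 (snd z))"
    have "norm (\<Psi> \<omega> z) \<le> w \<omega> * (norm (K_minus (fst z) \<omega> \<odot> h1 (fst z)) * norm (K_minus (snd z) \<omega> \<odot> h2 (snd
        z)) * K)"
      unfolding \<Psi>_def norm_scaleR using K(2) by (intro mult_mono) (auto simp: w_def)
    also have "\<dots> \<le> w \<omega> * ((C * (1 + norm \<omega>) ^ N * ?a) * (C * (1 + norm \<omega>) ^ N * ?b) * K)"
      using C K(1) by (intro mult_left_mono mult_right_mono mult_mono) (auto simp: w_def)
    also have "\<dots> = W \<omega> * R z"
      by (simp add: W_def R_def case_prod_unfold power_add mult_2 mult_2_right mult_ac)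
    finally show ?thesis .
  qed
  have "(\<lambda>(\<omega>, z). \<Psi> \<omega> z) \<in> borel_measurable (lborel \<Otimes>\<^sub>M (lborel \<Otimes>\<^sub>M lborel))"
    unfolding \<Psi>_def by measurable
  then have m: "(\<lambda>(\<omega>, z). \<Psi> \<omega> z) \<in> borel_measurable lborel" by (simp add: lborel_prod)
  have "integrable lborel (\<lambda>(\<omega>, z). \<Psi> \<omega> z)"
    by (rule integrable_norm_le[OF lborel_integrable_pair_bilinear(1)[OF bounded_bilinear_mult iW iR] m])
       (use le in auto)
  then have i: "integrable (lborel \<Otimes>\<^sub>M lborel) (\<lambda>(\<omega>, z). \<Psi> \<omega> z)" by (simp add: lborel_prod)
  have 1: "w \<omega> *\<^sub>R (cconj (clifford_FT h1 \<omega>) \<odot> clifford_FT h2 \<omega>) = (LINT z|lborel. \<Psi> \<omega> z)" for \<omega>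
    using lborel_integrable_pair_bilinear(2)[OF bounded_bilinear_cconj_cmult
        clifford_FT_integrand_integrable[OF adm(1), of \<omega>] clifford_FT_integrand_integrable[OF adm(2), of \<omega>]]
    by (simp add: \<Psi>_def clifford_FT_def case_prod_unfold)
  show "integrable lborel (\<lambda>\<omega>. w \<omega> *\<^sub>R (cconj (clifford_FT h1 \<omega>) \<odot> clifford_FT h2 \<omega>))"
    unfolding 1 using lborel_pair.integrable_fst'[OF i] by simp
  have 2: "(LINT \<omega>|lborel. \<Psi> \<omega> z) = heat \<epsilon> (fst z - snd z) *\<^sub>R (cconj (h1 (fst z)) \<odot> h2 (snd z))" for z
  proof -
    have lin: "bounded_linear (\<lambda>u. cconj (h1 (fst z)) \<odot> u \<odot> h2 (snd z))"
      by (intro bounded_linear_compose[OF cmult.bounded_linear_left cmult.bounded_linear_right, unfolded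
          o_def])
    have int: "integrable lborel (\<lambda>\<omega>. w \<omega> *\<^sub>R (cconj (K_minus (fst z) \<omega>) \<odot> K_minus (snd z) \<omega>))"
    proof (rule integrable_norm_le)
      define c where "c t = C * (1 + norm t) ^ N * norm (cone :: 'n clifford)" for t :: "(real, 'n) vec"
      have c: "norm (K_minus t \<omega>) \<le> c t * (1 + norm \<omega>) ^ N" for t \<omega> :: "(real, 'n) vec"
        using C(2)[of t \<omega> cone] by (simp add: c_def mult_ac)
      show "integrable lborel (\<lambda>\<omega>. c (fst z) * c (snd z) * K * W \<omega>)" using iW by simp
      fix \<omega>
      have "norm (w \<omega> *\<^sub>R (cconj (K_minus (fst z) \<omega>) \<odot> K_minus (snd z) \<omega>))
          \<le> w \<omega> * (norm (K_minus (fst z) \<omega>) * norm (K_minus (snd z) \<omega>) * K)"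
        unfolding norm_scaleR using K(2) by (intro mult_mono) (auto simp: w_def)
      also have "\<dots> \<le> w \<omega> * ((c (fst z) * (1 + norm \<omega>) ^ N) * (c (snd z) * (1 + norm \<omega>) ^ N) * K)"
        using C K(1) c by (intro mult_left_mono mult_right_mono mult_mono) (auto simp: w_def c_def)
      also have "\<dots> = c (fst z) * c (snd z) * K * W \<omega>"
          by (simp add: W_def power_add mult_2 mult_2_right mult_ac)
      finally show "norm (w \<omega> *\<^sub>R (cconj (K_minus (fst z) \<omega>) \<odot> K_minus (snd z) \<omega>))
          \<le> c (fst z) * c (snd z) * K * W \<omega>" .
    qed measurable
    \<comment> \<open>Conjugation reverses products, so the two kernels become adjacent and their
      integral can be evaluated between the noncommuting outer factors.\<close>
    have "\<Psi> \<omega> z = cconj (h1 (fst z)) \<odot> (w \<omega> *\<^sub>R (cconj (K_minus (fst z) \<omega>) \<odot> K_minus (snd z) \<omega>)) \<odot> h2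
        (snd z)" for \<omega>
      by (simp add: \<Psi>_def cconj_cmult cmult_assoc cmult.scaleR_left cmult.scaleR_right)
    then have "(LINT \<omega>|lborel. \<Psi> \<omega> z) = cconj (h1 (fst z)) \<odot> (LINT \<omega>|lborel. w \<omega> *\<^sub>R (cconj (K_minus (fst
        z) \<omega>) \<odot> K_minus (snd z) \<omega>)) \<odot> h2 (snd z)"
      using integral_bounded_linear[OF lin int] by simp
    then show ?thesis
      unfolding w_def K_minus_gauss_integral[OF even_dim dim_gt_2 \<epsilon>]
      by (simp add: heat_def cmult.scaleR_left cmult.scaleR_right)
  qed
  have "(LINT \<omega>|lborel. w \<omega> *\<^sub>R (cconj (clifford_FT h1 \<omega>) \<odot> clifford_FT h2 \<omega>))
      = (LINT z|lborel. LINT \<omega>|lborel. \<Psi> \<omega> z)"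
    unfolding 1 using lborel_pair.Fubini_integral[OF i] by simp
  also have "\<dots> = (LINT v|lborel. heat \<epsilon> v *\<^sub>R (LINT t|lborel. cconj (h1 t) \<odot> h2 (t + v)))"
    unfolding 2
  proof (rule correlation_integral_swap)
    show "integrable lborel h1" "integrable lborel h2"
      using adm by (auto intro: admissible_integrable)
    show "\<bar>heat \<epsilon> (v :: (real, 'n) vec)\<bar> \<le> (2 * pi / \<epsilon>) powr (real DIM((real, 'n) vec) / 2)" for v
      using heat_bounds(1)[of \<epsilon> v] heat_bounds(2)[OF \<epsilon>, of v] by simp
  qed (auto simp: heat_def)
  finally show "(LINT \<omega>|lborel. w \<omega> *\<^sub>R (cconj (clifford_FT h1 \<omega>) \<odot> clifford_FT h2 \<omega>))
      = (LINT v|lborel. heat \<epsilon> v *\<^sub>R (LINT t|lborel. cconj (h1 t) \<odot> h2 (t + v)))" .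
qed

lemma clifford_FT_gauss_tendsto:
  fixes h1 h2 :: "(real, 'n) vec \<Rightarrow> 'n clifford"
  assumes "admissible h1" "admissible h2"
  shows "(\<lambda>n. LINT \<omega>|lborel. exp (- (1 / (real (Suc n))\<^sup>2) * (norm \<omega>)\<^sup>2 / 2) *\<^sub>R (cconj (clifford_FT h1
      \<omega>) \<odot> clifford_FT h2 \<omega>))
    \<longlonglongrightarrow> (2 * pi) ^ CARD('n) *\<^sub>R (LINT t|lborel. cconj (h1 t) \<odot> h2 t)"
proof -
  have "1 / (real (Suc n))\<^sup>2 > 0" for n by simp
  from clifford_FT_gauss_integral(2)[OF assms this] show ?thesis
    using heat_tendsto[of h1 h2] assms by (simp add: admissible_def del: of_nat_Suc)
qed

lemma exp_gauss_tendsto: "(\<lambda>n. exp (- (1 / (real (Suc n))\<^sup>2) * r / 2)) \<longlonglongrightarrow> 1"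
proof -
  have "(\<lambda>n. (1 / real (Suc n))\<^sup>2) \<longlonglongrightarrow> 0\<^sup>2"
    by (intro tendsto_power LIMSEQ_Suc lim_const_over_n[of 1, simplified])
  then have "(\<lambda>n. 1 / (real (Suc n))\<^sup>2) \<longlonglongrightarrow> 0" by (simp add: power_divide del: of_nat_Suc)
  then have "(\<lambda>n. exp (- (1 / (real (Suc n))\<^sup>2) * r / 2)) \<longlonglongrightarrow> exp (- 0 * r / 2)"
    by (intro tendsto_intros) auto
  then show ?thesis by simp
qed

text \<open>Integrability is a conclusion here: the coefficient of 1 turns the Gaussian limit into
  one of nonnegative real integrals, and the weights increase to 1, so monotone convergence
  applies.\<close>

lemma clifford_FT_norm_square:
  fixes h :: "(real, 'n) vec \<Rightarrow> 'n clifford"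
  assumes "admissible h"
  shows "integrable lborel (\<lambda>\<omega>. (norm (clifford_FT h \<omega>))\<^sup>2)"
    and "(LINT \<omega>|lborel. (norm (clifford_FT h \<omega>))\<^sup>2) = (2 * pi) ^ CARD('n) * (LINT t|lborel. (norm (h t))\<^sup>2)"
proof -
  note [measurable] = borel_measurable_clifford_FT[OF assms]
  have hm [measurable]: "h \<in> borel_measurable borel" and h2: "integrable lborel (\<lambda>t. (norm (h t))\<^sup>2)"
    using assms by (auto simp: admissible_def)
  let ?w = "\<lambda>n \<omega>. exp (- (1 / (real (Suc n))\<^sup>2) * (norm (\<omega> :: (real, 'n) vec))\<^sup>2 / 2)"
  have lin: "bounded_linear (\<lambda>a :: 'n clifford. a $ {})" by (rule bounded_linear_vec_nth)
  have pos: "1 / (real (Suc n))\<^sup>2 > 0" for n by simp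
  note i = clifford_FT_gauss_integral(1)[OF assms assms pos]
  have c: "(?w n \<omega> *\<^sub>R (cconj (clifford_FT h \<omega>) \<odot> clifford_FT h \<omega>)) $ {}
      = ?w n \<omega> * (norm (clifford_FT h \<omega>))\<^sup>2" for n \<omega>
    by (simp add: cmult_cconj_scalar_part)
  have I: "integrable lborel (\<lambda>\<omega>. ?w n \<omega> * (norm (clifford_FT h \<omega>))\<^sup>2)" for n
    using integrable_bounded_linear[OF lin i[of n]] unfolding c .
  have e: "(LINT \<omega>|lborel. ?w n \<omega> *\<^sub>R (cconj (clifford_FT h \<omega>) \<odot> clifford_FT h \<omega>)) $ {}
      = (LINT \<omega>|lborel. ?w n \<omega> * (norm (clifford_FT h \<omega>))\<^sup>2)" for n
    using integral_bounded_linear[OF lin i[of n]] unfolding c by simp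
  obtain K where K: "K \<ge> 0" "\<And>x y. norm (cconj x \<odot> (y :: 'n clifford)) \<le> norm x * norm y * K"
    using bounded_bilinear.nonneg_bounded[OF bounded_bilinear_cconj_cmult] by blast
  have ih: "integrable lborel (\<lambda>t. cconj (h t) \<odot> h t)"
    by (rule integrable_bilinear_L2(1)[OF bounded_bilinear_cconj_cmult K(2,1) _ _ h2 h2 zero_less_one])
        simp_all
  have eh: "(LINT t|lborel. cconj (h t) \<odot> h t) $ {} = (LINT t|lborel. (norm (h t))\<^sup>2)"
    using integral_bounded_linear[OF lin ih] by (simp add: cmult_cconj_scalar_part)
  have lim: "(\<lambda>n. LINT \<omega>|lborel. ?w n \<omega> * (norm (clifford_FT h \<omega>))\<^sup>2)
      \<longlonglongrightarrow> (2 * pi) ^ CARD('n) * (LINT t|lborel. (norm (h t))\<^sup>2)"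
    using bounded_linear.tendsto[OF lin clifford_FT_gauss_tendsto[OF assms assms]] unfolding e
        by (simp add: eh)
  have mono: "AE \<omega> in lborel. mono (\<lambda>n. ?w n \<omega> * (norm (clifford_FT h \<omega>))\<^sup>2)"
  proof (intro AE_I2 monoI mult_right_mono)
    have g: "exp (- a * r / 2) \<le> exp (- b * r / 2)" if "b \<le> a" "0 \<le> r" for a b r :: real
      using mult_right_mono[OF that] by simp
    fix \<omega> :: "(real, 'n) vec" and m n :: nat assume "m \<le> n"
    then have "1 / (real (Suc n))\<^sup>2 \<le> 1 / (real (Suc m))\<^sup>2"
      by (intro divide_left_mono power_mono) auto
    then show "?w m \<omega> \<le> ?w n \<omega>" by (rule g) simp
  qed simp
  have pw: "AE \<omega> in lborel. (\<lambda>n. ?w n \<omega> * (norm (clifford_FT h \<omega>))\<^sup>2) \<longlonglongrightarrow> (norm (clifford_FT h \<omega>))\<^sup>2"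
    using tendsto_mult[OF exp_gauss_tendsto tendsto_const] by (intro AE_I2) simp
  have nn: "AE \<omega> in lborel. 0 \<le> ?w n \<omega> * (norm (clifford_FT h \<omega>))\<^sup>2" for n by simp
  have m: "(\<lambda>\<omega>. (norm (clifford_FT h \<omega>))\<^sup>2) \<in> borel_measurable lborel" by measurable
  show "integrable lborel (\<lambda>\<omega>. (norm (clifford_FT h \<omega>))\<^sup>2)"
    by (rule integral_monotone_convergence_nonneg(1)[OF I mono nn pw lim m])
  show "(LINT \<omega>|lborel. (norm (clifford_FT h \<omega>))\<^sup>2) = (2 * pi) ^ CARD('n) * (LINT t|lborel. (norm (h t))\<^sup>2)"
    by (rule integral_monotone_convergence_nonneg(2)[OF I mono nn pw lim m])
qed

text \<open>Both transforms being square-integrable, their product is integrable and dominates its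
  Gaussian-weighted versions, so the weight can be removed directly.\<close>

lemma clifford_FT_plancherel:
  fixes h1 h2 :: "(real, 'n) vec \<Rightarrow> 'n clifford"
  assumes adm: "admissible h1" "admissible h2"
  shows "integrable lborel (\<lambda>\<omega>. cconj (clifford_FT h1 \<omega>) \<odot> clifford_FT h2 \<omega>)"
    and "(LINT \<omega>|lborel. cconj (clifford_FT h1 \<omega>) \<odot> clifford_FT h2 \<omega>)
        = (2 * pi) ^ CARD('n) *\<^sub>R (LINT t|lborel. cconj (h1 t) \<odot> h2 t)"
proof -
  note [measurable] = borel_measurable_clifford_FT[OF adm(1)] borel_measurable_clifford_FT[OF adm(2)]
  obtain K where K: "K \<ge> 0" "\<And>x y. norm (cconj x \<odot> (y :: 'n clifford)) \<le> norm x * norm y * K"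
    using bounded_bilinear.nonneg_bounded[OF bounded_bilinear_cconj_cmult] by blast
  show i: "integrable lborel (\<lambda>\<omega>. cconj (clifford_FT h1 \<omega>) \<odot> clifford_FT h2 \<omega>)"
    by (rule integrable_bilinear_L2(1)[OF bounded_bilinear_cconj_cmult K(2,1) _ _
        clifford_FT_norm_square(1)[OF adm(1)] clifford_FT_norm_square(1)[OF adm(2)] zero_less_one])
       simp_all
  let ?w = "\<lambda>n \<omega>. exp (- (1 / (real (Suc n))\<^sup>2) * (norm (\<omega> :: (real, 'n) vec))\<^sup>2 / 2)"
  have "(\<lambda>n. LINT \<omega>|lborel. ?w n \<omega> *\<^sub>R (cconj (clifford_FT h1 \<omega>) \<odot> clifford_FT h2 \<omega>))
      \<longlonglongrightarrow> (LINT \<omega>|lborel. cconj (clifford_FT h1 \<omega>) \<odot> clifford_FT h2 \<omega>)"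
  proof (rule integral_dominated_convergence[where w
      = "\<lambda>\<omega>. norm (cconj (clifford_FT h1 \<omega>) \<odot> clifford_FT h2 \<omega>)"])
    show "AE \<omega> in lborel. (\<lambda>n. ?w n \<omega> *\<^sub>R (cconj (clifford_FT h1 \<omega>) \<odot> clifford_FT h2 \<omega>))
        \<longlonglongrightarrow> cconj (clifford_FT h1 \<omega>) \<odot> clifford_FT h2 \<omega>"
      using tendsto_scaleR[OF exp_gauss_tendsto tendsto_const] by (intro AE_I2) simp
    show "AE \<omega> in lborel. norm (?w n \<omega> *\<^sub>R (cconj (clifford_FT h1 \<omega>) \<odot> clifford_FT h2 \<omega>))
        \<le> norm (cconj (clifford_FT h1 \<omega>) \<odot> clifford_FT h2 \<omega>)" for n
      by (intro AE_I2) (auto intro!: mult_left_le_one_le)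
  qed (use i in auto)
  with clifford_FT_gauss_tendsto[OF adm]
  show "(LINT \<omega>|lborel. cconj (clifford_FT h1 \<omega>) \<odot> clifford_FT h2 \<omega>)
      = (2 * pi) ^ CARD('n) *\<^sub>R (LINT t|lborel. cconj (h1 t) \<odot> h2 t)"
    by (rule LIMSEQ_unique[rotated])
qed

end

section \<open>The short-time transform\<close>

lemma schwartz_continuous:
  assumes "g \<in> schwartz"
  shows "continuous_on UNIV g"
proof -
  have "\<forall>x. partial_derivs [] g differentiable at x" using assms unfolding schwartz_def by blast
  then have "g differentiable at x" for x by (simp add: partial_derivs_def)
  then show ?thesis by (meson continuous_at_imp_continuous_on differentiable_imp_continuous_within)
qed

lemma schwartz_decay:
  assumes "g \<in> schwartz"
  shows "\<exists>C\<ge>0. \<forall>x. (1 + norm x) ^ k * \<bar>g x\<bar> \<le> C"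
proof -
  have "\<exists>B. \<forall>x. norm x ^ j * \<bar>g x\<bar> \<le> B" for j
  proof -
    have "bounded (range (\<lambda>x. norm x ^ j * partial_derivs [] g x))" using assms unfolding schwartz_def
        by blast
    then show ?thesis by (auto simp: bounded_iff partial_derivs_def abs_mult)
  qed
  then obtain B where B: "\<And>j x. norm x ^ j * \<bar>g x\<bar> \<le> B j" by metis
  have "(1 + norm x) ^ k * \<bar>g x\<bar> \<le> 2 ^ k * (B 0 + B k)" for x
  proof -
    have "(1 + norm x) ^ k \<le> (2 * max 1 (norm x)) ^ k" by (intro power_mono) auto
    also have "\<dots> \<le> 2 ^ k * (1 + norm x ^ k)"
      unfolding power_mult_distrib by (intro mult_left_mono) (auto simp: max_def)
    finally have "(1 + norm x) ^ k * \<bar>g x\<bar> \<le> (2 ^ k * (1 + norm x ^ k)) * \<bar>g x\<bar>"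
      by (intro mult_right_mono) auto
    also have "\<dots> = 2 ^ k * (norm x ^ 0 * \<bar>g x\<bar> + norm x ^ k * \<bar>g x\<bar>)" by (simp add: algebra_simps)
    also have "\<dots> \<le> 2 ^ k * (B 0 + B k)" by (intro mult_left_mono add_mono B) auto
    finally show ?thesis .
  qed
  then have "\<forall>x. (1 + norm x) ^ k * \<bar>g x\<bar> \<le> \<bar>2 ^ k * (B 0 + B k)\<bar>" by (meson abs_ge_self order_trans)
  then show ?thesis by (meson abs_ge_zero)
qed

lemma schwartz_weighted_square_integrable:
  assumes "g \<in> schwartz"
  shows "integrable lborel (\<lambda>x::(real, 'n::finite) vec. ((1 + norm x) ^ N * g x)\<^sup>2)"
proof -
  let ?D = "DIM((real, 'n) vec)"
  have [measurable]: "g \<in> borel_measurable borel"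
    by (rule borel_measurable_continuous_onI[OF schwartz_continuous[OF assms]])
  \<comment> \<open>The additional DIM powers of decay become 2 DIM after squaring, which is the
    integrable weight.\<close>
  obtain C where C: "C \<ge> 0" "\<And>x. (1 + norm x) ^ (N + ?D) * \<bar>g x\<bar> \<le> C"
    using schwartz_decay[OF assms] by blast
  show ?thesis
  proof (rule integrable_norm_le)
    show "integrable lborel (\<lambda>x::(real, 'n) vec. C\<^sup>2 * (1 / (1 + norm x) ^ (2 * ?D)))"
      by (intro integrable_mult_right integrable_inverse_one_plus_norm_power)
    fix x :: "(real, 'n) vec"
    have p: "(1 + norm x) ^ ?D > 0" by (simp add: add_pos_nonneg)
    have "\<bar>(1 + norm x) ^ N * g x\<bar> \<le> C / (1 + norm x) ^ ?D"
      using C(2)[of x] p by (simp add: abs_mult power_add field_simps)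
    then have "((1 + norm x) ^ N * g x)\<^sup>2 \<le> (C / (1 + norm x) ^ ?D)\<^sup>2"
      using C(1) p by (simp add: abs_le_square_iff[symmetric])
    then show "norm (((1 + norm x) ^ N * g x)\<^sup>2) \<le> C\<^sup>2 * (1 / (1 + norm x) ^ (2 * ?D))"
      by (simp add: power_divide mult.commute flip: power_mult)
  qed measurable
qed

lemma schwartz_square_integrable:
  assumes "g \<in> schwartz"
  shows "integrable lborel (\<lambda>x::(real, 'n::finite) vec. (g x)\<^sup>2)"
  using schwartz_weighted_square_integrable[OF assms, of 0] by simp

lemma schwartz_product_integrable:
  assumes "g1 \<in> schwartz" "g2 \<in> schwartz"
  shows "integrable lborel (\<lambda>x::(real, 'n::finite) vec. g1 x * g2 x)"
proof -
  have [measurable]: "g1 \<in> borel_measurable borel" "g2 \<in> borel_measurable borel"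
    using assms by (auto intro: borel_measurable_continuous_onI schwartz_continuous)
  have le: "norm (a * b) \<le> norm a * norm b * 1" for a b :: real by (simp add: abs_mult)
  show ?thesis
    by (rule integrable_bilinear_L2(1)[OF bounded_bilinear_mult le zero_le_one _ _ _ _ zero_less_one])
       (use schwartz_square_integrable assms in auto)
qed

text \<open>The inequality 1 + |t| \<le> (1 + |x|) (1 + |t - x|) moves polynomial weights from t
  onto the window, whose rapid decay makes it square-integrable with any weight; a product of two
  square-integrable functions is integrable.\<close>

lemma admissible_window:
  fixes f :: "(real, 'n::{finite,linorder}) vec \<Rightarrow> 'n clifford"
  assumes g: "g \<in> schwartz" and [measurable]: "f \<in> borel_measurable borel"
    and f: "integrable lborel (\<lambda>t. (norm (f t))\<^sup>2)"
  shows "admissible (\<lambda>t. g (t - x) *\<^sub>R f t)"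
proof -
  have [measurable]: "g \<in> borel_measurable borel"
    by (rule borel_measurable_continuous_onI[OF schwartz_continuous[OF g]])
  obtain C where C: "C \<ge> 0" "\<And>x. (1 + norm x) ^ 0 * \<bar>g x\<bar> \<le> C" using schwartz_decay[OF g] by blast
  have "integrable lborel (\<lambda>t. (norm (g (t - x) *\<^sub>R f t))\<^sup>2)"
  proof (rule integrable_norm_le)
    show "integrable lborel (\<lambda>t. C\<^sup>2 * (norm (f t))\<^sup>2)" using f by simp
    fix t
    have "\<bar>g (t - x)\<bar>\<^sup>2 \<le> C\<^sup>2" using C(2)[of "t - x"] by (intro power_mono) auto
    then show "norm ((norm (g (t - x) *\<^sub>R f t))\<^sup>2) \<le> C\<^sup>2 * (norm (f t))\<^sup>2"
      by (simp add: power_mult_distrib mult_right_mono)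
  qed measurable
  moreover have "integrable lborel (\<lambda>t. (1 + norm t) ^ N * norm (g (t - x) *\<^sub>R f t))" for N
  proof -
    define G where "G t = (1 + norm (t - x)) ^ N * g (t - x)" for t
    have [measurable]: "G \<in> borel_measurable borel" unfolding G_def[abs_def] by measurable
    have iG: "integrable lborel (\<lambda>t. (norm (G t))\<^sup>2)"
      using lborel_integrable_translate[OF schwartz_weighted_square_integrable[OF g, of N], of "- x"]
      by (simp add: G_def)
    have le: "norm (a *\<^sub>R b) \<le> norm a * norm b * 1" for a and b :: "'n clifford" by simp
    have iGf: "integrable lborel (\<lambda>t. G t *\<^sub>R f t)"
      by (rule integrable_bilinear_L2(1)[OF bounded_bilinear_scaleR le zero_le_one _ _ iG f
          zero_less_one]) simp_all
    show ?thesis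
    proof (rule integrable_norm_le)
      show "integrable lborel (\<lambda>t. (1 + norm x) ^ N * norm (G t *\<^sub>R f t))"
        by (intro integrable_mult_right integrable_norm iGf)
      fix t
      have "1 + norm t \<le> (1 + norm x) * (1 + norm (t - x))"
      proof -
        have "norm t \<le> norm x + norm (t - x)" using norm_triangle_ineq[of x "t - x"] by simp
        moreover have "0 \<le> norm x * norm (t - x)" by simp
        moreover have "(1 + norm x) * (1 + norm (t - x)) = 1 + norm x + norm (t - x) + norm x * norm (t - x)"
          by (simp add: algebra_simps)
        ultimately show ?thesis by linarith
      qed
      then have "(1 + norm t) ^ N \<le> ((1 + norm x) * (1 + norm (t - x))) ^ N" by (intro power_mono) auto
      then have "(1 + norm t) ^ N * norm (g (t - x) *\<^sub>R f t)
          \<le> ((1 + norm x) * (1 + norm (t - x))) ^ N * norm (g (t - x) *\<^sub>R f t)"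
        by (intro mult_right_mono) auto
      then show "norm ((1 + norm t) ^ N * norm (g (t - x) *\<^sub>R f t)) \<le> (1 + norm x) ^ N * norm (G t *\<^sub>R f t)"
        by (simp add: G_def abs_mult power_mult_distrib mult_ac)
    qed measurable
  qed
  ultimately show ?thesis by (simp add: admissible_def)
qed

section \<open>Averaging over window positions and Borel representatives\<close>

lemma lborel_reflect:
  fixes f :: "'a::euclidean_space \<Rightarrow> 'b::{banach, second_countable_topology}"
  assumes "integrable lborel f"
  shows "integrable lborel (\<lambda>x. f (t - x))" "(LINT x|lborel. f (t - x)) = (LINT x|lborel. f x)"
proof -
  have [measurable]: "f \<in> borel_measurable borel" using assms by (auto dest: borel_measurable_integrable)
  have l: "lborel = distr lborel borel (\<lambda>x::'a. t - x)"
    using lborel_affine[of "-1" t] by (simp add: density_1)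
  have "integrable (distr lborel borel (\<lambda>x::'a. t - x)) f"
    using assms unfolding l[symmetric] .
  then show "integrable lborel (\<lambda>x. f (t - x))"
    by (simp add: integrable_distr_eq)
  have "(LINT x|lborel. f x) = (LINT x|distr lborel borel (\<lambda>x::'a. t - x). f x)"
    unfolding l[symmetric] ..
  then show "(LINT x|lborel. f (t - x)) = (LINT x|lborel. f x)"
    by (simp add: integral_distr)
qed

text \<open>For fixed t, the window positions x integrate out by reflection and translation. With a
  product of windows as \<open>a\<close> this yields the value of the theorem, with squares of
  windows its absolute convergence.\<close>

lemma integral_window_average:
  fixes a :: "'a::euclidean_space \<Rightarrow> real" and b :: "'a \<Rightarrow> 'b::{banach, second_countable_topology}"
  assumes a: "integrable lborel a" and b: "integrable lborel b"
  shows "integrable lborel (\<lambda>x. LINT t|lborel. a (t - x) *\<^sub>R b t)"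
    and "(LINT x|lborel. LINT t|lborel. a (t - x) *\<^sub>R b t) = (LINT x|lborel. a x) *\<^sub>R (LINT t|lborel. b t)"
proof -
  have [measurable]: "a \<in> borel_measurable borel" "b \<in> borel_measurable borel" using a b
      by (auto dest: borel_measurable_integrable)
  have i: "integrable (lborel \<Otimes>\<^sub>M lborel) (\<lambda>(t, x). a (t - x) *\<^sub>R b t)"
  proof (rule lborel_pair.Fubini_integrable)
    show "AE t in lborel. integrable lborel (\<lambda>x. case (t, x) of (t, x) \<Rightarrow> a (t - x) *\<^sub>R b t)"
      using lborel_reflect(1)[OF a] by simp
    have e: "(\<lambda>t. LINT x|lborel. norm (case (t, x) of (t, x) \<Rightarrow> a (t - x) *\<^sub>R b t))
        = (\<lambda>t. (LINT x|lborel. \<bar>a x\<bar>) * norm (b t))"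
      by (rule ext) (simp add: lborel_reflect(2)[OF integrable_abs[OF a]])
    show "integrable lborel (\<lambda>t. LINT x|lborel. norm (case (t, x) of (t, x) \<Rightarrow> a (t - x) *\<^sub>R b t))"
      unfolding e by (intro integrable_mult_right integrable_norm b)
  qed measurable
  from lborel_pair.integrable_snd[OF i] show "integrable lborel (\<lambda>x. LINT t|lborel. a (t - x) *\<^sub>R b t)"
      by simp
  from lborel_pair.Fubini_integral[OF i]
  have "(LINT x|lborel. LINT t|lborel. a (t - x) *\<^sub>R b t)
      = (LINT t|lborel. LINT x|lborel. a (t - x) *\<^sub>R b t)" by simp
  also have "\<dots> = (LINT t|lborel. (LINT x|lborel. a x) *\<^sub>R b t)"
    using lborel_reflect[OF a] by simp
  finally show "(LINT x|lborel. LINT t|lborel. a (t - x) *\<^sub>R b t)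
      = (LINT x|lborel. a x) *\<^sub>R (LINT t|lborel. b t)" by simp
qed

text \<open>The Fubini arguments need joint Borel measurability, while square-integrable functions
  are given as Lebesgue measurable. The completion argument is real-valued, hence applied
  coordinatewise.\<close>

lemma borel_representative:
  fixes f :: "(real, 'n::finite) vec \<Rightarrow> (real, 'm::finite) vec"
  assumes "f \<in> borel_measurable lebesgue"
  obtains f' where "f' \<in> borel_measurable borel" "AE t in lebesgue. f t = f' t"
proof -
  have "\<exists>g. g \<in> borel_measurable borel \<and> (AE t in lborel. f t $ A = g t)" for A
  proof -
    have "(\<lambda>t. f t $ A) \<in> borel_measurable lebesgue"
      by (intro measurable_compose[OF assms] borel_measurable_continuous_onI continuous_intros)
    from completion_ex_borel_measurable_real[OF this] show ?thesis by auto
  qed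
  then have "\<exists>g. \<forall>A. g A \<in> borel_measurable borel \<and> (AE t in lborel. f t $ A = g A t)"
    by (intro choice allI)
  then obtain g where g: "\<And>A. g A \<in> borel_measurable borel" "\<And>A. AE t in lborel. f t $ A = g A t"
    by blast
  show ?thesis
  proof
    show "(\<lambda>t. \<chi> A. g A t) \<in> borel_measurable borel"
    proof -
      have "(\<chi> A. g A t) = (\<Sum>A\<in>UNIV. g A t *\<^sub>R axis A 1)" for t
        by (subst vec_eq_sum_axis) simp
      then show ?thesis using g(1) by simp
    qed
    have "AE t in lborel. \<forall>A. f t $ A = g A t" using g(2) by (simp add: AE_all_countable)
    then have "AE t in lborel. f t = (\<chi> A. g A t)" by eventually_elim (simp add: vec_eq_iff)
    then show "AE t in lebesgue. f t = (\<chi> A. g A t)" by (rule AE_completion)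
  qed
qed

theorem theorem8p1:
  fixes g1 g2 :: "(real, 'n::{finite,linorder}) vec \<Rightarrow> real"
    and f1 f2 :: "(real, 'n) vec \<Rightarrow> 'n clifford"
  assumes "even CARD('n)" and "CARD('n) > 2"
    and "g1 \<in> schwartz" and "radial g1"
    and "g2 \<in> schwartz" and "radial g2"
    and "f1 \<in> L2_clifford" and "f2 \<in> L2_clifford"
  shows "has_bochner_integral lebesgue
           (\<lambda>(x, \<omega>). cconj (clifford_STFT g1 f1 x \<omega>) \<odot> clifford_STFT g2 f2 x \<omega>)
           ((LINT z|lebesgue. g1 z * g2 z) *\<^sub>R cinner f1 f2)"
proof -
  note K_meas [measurable (raw)] = borel_measurable_K_minus[OF assms(1,2)]
  define c where "c = (2 * pi) powr (- real CARD('n) / 2)"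
  \<comment> \<open>The two normalizations of the transforms cancel the constant of the Plancherel
    formula.\<close>
  have cc: "c * c * (2 * pi) ^ CARD('n) = 1"
  proof -
    have "c * c = (2 * pi) powr (- real CARD('n))" unfolding c_def by (simp flip: powr_add)
    then have "c * c = inverse ((2 * pi) ^ CARD('n))" by (simp add: powr_minus powr_realpow)
    then show ?thesis by (simp only:) (rule left_inverse, simp)
  qed
  have gm [measurable]: "g1 \<in> borel_measurable borel" "g2 \<in> borel_measurable borel"
    using assms by (auto intro: borel_measurable_continuous_onI schwartz_continuous)
  obtain F1 where F1 [measurable]: "F1 \<in> borel_measurable borel" and F1f: "AE t in lebesgue. f1 t = F1 t"
    using borel_representative assms(7) unfolding L2_clifford_def by blast
  obtain F2 where F2 [measurable]: "F2 \<in> borel_measurable borel" and F2f: "AE t in lebesgue. f2 t = F2 t"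
    using borel_representative assms(8) unfolding L2_clifford_def by blast
  have L2: "integrable lborel (\<lambda>t. (norm (F t))\<^sup>2)"
    if f: "f \<in> L2_clifford" and F [measurable]: "F \<in> borel_measurable borel" and eq: "AE t in lebesgue. f
        t = F t"
    for f F :: "(real, 'n) vec \<Rightarrow> 'n clifford"
  proof -
    have [measurable]: "F \<in> borel_measurable lebesgue" "f \<in> borel_measurable lebesgue"
      using f by (auto simp: L2_clifford_def intro: measurable_completion)
    have "integrable lebesgue (\<lambda>t. (norm (F t))\<^sup>2) \<longleftrightarrow> integrable lebesgue (\<lambda>t. (norm (f t))\<^sup>2)"
      by (rule integrable_cong_AE) (use eq in auto)
    moreover have "integrable lebesgue (\<lambda>t. (norm (F t))\<^sup>2) \<longleftrightarrow> integrable lborel (\<lambda>t. (norm (F t))\<^sup>2)"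
      by (rule integrable_completion) measurable
    ultimately show ?thesis using f by (simp add: L2_clifford_def)
  qed
  note L1 = L2[OF assms(7) F1 F1f] and L2 = L2[OF assms(8) F2 F2f]
  define H1 where "H1 = (\<lambda>x t. g1 (t - x) *\<^sub>R F1 t)"
  define H2 where "H2 = (\<lambda>x t. g2 (t - x) *\<^sub>R F2 t)"
  have adm1: "admissible (H1 x)" for x unfolding H1_def by (rule admissible_window[OF assms(3) F1 L1])
  have adm2: "admissible (H2 x)" for x unfolding H2_def by (rule admissible_window[OF assms(5) F2 L2])
  \<comment> \<open>Equality holds for every x and \<omega>, not just almost everywhere, since a
    null set of t does not affect the defining integral.\<close>
  have STFT: "clifford_STFT g f x \<omega> = c *\<^sub>R clifford_FT (\<lambda>t. g (t - x) *\<^sub>R F t) \<omega>"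
    if f: "f \<in> L2_clifford" and F [measurable]: "F \<in> borel_measurable borel" and eq: "AE t in lebesgue. f
        t = F t"
      and g [measurable]: "g \<in> borel_measurable borel"
    for f F :: "(real, 'n) vec \<Rightarrow> 'n clifford" and g x \<omega>
  proof -
    have [measurable]: "F \<in> borel_measurable lebesgue" "f \<in> borel_measurable lebesgue" "(\<lambda>t. g (t - x)) \<in>
        borel_measurable lebesgue"
        "(\<lambda>t. K_minus t \<omega>) \<in> borel_measurable lebesgue"
      using f by (auto simp: L2_clifford_def intro!: measurable_completion K_meas)
    have "(LINT t|lebesgue. K_minus t \<omega> \<odot> (g (t - x) *\<^sub>R f t))
        = (LINT t|lebesgue. K_minus t \<omega> \<odot> (g (t - x) *\<^sub>R F t))"
      by (rule integral_cong_AE) (use eq in auto)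
    also have "\<dots> = (LINT t|lborel. K_minus t \<omega> \<odot> (g (t - x) *\<^sub>R F t))"
      by (rule integral_completion) measurable
    finally show ?thesis by (simp add: clifford_STFT_def clifford_FT_def c_def)
  qed
  define V where "V z = cconj (clifford_FT (H1 (fst z)) (snd z)) \<odot> clifford_FT (H2 (fst z)) (snd z)" for z
  have stft: "(\<lambda>(x, \<omega>). cconj (clifford_STFT g1 f1 x \<omega>) \<odot> clifford_STFT g2 f2 x \<omega>) = (\<lambda>z. (c * c) *\<^sub>R V z)"
    by (rule ext) (simp add: case_prod_unfold STFT[OF assms(7) F1 F1f gm(1)] STFT[OF assms(8) F2 F2f
        gm(2)] V_def H1_def H2_def
        cconj_scaleR cmult.scaleR_left cmult.scaleR_right)
  have "V \<in> borel_measurable (lborel \<Otimes>\<^sub>M lborel)"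
    unfolding V_def[abs_def] clifford_FT_def H1_def H2_def by measurable
  then have Vm: "V \<in> borel_measurable (lborel \<Otimes>\<^sub>M lborel)" "V \<in> borel_measurable borel"
      by (simp_all add: lborel_prod)
  obtain K where K: "K \<ge> 0" "\<And>x y. norm (cconj x \<odot> (y :: 'n clifford)) \<le> norm x * norm y * K"
    using bounded_bilinear.nonneg_bounded[OF bounded_bilinear_cconj_cmult] by blast
  note cft = clifford_FT_norm_square[OF assms(1,2)] clifford_FT_plancherel[OF assms(1,2)]
  have cf: "integrable lborel (\<lambda>t. cconj (F1 t) \<odot> F2 t)"
    by (rule integrable_bilinear_L2(1)[OF bounded_bilinear_cconj_cmult K(2,1) _ _ L1 L2 zero_less_one])
        simp_all
  have i1: "(LINT \<omega>|lborel. (norm (clifford_FT (H1 x) \<omega>))\<^sup>2)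
      = (2 * pi) ^ CARD('n) * (LINT t|lborel. (g1 (t - x))\<^sup>2 *\<^sub>R (norm (F1 t))\<^sup>2)" for x
    unfolding cft(2)[OF adm1] by (simp add: H1_def power_mult_distrib)
  have i2: "(LINT \<omega>|lborel. (norm (clifford_FT (H2 x) \<omega>))\<^sup>2)
      = (2 * pi) ^ CARD('n) * (LINT t|lborel. (g2 (t - x))\<^sup>2 *\<^sub>R (norm (F2 t))\<^sup>2)" for x
    unfolding cft(2)[OF adm2] by (simp add: H2_def power_mult_distrib)
  \<comment> \<open>The norm of V is at most K / 2 times the sum of the squared norms of the two
    transforms. By Plancherel and averaging over x, their integrals are multiples of the integral of
    a squared window times that of |F1|^2 or |F2|^2, hence finite.\<close>
  have iV: "integrable (lborel \<Otimes>\<^sub>M lborel) V"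
  proof (rule lborel_pair.Fubini_integrable[OF Vm(1)])
    show "AE x in lborel. integrable lborel (\<lambda>\<omega>. V (x, \<omega>))"
      using cft(3)[OF adm1 adm2] by (simp add: V_def)
    show "integrable lborel (\<lambda>x. LINT \<omega>|lborel. norm (V (x, \<omega>)))"
    proof (rule integrable_norm_le)
      show "integrable lborel (\<lambda>x. K / 2 * ((LINT \<omega>|lborel. (norm (clifford_FT (H1 x) \<omega>))\<^sup>2) + (LINT
          \<omega>|lborel. (norm (clifford_FT (H2 x) \<omega>))\<^sup>2)))"
        unfolding i1 i2
        by (intro integrable_mult_right Bochner_Integration.integrable_add integral_window_average(1)
            schwartz_square_integrable assms L1 L2)
      show "(\<lambda>x. LINT \<omega>|lborel. norm (V (x, \<omega>))) \<in> borel_measurable lborel" using Vm(1) by measurable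
      fix x
      have "(LINT \<omega>|lborel. norm (V (x, \<omega>))) \<le> (LINT \<omega>|lborel. K / 2 * ((norm (clifford_FT (H1 x) \<omega>))\<^sup>2 +
          (norm (clifford_FT (H2 x) \<omega>))\<^sup>2))"
      proof (rule integral_mono)
        show "integrable lborel (\<lambda>\<omega>. norm (V (x, \<omega>)))"
          using cft(3)[OF adm1 adm2, of x x] by (intro integrable_norm) (simp add: V_def)
        show "integrable lborel (\<lambda>\<omega>. K / 2 * ((norm (clifford_FT (H1 x) \<omega>))\<^sup>2 + (norm (clifford_FT (H2 x)
            \<omega>))\<^sup>2))"
          using cft(1)[OF adm1] cft(1)[OF adm2] by simp
        fix \<omega>
        let ?a = "norm (clifford_FT (H1 x) \<omega>)" and ?b = "norm (clifford_FT (H2 x) \<omega>)"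
        have "?a * ?b \<le> (?a\<^sup>2 + ?b\<^sup>2) / 2"
          using sum_squares_bound[of ?a ?b] by (simp add: power2_eq_square)
        then have "?a * ?b * K \<le> (?a\<^sup>2 + ?b\<^sup>2) / 2 * K" using K(1) by (rule mult_right_mono)
        then show "norm (V (x, \<omega>)) \<le> K / 2 * (?a\<^sup>2 + ?b\<^sup>2)"
          using K(2)[of "clifford_FT (H1 x) \<omega>" "clifford_FT (H2 x) \<omega>"] by (simp add: V_def mult_ac)
      qed
      also have "\<dots> = K / 2 * ((LINT \<omega>|lborel. (norm (clifford_FT (H1 x) \<omega>))\<^sup>2) + (LINT \<omega>|lborel. (norm
          (clifford_FT (H2 x) \<omega>))\<^sup>2))"
        using cft(1)[OF adm1] cft(1)[OF adm2] by simp
      finally show "norm (LINT \<omega>|lborel. norm (V (x, \<omega>)))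
          \<le> K / 2 * ((LINT \<omega>|lborel. (norm (clifford_FT (H1 x) \<omega>))\<^sup>2) + (LINT \<omega>|lborel. (norm
              (clifford_FT (H2 x) \<omega>))\<^sup>2))" by simp
    qed
  qed
  have V1: "(LINT \<omega>|lborel. V (x, \<omega>)) = (2 * pi) ^ CARD('n) *\<^sub>R (LINT t|lborel. (g1 (t - x) * g2 (t - x))
      *\<^sub>R (cconj (F1 t) \<odot> F2 t))" for x
    using cft(4)[OF adm1 adm2, of x x]
    by (simp add: V_def H1_def H2_def cconj_scaleR cmult.scaleR_left cmult.scaleR_right mult.commute)
  have "(LINT z|lborel. V z) = (LINT x|lborel. LINT \<omega>|lborel. V (x, \<omega>))"
    using lborel_pair.integral_fst'[OF iV] by (simp add: lborel_prod)
  also have "\<dots> = (2 * pi) ^ CARD('n) *\<^sub>R ((LINT x|lborel. g1 x * g2 x) *\<^sub>R (LINT t|lborel. cconj (F1 t) \<odot>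
      F2 t))"
    unfolding V1 integral_scaleR_right
    using integral_window_average(2)[OF schwartz_product_integrable[OF assms(3,5)] cf] by simp
  finally have IV: "(LINT z|lborel. (c * c) *\<^sub>R V z)
      = (LINT x|lborel. g1 x * g2 x) *\<^sub>R (LINT t|lborel. cconj (F1 t) \<odot> F2 t)"
    using cc by (simp add: mult.assoc)
  have g: "(LINT z|lebesgue. g1 z * g2 z) = (LINT z|lborel. g1 z * g2 z)"
    by (rule integral_completion) measurable
  have f: "cinner f1 f2 = (LINT t|lborel. cconj (F1 t) \<odot> F2 t)"
  proof -
    have [measurable]: "F1 \<in> borel_measurable lebesgue" "f1 \<in> borel_measurable lebesgue" "F2 \<in>
        borel_measurable lebesgue" "f2 \<in> borel_measurable lebesgue"
      using assms(7,8) by (auto simp: L2_clifford_def intro!: measurable_completion)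
    have "cinner f1 f2 = (LINT t|lebesgue. cconj (F1 t) \<odot> F2 t)"
      unfolding cinner_def by (rule integral_cong_AE) (use F1f F2f in auto)
    also have "\<dots> = (LINT t|lborel. cconj (F1 t) \<odot> F2 t)" by (rule integral_completion) measurable
    finally show ?thesis .
  qed
  have m: "(\<lambda>z. (c * c) *\<^sub>R V z) \<in> borel_measurable lborel" using Vm(2) by measurable
  have "integrable lborel (\<lambda>z. (c * c) *\<^sub>R V z)" using iV by (simp add: lborel_prod)
  then show ?thesis
    unfolding stft g f IV[symmetric] has_bochner_integral_iff
    by (simp only: integrable_completion[OF m] integral_completion[OF m])
qed

end
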